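(* Let $k\ge 1$ and $\ell$ be integers with $1\le \ell\le k$ and $\gcd(\ell,k)=1$. Then for all sufficiently large $x$, $$\sum_{\substack{2\le n\le x\\ p(n)\equiv \ell \pmod k}}\mu(n)\omega(n)=O\!\left(\frac{x(\log\log x)^4}{\log x}\right),$$ where the implied constant may depend on $k$ and $\ell$.
   Context: $\mu$ is the Möbius function, $\omega(n)$ is the number of distinct prime factors of $n$, and for $n\ge 2$, $p(n)$ is the smallest prime factor of $n$. *)

theory Defs
  imports
    Complex_Main
    "HOL-Library.Landau_Symbols"
    "HOL-Computational_Algebra.Squarefree"
    "HOL-Number_Theory.Cong"
begin

definition omega :: "nat \<Rightarrow> nat" where
  "omega n = card (prime_factors n)"

definition moebius :: "nat \<Rightarrow> int" where
  "moebius n = (if squarefree n then (-1) ^ omega n else 0)"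

(* Only meaningful for n \<ge> 2; otherwise n has no least prime factor. *)
definition least_prime_factor :: "nat \<Rightarrow> nat" where
  "least_prime_factor n = Min (prime_factors n)"

end

theory Submission
  imports
    "HOL-Complex_Analysis.Complex_Analysis"
    "HOL-Probability.Probability"
    "HOL-Number_Theory.Prime_Powers"
    "HOL-Real_Asymp.Real_Asymp"
    Defs
begin

text \<open>
  Write \<open>n = p m\<close> with \<open>p\<close> the least prime factor of \<open>n\<close>, and let \<open>v\<close> be of order \<open>ln (ln x)\<close>.
  If \<open>p ^ (2 * (v + 1)) > x\<close>, then \<open>omega n\<close> is \<open>O(v)\<close> and an elementary upper bound sieve
  shows that there are \<open>O(x v ^ 3 / ln x)\<close> such \<open>n\<close>, which gives \<open>O(x v ^ 4 / ln x)\<close>.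

  For a smaller \<open>p\<close>, expanding \<open>omega\<close> over the prime divisors \<open>q\<close> of \<open>m\<close> turns the sum into
  sums of the Moebius function over integers \<open>\<le> t = x / (p q)\<close> that are free of primes \<open>\<le> p\<close> and of \<open>q\<close>.
  Such a sum is a sum of \<open>M(t / d)\<close> over integers \<open>d\<close> composed of the sifting primes, \<open>M\<close> being the
  summatory function of the Moebius function. If \<open>t \<ge> p ^ v\<close>, the bound \<open>M(N) = O(N / ln N ^ 4)\<close>
  and Rankin's trick for large \<open>d\<close> yield \<open>O(t / ln t ^ 3)\<close>; if \<open>t < p ^ v\<close>, one counts trivially,
  and the sum over \<open>q\<close> gains the factor \<open>1 / ln x\<close> from Chebyshev's bound. No cancellation between
  different \<open>p\<close> is needed, so that the condition on the residue class of \<open>p\<close> is dropped at once.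

  The bound for \<open>M\<close> needs no contour shift. By the 3-4-1 inequality and Cauchy's estimates, each
  derivative of \<open>1 / zeta\<close> is bounded by a power of \<open>ln t\<close> uniformly to the right of the line
  \<open>Re s = 1\<close>. Fourier inversion of the absolutely integrable transform \<open>1 / (s (s + 1))\<close> on the line
  \<open>Re s = 1 + 1 / ln x\<close> then bounds the Cesaro means of \<open>moebius n * ln n ^ 8\<close> by \<open>O(x)\<close>,
  and differencing and partial summation remove the smoothing and the logarithms.
\<close>

section \<open>The Moebius function and elementary prime sums\<close>

text \<open>Three of the four factors ln ln x come from \<open>exp_sum_prime_reciprocals_le\<close>:
  as only upper bounds of Chebyshev and Mertens type are proved, a product over the primes between z
  and z^w is bounded by a multiple of w^3 instead of w. The fourth factor is the sum of 1/p over
  small p, and the bound on omega for large p. The logarithms are budgeted backwards. A sifted sum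
  of size t / ln t ^ 3 can be majorised by a sum over m \<le> t of weights 1 / ln m ^ 3, and the sum
  of 1 / (m ln m ^ 3) converges; the harmonic sum over d costs one more logarithm, hence the fourth
  power in the bound for M. Differencing Cesaro means weighted by ln n ^ j and dividing the weight
  out again saves j/2 logarithms, hence j = 8. The smoothing answers an integrability problem: a
  sharp cutoff has the transform 1/s, which is not absolutely integrable on a vertical line, whereas
  1 / (s (s + 1)) even leaves room for a factor of size sqrt |t|. Powers of ln t may therefore be
  treated wastefully.\<close>

lemma moebius_0 [simp]: "moebius 0 = 0"
  by (simp add: moebius_def)

lemma moebius_1 [simp]: "moebius (Suc 0) = 1"
  by (simp add: moebius_def omega_def)

lemma abs_moebius_le: "\<bar>moebius n\<bar> \<le> 1"
  by (simp add: moebius_def power_abs)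

lemma omega_prime_mult:
  assumes "prime q" "m > 0"
  shows "omega (q * m) = (if q dvd m then omega m else Suc (omega m))"
proof -
  have "prime_factors (q * m) = insert q (prime_factors m)"
    using assms by (simp add: prime_factors_product prime_prime_factors)
  then show ?thesis
    using assms by (auto simp: omega_def card_insert_if in_prime_factors_iff)
qed

lemma moebius_prime_mult:
  assumes "prime q"
  shows "moebius (q * m) = (if q dvd m then 0 else - moebius m)"
proof (cases "q dvd m")
  case True
  then obtain k where "m = q * k" by blast
  then have "q ^ 2 dvd q * m" by (simp add: power2_eq_square)
  moreover have "\<not> is_unit q" using assms by (simp add: prime_nat_iff)
  ultimately have "\<not> squarefree (q * m)"
    unfolding squarefree_def by blast
  then show ?thesis using True by (simp add: moebius_def)
next
  case False
  then have m: "m > 0" by (cases m) auto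
  have "coprime q m" using False assms by (simp add: prime_imp_coprime)
  then have "squarefree (q * m) \<longleftrightarrow> squarefree m"
    using squarefree_mult_coprime squarefree_multD squarefree_prime assms by blast
  then show ?thesis using False m assms by (simp add: moebius_def omega_prime_mult)
qed

text \<open>Fix a prime q dividing n. The divisors not divisible by q cancel against their multiples
  by q, and all other divisors contain q^2.\<close>

lemma sum_moebius_divisors:
  assumes "n > 0"
  shows "(\<Sum>d | d dvd n. moebius d) = (if n = 1 then 1 else 0)"
proof (cases "n = 1")
  case False
  then obtain q where q: "prime q" "q dvd n" using prime_factor_nat by blast
  then obtain n' where n': "n = q * n'" by blast
  have fin: "finite {d. d dvd n}" "n' > 0" using assms n' by (auto intro: finite_divisors_nat)
  have split: "{d. d dvd n} = {d. d dvd n \<and> \<not> q dvd d} \<union> {d. d dvd n \<and> q dvd d}" by auto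
  have img: "{d. d dvd n \<and> q dvd d} = (\<lambda>e. q * e) ` {e. e dvd n'}"
    using q n' by (auto simp: prime_gt_0_nat elim!: dvdE)
  have inj: "inj_on (\<lambda>e. q * e) {e. e dvd n'}" using q by (auto simp: inj_on_def)
  have eq: "{d. d dvd n \<and> \<not> q dvd d} = {e. e dvd n' \<and> \<not> q dvd e}"
    using q n' by (auto intro: dvd_mult coprime_dvd_mult_right_iff[THEN iffD1, rotated] simp: prime_imp_coprime)
       (metis coprime_commute coprime_dvd_mult_right_iff prime_imp_coprime)
  have fin': "finite {e. e dvd n'}" using fin by (auto intro: finite_divisors_nat)
  have "(\<Sum>d | d dvd n \<and> q dvd d. moebius d) = (\<Sum>e | e dvd n'. moebius (q * e))"
    unfolding img by (simp add: sum.reindex[OF inj])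
  also have "\<dots> = (\<Sum>e | e dvd n'. if q dvd e then 0 else - moebius e)"
    using q by (intro sum.cong) (auto simp: moebius_prime_mult)
  also have "\<dots> = - (\<Sum>e | e dvd n' \<and> \<not> q dvd e. moebius e)"
    using fin' by (simp add: sum.If_cases sum_negf Int_def)
  finally show ?thesis using False fin eq unfolding split
    by (subst sum.union_disjoint) auto
qed (simp add: dvd_def)

lemma prod_primes_dvd:
  fixes N :: nat
  assumes "finite A" "\<And>p. p \<in> A \<Longrightarrow> prime p" "\<And>p. p \<in> A \<Longrightarrow> p dvd N"
  shows "\<Prod>A dvd N"
  using assms
proof (induction A rule: finite_induct)
  case (insert p A)
  have "coprime p (\<Prod>A)"
    using insert by (intro prod_coprime_right) (metis insertI1 insertI2 primes_coprime)
  then show ?case using insert by (auto intro: divides_mult)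
qed simp

section \<open>Upper bounds of Chebyshev and Mertens type for primes\<close>

lemma choose_odd_middle_le: "(2 * m + 1) choose m \<le> 4 ^ m"
proof -
  \<comment> \<open>The row has an even number of entries, so its two middle ones coincide; together
    they are at most the row sum.\<close>
  have "2 * ((2 * m + 1) choose m) = (\<Sum>k\<in>{m, m + 1}. (2 * m + 1) choose k)"
    using binomial_symmetric[of m "2 * m + 1"] by (simp add: mult_2)
  also have "\<dots> \<le> (\<Sum>k\<le>2 * m + 1. (2 * m + 1) choose k)"
    by (intro sum_mono2) auto
  also have "\<dots> = 2 ^ (2 * m + 1)" by (rule choose_row_sum)
  also have "\<dots> = 2 * 4 ^ m" by (simp add: power_mult)
  finally show ?thesis by simp
qed

lemma finite_primes_le [simp]: "finite {p::nat. prime p \<and> p \<le> n}"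
  by (rule finite_subset[of _ "{..n}"]) auto

lemma finite_primes_between [simp]: "finite {p::nat. prime p \<and> a < p \<and> p \<le> b}"
  by (rule finite_subset[of _ "{..b}"]) auto

lemma ln_4_le_2: "ln 4 \<le> (2::real)"
  using ln_realpow[of "2::real" 2] ln_le_minus_one[of "2::real"] by simp

lemma one_le_ln:
  assumes "x \<ge> (3::real)" shows "1 \<le> ln x"
  using e_less_272 assms by (subst ln_ge_iff) auto

text \<open>Erdos's argument: for n = 2m + 1 every prime in (m + 1, n] divides
  \<open>n choose m\<close>, and the primes up to m + 1 are left to the induction. An even n > 2
  contributes no new prime.\<close>

lemma primorial_le: "\<Prod>{p. prime p \<and> p \<le> n} \<le> (4::nat) ^ n"
proof (induction n rule: less_induct)
  case (less n)
  consider "n \<le> 1" | "n = 2" | "n > 2" "even n" | "n > 2" "odd n" by fastforce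
  then show ?case
  proof cases
    case 1
    then have e: "{p::nat. prime p \<and> p \<le> n} = {}" by (auto dest: prime_gt_1_nat)
    show ?thesis unfolding e by simp
  next
    case 2
    then have "{p::nat. prime p \<and> p \<le> n} = {2}"
      by (auto dest: prime_ge_2_nat intro!: le_antisym)
    then show ?thesis using 2 by simp
  next
    case 3
    then have "\<not> prime n" using prime_odd_nat by blast
    then have "{p::nat. prime p \<and> p \<le> n} = {p. prime p \<and> p \<le> n - 1}"
      using 3 by (auto simp: le_diff_conv2 Suc_le_eq nat_less_le)
    moreover have "(4::nat) ^ (n - 1) \<le> 4 ^ n" by (intro power_increasing) auto
    ultimately show ?thesis using less.IH[of "n - 1"] 3 by (metis le_trans diff_less zero_less_one less_trans pos2)
  next
    case 4
    then obtain m where m: "n = 2 * m + 1" by (auto elim: oddE)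
    then have m0: "m > 0" using 4 by auto
    let ?B = "{p. prime p \<and> m + 1 < p \<and> p \<le> n}"
    have "\<Prod>?B dvd (n choose m)"
    proof (rule prod_primes_dvd)
      show "finite ?B" by simp
      fix p assume p: "p \<in> ?B"
      have "fact m * fact (n - m) * (n choose m) = (fact n :: nat)"
        by (rule binomial_fact_lemma) (use m in auto)
      moreover have "p dvd fact n" using p by (auto simp: prime_dvd_fact_iff)
      ultimately have "p dvd fact m * fact (n - m) * (n choose m)" by simp
      moreover have "\<not> p dvd fact m" "\<not> p dvd fact (n - m)"
        using p m prime_dvd_fact_iff[of p m] prime_dvd_fact_iff[of p "n - m"] by auto
      ultimately show "p dvd (n choose m)" using p by (auto simp: prime_dvd_mult_iff)
    qed auto
    then have "\<Prod>?B \<le> 4 ^ m"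
      using choose_odd_middle_le[of m] m dvd_imp_le[of "\<Prod>?B" "n choose m"] by simp
    moreover have "{p. prime p \<and> p \<le> n} = {p. prime p \<and> p \<le> m + 1} \<union> ?B" using m by auto
    then have "\<Prod>{p. prime p \<and> p \<le> n} = \<Prod>{p. prime p \<and> p \<le> m + 1} * \<Prod>?B"
      by (simp add: prod.union_disjoint disjoint_iff)
    moreover have "\<Prod>{p. prime p \<and> p \<le> m + 1} \<le> 4 ^ (m + 1)"
      using less.IH[of "m + 1"] m m0 by simp
    ultimately have "\<Prod>{p. prime p \<and> p \<le> n} \<le> 4 ^ (m + 1) * 4 ^ m"
      by (simp add: mult_le_mono)
    also have "\<dots> = 4 ^ n" using m by (simp add: power_add[symmetric] mult_2)
    finally show ?thesis .
  qed
qed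

lemma theta_le: "(\<Sum>p | prime p \<and> p \<le> n. ln (real p)) \<le> ln 4 * real n"
proof -
  have "(\<Sum>p | prime p \<and> p \<le> n. ln (real p)) = ln (\<Prod>p | prime p \<and> p \<le> n. real p)"
    by (intro ln_prod[symmetric]) (auto simp: prime_gt_0_nat)
  also have "\<dots> = ln (real (\<Prod>{p. prime p \<and> p \<le> n}))" by simp
  also have "\<dots> \<le> ln (real (4 ^ n))"
    by (subst ln_le_cancel_iff) (use primorial_le[of n] in \<open>auto simp: prod_pos prime_gt_0_nat simp del: of_nat_prod of_nat_power\<close>)
  also have "\<dots> = ln 4 * real n" by (simp add: ln_realpow)
  finally show ?thesis .
qed

lemma sum_ln_prime_factors_le:
  assumes "n > 0"
  shows "(\<Sum>p\<in>prime_factors n. ln (real p)) \<le> ln (real n)"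
proof -
  have "\<Prod>(prime_factors n) dvd n" by (rule prod_primes_dvd) auto
  then have le: "\<Prod>(prime_factors n) \<le> n" using assms by (simp add: dvd_imp_le)
  have "(\<Sum>p\<in>prime_factors n. ln (real p)) = ln (\<Prod>p\<in>prime_factors n. real p)"
    by (intro ln_prod[symmetric]) (auto simp: prime_gt_0_nat in_prime_factors_iff)
  also have "\<dots> = ln (real (\<Prod>(prime_factors n)))" by simp
  also have "\<dots> \<le> ln (real n)"
    by (subst ln_le_cancel_iff) (use le assms in \<open>auto simp: prod_pos prime_gt_0_nat in_prime_factors_iff simp del: of_nat_prod\<close>)
  finally show ?thesis .
qed

lemma card_multiples:
  assumes "r > 0"
  shows "card {n. 0 < n \<and> n \<le> X \<and> r dvd n} = X div (r::nat)"
proof -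
  have "{n. 0 < n \<and> n \<le> X \<and> r dvd n} = (\<lambda>k. r * k) ` {1..X div r}"
    using assms by (auto simp: less_eq_div_iff_mult_less_eq mult.commute elim!: dvdE)
  then show ?thesis using assms by (simp add: card_image inj_on_def)
qed

text \<open>Upper half of Mertens' first theorem. Pairs (p, n) with p dividing n \<le> X, weighted
  by ln p, are counted in two ways; rounding X / p to \<open>X div p\<close> costs theta(X), which
  Chebyshev's bound \<open>theta_le\<close> controls.\<close>

lemma sum_ln_over_primes_le:
  assumes "X > 0"
  shows "(\<Sum>p | prime p \<and> p \<le> X. ln (real p) / real p) \<le> ln (real X) + ln 4"
proof -
  let ?P = "{p. prime p \<and> p \<le> X}"
  have "(\<Sum>p\<in>?P. ln (real p) * (X div p)) = (\<Sum>p\<in>?P. \<Sum>n | n \<in> {1..X} \<and> p dvd n. ln (real p))"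
  proof (intro sum.cong refl)
    fix p assume "p \<in> ?P"
    then have "p > 0" by (auto simp: prime_gt_0_nat)
    moreover have "{n. n \<in> {1..X} \<and> p dvd n} = {n. 0 < n \<and> n \<le> X \<and> p dvd n}" by auto
    ultimately show "ln (real p) * (X div p) = (\<Sum>n | n \<in> {1..X} \<and> p dvd n. ln (real p))"
      by (simp add: card_multiples)
  qed
  also have "\<dots> = (\<Sum>n\<in>{1..X}. \<Sum>p | p \<in> ?P \<and> p dvd n. ln (real p))"
    by (rule sum.swap_restrict) auto
  also have "\<dots> = (\<Sum>n\<in>{1..X}. \<Sum>p\<in>prime_factors n. ln (real p))"
  proof (intro sum.cong refl)
    fix n assume n: "n \<in> {1..X}"
    have "p \<le> X" if "p dvd n" for p using dvd_imp_le[OF that] n by simp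
    then show "{p. p \<in> ?P \<and> p dvd n} = prime_factors n"
      using n by (auto simp: in_prime_factors_iff)
  qed
  also have "\<dots> \<le> (\<Sum>n\<in>{1..X}. ln (real X))"
  proof (rule sum_mono)
    fix n assume n: "n \<in> {1..X}"
    then have "ln (real n) \<le> ln (real X)" by simp
    then show "(\<Sum>p\<in>prime_factors n. ln (real p)) \<le> ln (real X)"
      using sum_ln_prime_factors_le[of n] n order_trans by fastforce
  qed
  finally have 1: "(\<Sum>p\<in>?P. ln (real p) * (X div p)) \<le> X * ln (real X)" by simp
  have "(\<Sum>p\<in>?P. ln (real p) * (real X / real p - 1)) \<le> (\<Sum>p\<in>?P. ln (real p) * (X div p))"
  proof (intro sum_mono mult_left_mono)
    fix p assume "p \<in> ?P"
    then have p: "p > 0" by (auto simp: prime_gt_0_nat)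
    have "X < (X div p + 1) * p"
      using p dividend_less_times_div[of p X] by (simp add: mult.commute)
    then have "real X < real ((X div p + 1) * p)" by (subst of_nat_less_iff)
    then have "real X / real p < real (X div p) + 1"
      using p by (simp add: divide_simps algebra_simps)
    then show "real X / real p - 1 \<le> real (X div p)" by simp
    show "0 \<le> ln (real p)" using p by simp
  qed
  also have "(\<Sum>p\<in>?P. ln (real p) * (real X / real p - 1)) =
      real X * (\<Sum>p\<in>?P. ln (real p) / real p) - (\<Sum>p\<in>?P. ln (real p))"
    by (simp add: sum_subtractf right_diff_distrib sum_distrib_left mult_ac)
  finally have "real X * (\<Sum>p\<in>?P. ln (real p) / real p) \<le> X * ln (real X) + ln 4 * X"
    using 1 theta_le[of X] by linarith
  also have "\<dots> = real X * (ln (real X) + ln 4)" by (simp add: algebra_simps)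
  finally show ?thesis using assms by simp
qed

text \<open>On this interval ln p is at least ln z, so the previous bound may be divided by ln z.
  Without a matching lower bound for the primes up to z, the main term is 2 instead of the true ln
  2.\<close>

lemma sum_prime_reciprocals_square:
  assumes "z \<ge> 2"
  shows "(\<Sum>p | prime p \<and> z < p \<and> p \<le> z ^ 2. 1 / real p) \<le> 2 + ln 4 / ln (real z)"
proof -
  let ?B = "{p. prime p \<and> z < p \<and> p \<le> z ^ 2}"
  have lz: "ln (real z) > 0" using assms by simp
  have "ln (real z) * (\<Sum>p\<in>?B. 1 / real p) \<le> (\<Sum>p\<in>?B. ln (real p) / real p)"
    unfolding sum_distrib_left
    by (intro sum_mono) (use assms in \<open>auto simp: field_simps\<close>)
  also have "\<dots> \<le> (\<Sum>p | prime p \<and> p \<le> z ^ 2. ln (real p) / real p)"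
    by (intro sum_mono2) (auto simp: prime_gt_0_nat Suc_le_eq)
  also have "\<dots> \<le> ln (real (z ^ 2)) + ln 4" by (rule sum_ln_over_primes_le) (use assms in simp)
  also have "\<dots> = ln (real z) * (2 + ln 4 / ln (real z))"
    using lz assms by (simp add: field_simps ln_realpow)
  finally show ?thesis using lz by simp
qed

text \<open>Squaring z doubles ln z, so the error terms ln 4 / ln z halve from step to step and add
  up to at most twice the first one.\<close>

lemma sum_prime_reciprocals_power2:
  assumes "z \<ge> 2"
  shows "(\<Sum>p | prime p \<and> z < p \<and> p \<le> z ^ (2 ^ j). 1 / real p)
           \<le> 2 * real j + 2 * ln 4 / ln (real z)"
  using assms
proof (induction j arbitrary: z)
  case 0
  have "{p. prime p \<and> z < p \<and> p \<le> z ^ (2 ^ 0)} = {}" by auto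
  then show ?case using 0 by (simp only: sum.empty) simp
next
  case (Suc j)
  have lz: "ln (real z) > 0" using Suc.prems by simp
  have z2: "z ^ 2 \<ge> 2" using Suc.prems using power_increasing[of 1 2 z] by simp
  have pw: "z ^ (2 ^ Suc j) = (z ^ 2) ^ (2 ^ j)" by (simp add: power_mult)
  have "{p. prime p \<and> z < p \<and> p \<le> z ^ (2 ^ Suc j)} \<subseteq>
      {p. prime p \<and> z < p \<and> p \<le> z ^ 2} \<union> {p. prime p \<and> z ^ 2 < p \<and> p \<le> (z ^ 2) ^ (2 ^ j)}"
    unfolding pw by auto
  then have "(\<Sum>p | prime p \<and> z < p \<and> p \<le> z ^ (2 ^ Suc j). 1 / real p) \<le>
      (\<Sum>p\<in>{p. prime p \<and> z < p \<and> p \<le> z ^ 2} \<union> {p. prime p \<and> z ^ 2 < p \<and> p \<le> (z ^ 2) ^ (2 ^ j)}. 1 / real p)"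
    by (intro sum_mono2) auto
  also have "\<dots> = (\<Sum>p | prime p \<and> z < p \<and> p \<le> z ^ 2. 1 / real p) +
      (\<Sum>p | prime p \<and> z ^ 2 < p \<and> p \<le> (z ^ 2) ^ (2 ^ j). 1 / real p)"
    by (intro sum.union_disjoint) auto
  also have "\<dots> \<le> (2 + ln 4 / ln (real z)) + (2 * real j + 2 * ln 4 / ln (real (z ^ 2)))"
    by (intro add_mono sum_prime_reciprocals_square Suc.IH Suc.prems z2)
  also have "\<dots> = 2 * real (Suc j) + 2 * ln 4 / ln (real z)"
    using lz Suc.prems by (simp add: field_simps ln_realpow)
  finally show ?case .
qed

text \<open>Take 2^j between w and 2w. As e^2 < 8 = 2^3, a doubling of the exponent costs a factor
  8, which gives the cube of 2^j \<le> 2w; exp 4 is the total error term in the worst case z =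
  2.\<close>

lemma exp_sum_prime_reciprocals_le:
  assumes "z \<ge> 2" "w \<ge> 1"
  shows "exp (\<Sum>p | prime p \<and> z < p \<and> p \<le> z ^ w. 1 / real p) \<le> 8 * exp 4 * real w ^ 3"
proof -
  have "\<exists>j. w \<le> 2 ^ j \<and> 2 ^ j \<le> 2 * w"
    using assms(2)
  proof (induction w rule: dec_induct)
    case (step n)
    then obtain j where "n \<le> 2 ^ j" "2 ^ j \<le> 2 * n" by auto
    then show ?case by (cases "n = 2 ^ j") (auto intro: exI[of _ "Suc j"] exI[of _ j])
  qed (auto intro: exI[of _ 0])
  then obtain j where j: "w \<le> 2 ^ j" "2 ^ j \<le> 2 * w" by blast
  have "z ^ w \<le> z ^ (2 ^ j)" using j assms by (intro power_increasing) auto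
  then have "(\<Sum>p | prime p \<and> z < p \<and> p \<le> z ^ w. 1 / real p)
      \<le> (\<Sum>p | prime p \<and> z < p \<and> p \<le> z ^ (2 ^ j). 1 / real p)"
    by (intro sum_mono2) auto
  also have "\<dots> \<le> 2 * real j + 2 * ln 4 / ln (real z)"
    by (rule sum_prime_reciprocals_power2) fact
  also have "2 * ln 4 / ln (real z) \<le> 4"
  proof -
    have "ln (2::real) \<le> ln (real z)" using assms by simp
    moreover have "ln (4::real) = 2 * ln 2" using ln_realpow[of 2 2] by simp
    ultimately show ?thesis using assms by (simp add: field_simps)
  qed
  finally have "exp (\<Sum>p | prime p \<and> z < p \<and> p \<le> z ^ w. 1 / real p) \<le> exp (2 * real j + 4)" by simp
  also have "\<dots> = exp 4 * exp 2 ^ j" by (simp add: exp_add exp_of_nat2_mult[symmetric] mult.commute)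
  also have "exp 2 = exp (1::real) ^ (2::nat)" by (simp add: exp_of_nat_mult[symmetric])
  also have "exp 1 ^ (2::nat) \<le> (8::real)"
  proof -
    have "exp 1 ^ 2 \<le> (2.72::real) ^ 2" using e_less_272 by (intro power_mono) auto
    then show ?thesis by (simp add: power2_eq_square)
  qed
  then have "exp 4 * (exp 1 ^ (2::nat)) ^ j \<le> exp 4 * (8::real) ^ j"
    by (intro mult_left_mono power_mono) auto
  also have "(8::real) ^ j = (2 ^ j) ^ 3" by (simp add: power_mult[symmetric] mult.commute[of j] power_mult[of _ 3])
  also have "(2::real) ^ j \<le> 2 * real w" using j(2) by (metis of_nat_le_iff of_nat_mult of_nat_numeral of_nat_power)
  then have "exp 4 * ((2::real) ^ j) ^ 3 \<le> exp 4 * (2 * real w) ^ 3"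
    by (intro mult_left_mono power_mono) auto
  finally show ?thesis by (simp add: power_mult_distrib mult_ac)
qed

lemma sum_prime_reciprocals_le:
  assumes "X \<ge> 3"
  shows "(\<Sum>p | prime p \<and> p \<le> X. 1 / real p) \<le> 3 * ln (ln (real X)) + 12"
proof -
  have l1: "ln (real X) \<ge> 1" using assms by (intro one_le_ln) simp
  \<comment> \<open>As ln 2 exceeds 1/2, this choice makes 2^w at least X, so that the bound for z =
    2 covers all primes in question.\<close>
  define w where "w = nat \<lceil>2 * ln (real X)\<rceil>"
  have w: "real w \<ge> 2 * ln (real X)" "real w \<le> 2 * ln (real X) + 1" "w \<ge> 1"
    using l1 unfolding w_def by linarith+
  have "ln 2 \<ge> (1/2::real)" using ln2_ge_two_thirds by simp
  then have "ln (real X) \<le> real w * ln 2"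
    using w(1) l1 mult_mono[of "2 * ln (real X)" "real w" "1/2" "ln 2"] by simp
  then have "ln (real X) \<le> ln (2 ^ w)" by (simp add: ln_realpow)
  then have "real X \<le> 2 ^ w" using assms by simp
  then have X: "X \<le> 2 ^ w" by (metis of_nat_le_iff of_nat_numeral of_nat_power)
  let ?S = "\<Sum>p | prime p \<and> 2 < p \<and> p \<le> 2 ^ w. 1 / real p"
  have "(\<Sum>p | prime p \<and> p \<le> X. 1 / real p) \<le> (\<Sum>p\<in>insert 2 {p. prime p \<and> 2 < p \<and> p \<le> 2 ^ w}. 1 / real p)"
    using X by (intro sum_mono2) (auto dest: prime_ge_2_nat)
  also have "\<dots> = 1 / 2 + ?S" by simp
  also have "?S = ln (exp ?S)" by simp
  also have "\<dots> \<le> ln (8 * exp 4 * real w ^ 3)"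
    using exp_sum_prime_reciprocals_le[of 2 w] w(3) by (subst ln_le_cancel_iff) auto
  also have "\<dots> = ln 8 + 4 + 3 * ln (real w)" using w(3) by (simp add: ln_mult ln_realpow)
  also have "ln (real w) \<le> ln (3 * ln (real X))" using w l1 by (subst ln_le_cancel_iff) auto
  also have "ln (3 * ln (real X)) = ln 3 + ln (ln (real X))" using l1 by (simp add: ln_mult)
  also have "ln 8 = 3 * ln (2::real)" using ln_realpow[of 2 3] by simp
  also have "ln (2::real) \<le> 1" using ln_le_minus_one[of 2] by simp
  also have "ln (3::real) \<le> 3/2"
    using ln_le_minus_one[of "3/2"] \<open>ln (2::real) \<le> 1\<close> ln_div[of 3 2] by simp
  finally show ?thesis by simp
qed

lemma sum_reciprocals_le:
  assumes "n > 0" shows "(\<Sum>m\<in>{1..n}. 1 / real m) \<le> 1 + ln (real n)"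
  using assms
proof (induction n rule: nat_induct_non_zero)
  case (Suc n)
  have "1 / real (Suc n) \<le> ln (real (Suc n)) - ln (real n)"
    using ln_diff_le[of "real n" "real (Suc n)"] Suc by (simp add: field_simps)
  then show ?case using Suc by simp
qed simp

lemma sqrt_le_over_ln:
  assumes "n \<ge> (2::nat)"
  shows "sqrt (real n) \<le> 2 * real n / ln (real n)"
proof -
  have "ln (sqrt (real n)) \<le> sqrt (real n)" using assms ln_le_minus_one[of "sqrt (real n)"] by simp
  then have "ln (real n) \<le> 2 * sqrt (real n)" using assms by (simp add: ln_sqrt)
  then have "sqrt (real n) * ln (real n) \<le> sqrt (real n) * (2 * sqrt (real n))" by (intro mult_left_mono) auto
  also have "\<dots> = 2 * (sqrt (real n) * sqrt (real n))" by (simp only: mult.left_commute)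
  also have "\<dots> = 2 * real n" by (simp only: real_sqrt_mult_self abs_of_nat)
  finally show ?thesis using assms by (simp add: pos_le_divide_eq)
qed

text \<open>Primes above sqrt n have logarithm at least half of ln n, so theta(n) counts them up to
  this factor; the others number at most sqrt n.\<close>

lemma card_primes_le:
  assumes "n \<ge> 2"
  shows "real (card {p. prime p \<and> p \<le> n}) \<le> 6 * real n / ln (real n)"
proof -
  have ln: "ln (real n) > 0" using assms by simp
  let ?A = "{p. prime p \<and> real p \<le> sqrt n}" and ?B = "{p. prime p \<and> sqrt n < real p \<and> p \<le> n}"
  have finB: "finite ?B" by (rule finite_subset[of _ "{..n}"]) auto
  have A: "?A \<subseteq> {1..nat \<lfloor>sqrt n\<rfloor>}" by (auto simp: le_nat_floor Suc_le_eq prime_gt_0_nat)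
  have cA: "real (card ?A) \<le> sqrt n"
  proof -
    have "card ?A \<le> card {1..nat \<lfloor>sqrt n\<rfloor>}" by (intro card_mono A) auto
    then have "real (card ?A) \<le> real (nat \<lfloor>sqrt n\<rfloor>)"
      by (simp only: card_atLeastAtMost of_nat_le_iff diff_Suc_1)
    also have "\<dots> \<le> sqrt n" by (rule of_nat_floor) simp
    finally show ?thesis .
  qed
  have "ln (real n) / 2 * card ?B \<le> (\<Sum>p\<in>?B. ln (real p))"
  proof -
    have "(\<Sum>p\<in>?B. ln (real n) / 2) \<le> (\<Sum>p\<in>?B. ln (real p))"
    proof (rule sum_mono)
      fix p assume "p \<in> ?B"
      then have "ln (sqrt n) \<le> ln (real p)" using assms by (subst ln_le_cancel_iff) (auto simp: prime_gt_0_nat)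
      then show "ln (real n) / 2 \<le> ln (real p)" using assms by (simp add: ln_sqrt)
    qed
    then show ?thesis by (simp add: mult.commute)
  qed
  also have "\<dots> \<le> (\<Sum>p | prime p \<and> p \<le> n. ln (real p))"
    by (intro sum_mono2) (auto simp: prime_gt_0_nat Suc_le_eq)
  also have "\<dots> \<le> ln 4 * n" by (rule theta_le)
  also have "\<dots> \<le> 2 * n"
    using mult_right_mono[OF ln_4_le_2, of "real n"] by simp
  finally have cB: "real (card ?B) \<le> 4 * n / ln n" using ln by (simp add: field_simps)
  have s: "sqrt (real n) \<le> 2 * real n / ln (real n)" by (rule sqrt_le_over_ln[OF assms])
  have "{p. prime p \<and> p \<le> n} \<subseteq> ?A \<union> ?B" by auto
  then have "card {p. prime p \<and> p \<le> n} \<le> card (?A \<union> ?B)"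
    using finB A by (intro card_mono) (auto intro: finite_subset)
  also have "\<dots> \<le> card ?A + card ?B" by (rule card_Un_le)
  finally have "real (card {p. prime p \<and> p \<le> n}) \<le> real (card ?A) + real (card ?B)" by linarith
  moreover have "4 * n / ln n + 2 * n / ln n = 6 * n / ln n"
    by (simp add: add_divide_distrib[symmetric])
  ultimately show ?thesis using cA cB s by linarith
qed

section \<open>Sums over smooth numbers and sifted sums\<close>

text \<open>P is not an initial segment of the primes in general: below it is the set of primes up
  to p with one more prime q, or the set of primes of an interval.\<close>

definition smooths :: "nat set \<Rightarrow> nat \<Rightarrow> nat set" where
  "smooths P X = {d. 0 < d \<and> d \<le> X \<and> prime_factors d \<subseteq> P}"

lemma finite_smooths [simp]: "finite (smooths P X)"
  unfolding smooths_def by (rule finite_subset[of _ "{..X}"]) auto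

lemma smooths_empty: "smooths {} X = (if X = 0 then {} else {1})"
  by (auto simp: smooths_def prime_factorization_empty_iff)

lemma smooths_mono: "X \<le> Y \<Longrightarrow> smooths P X \<subseteq> smooths P Y"
  by (auto simp: smooths_def)

text \<open>An element either avoids q or is q times an element that may contain q again. Hence q
  stays in the set of the second part and only the bound decreases.\<close>

lemma smooths_insert:
  assumes "prime q" "q \<notin> P"
  shows "smooths (insert q P) X = smooths P X \<union> (\<lambda>d. q * d) ` smooths (insert q P) (X div q)"
    and "smooths P X \<inter> (\<lambda>d. q * d) ` smooths (insert q P) (X div q) = {}"
proof -
  have q: "q > 0" using assms prime_gt_0_nat by blast
  have pf: "prime_factors (q * d) = insert q (prime_factors d)" if "d > 0" for d
    using assms that by (simp add: prime_factors_product prime_prime_factors)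
  show "smooths (insert q P) X = smooths P X \<union> (\<lambda>d. q * d) ` smooths (insert q P) (X div q)"
    (is "?L = ?R")
  proof
    show "?R \<subseteq> ?L"
      using q pf by (auto simp: smooths_def less_eq_div_iff_mult_less_eq mult.commute)
    show "?L \<subseteq> ?R"
    proof
      fix d assume d: "d \<in> ?L"
      show "d \<in> ?R"
      proof (cases "q dvd d")
        case True
        then obtain e where e: "d = q * e" by blast
        then have "e \<in> smooths (insert q P) (X div q)"
          using d q pf[of e] by (auto simp: smooths_def less_eq_div_iff_mult_less_eq mult.commute)
        then show ?thesis using e by auto
      next
        case False
        then show ?thesis using d by (auto simp: smooths_def in_prime_factors_iff)
      qed
    qed
  qed
  show "smooths P X \<inter> (\<lambda>d. q * d) ` smooths (insert q P) (X div q) = {}"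
    using pf assms by (auto simp: smooths_def)
qed

lemma sum_smooths_insert:
  assumes "prime q" "q \<notin> P"
  shows "(\<Sum>d\<in>smooths (insert q P) X. f d :: 'a :: comm_monoid_add) =
    (\<Sum>d\<in>smooths P X. f d) + (\<Sum>d\<in>smooths (insert q P) (X div q). f (q * d))"
proof -
  have "inj_on (\<lambda>d. q * d) S" for S using assms by (auto simp: inj_on_def)
  then show ?thesis
    using smooths_insert[OF assms, of X] by (simp add: sum.union_disjoint sum.reindex)
qed

text \<open>Euler product bound without infinite products. In the recursion the inner sum over
  \<open>X div q\<close> is at most the whole sum S, so S \<le> S' + g(q) S, where S' is the sum for
  P, and this is solved for S.\<close>

lemma sum_smooths_mult_le:
  fixes g :: "nat \<Rightarrow> real"
  assumes "finite P" "\<And>q. q \<in> P \<Longrightarrow> prime q" "\<And>q. q \<in> P \<Longrightarrow> g q < 1"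
    and "g 1 = 1" "\<And>a b. g (a * b) = g a * g b" "\<And>a. g a \<ge> 0"
  shows "(\<Sum>d\<in>smooths P X. g d) \<le> (\<Prod>q\<in>P. 1 / (1 - g q))"
  using assms(1-3)
proof (induction P rule: finite_induct)
  case empty
  then show ?case using assms by (simp add: smooths_empty)
next
  case (insert q P)
  let ?S = "\<Sum>d\<in>smooths (insert q P) X. g d"
  have eq: "?S = (\<Sum>d\<in>smooths P X. g d) + g q * (\<Sum>d\<in>smooths (insert q P) (X div q). g d)"
    using insert by (subst sum_smooths_insert) (auto simp: assms sum_distrib_left)
  have "(\<Sum>d\<in>smooths (insert q P) (X div q). g d) \<le> ?S"
    by (intro sum_mono2 smooths_mono) (auto simp: assms)
  then have "g q * (\<Sum>d\<in>smooths (insert q P) (X div q). g d) \<le> g q * ?S"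
    by (intro mult_left_mono assms)
  moreover have "(\<Sum>d\<in>smooths P X. g d) \<le> (\<Prod>q\<in>P. 1 / (1 - g q))" using insert by auto
  ultimately have "?S * (1 - g q) \<le> (\<Prod>q\<in>P. 1 / (1 - g q))"
    using eq by (simp add: algebra_simps)
  then have "?S \<le> (\<Prod>q\<in>P. 1 / (1 - g q)) / (1 - g q)"
    using insert by (simp add: pos_le_divide_eq)
  then show ?case using insert by simp
qed

text \<open>A squarefree number contains q at most once, so the Euler factor is 1 + 1/q, which is at
  most exp (1/q).\<close>

lemma sum_squarefree_reciprocals_le:
  assumes "finite P" "\<And>q. q \<in> P \<Longrightarrow> prime q"
  shows "(\<Sum>d | d \<in> smooths P X \<and> squarefree d. 1 / real d) \<le> exp (\<Sum>q\<in>P. 1 / real q)"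
proof -
  have "(\<Sum>d\<in>smooths P X. if squarefree d then 1 / real d else 0) \<le> (\<Prod>q\<in>P. 1 + 1 / real q)"
    using assms
  proof (induction P arbitrary: X rule: finite_induct)
    case empty
    then show ?case by (simp add: smooths_empty)
  next
    case (insert q P)
    let ?g = "\<lambda>d. if squarefree d then 1 / real d else 0"
    have q: "prime q" using insert by auto
    have "?g (q * d) \<le> (if q dvd d then 0 else ?g d / real q)" for d
    proof (cases "squarefree (q * d)")
      case True
      then have "squarefree d" using squarefree_mono by (metis dvd_triv_right)
      moreover have "\<not> q dvd d"
      proof
        assume "q dvd d"
        then have "q ^ 2 dvd q * d" by (simp add: power2_eq_square)
        then show False using True q squarefreeD[of "q * d" q] by auto
      qed
      ultimately show ?thesis by (simp add: mult.commute)
    qed auto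
    then have "(\<Sum>d\<in>smooths (insert q P) (X div q). ?g (q * d))
        \<le> (\<Sum>d\<in>smooths (insert q P) (X div q). if q dvd d then 0 else ?g d / real q)"
      by (rule sum_mono)
    also have "\<dots> = (\<Sum>d | d \<in> smooths (insert q P) (X div q) \<and> \<not> q dvd d. ?g d / real q)"
      by (simp add: sum.If_cases Int_def cong: if_cong)
    also have "{d \<in> smooths (insert q P) (X div q). \<not> q dvd d} \<subseteq> smooths P (X div q)"
      by (auto simp: smooths_def in_prime_factors_iff)
    then have "(\<Sum>d | d \<in> smooths (insert q P) (X div q) \<and> \<not> q dvd d. ?g d / real q) \<le>
        (\<Sum>d\<in>smooths P (X div q). ?g d / real q)"
      by (intro sum_mono2) auto
    also have "\<dots> = (\<Sum>d\<in>smooths P (X div q). ?g d) * (1 / real q)"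
      by (simp add: sum_divide_distrib)
    also have "\<dots> \<le> (\<Prod>q\<in>P. 1 + 1 / real q) * (1 / real q)"
      using insert by (intro mult_right_mono) auto
    finally have "(\<Sum>d\<in>smooths (insert q P) X. ?g d)
        \<le> (\<Prod>q\<in>P. 1 + 1 / real q) + (\<Prod>q\<in>P. 1 + 1 / real q) * (1 / real q)"
      using insert by (subst sum_smooths_insert) (auto intro: add_mono)
    then show ?case using insert by (simp add: algebra_simps)
  qed
  also have "\<dots> \<le> (\<Prod>q\<in>P. exp (1 / real q))"
    by (intro prod_mono) (auto simp: exp_ge_add_one_self)
  also have "\<dots> = exp (\<Sum>q\<in>P. 1 / real q)" using assms by (simp add: exp_sum)
  finally show ?thesis by (simp add: sum.If_cases Int_def)
qed

section \<open>Moebius sums over integers free of given primes\<close>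

definition mertens :: "nat \<Rightarrow> real" where
  "mertens n = (\<Sum>m\<in>{1..n}. real_of_int (moebius m))"

lemma abs_mertens_le: "\<bar>mertens n\<bar> \<le> real n"
proof -
  have "\<bar>mertens n\<bar> \<le> (\<Sum>m\<in>{1..n}. \<bar>real_of_int (moebius m)\<bar>)"
    unfolding mertens_def by (rule sum_abs)
  also have "\<dots> \<le> (\<Sum>m\<in>{1..n}. 1)"
    by (intro sum_mono) (metis abs_moebius_le of_int_abs of_int_le_1_iff)
  finally show ?thesis by simp
qed

definition mertens_sifted :: "nat set \<Rightarrow> nat \<Rightarrow> real" where
  "mertens_sifted P n = (\<Sum>m | m \<in> {1..n} \<and> (\<forall>q\<in>P. \<not> q dvd m). real_of_int (moebius m))"

lemma mertens_sifted_insert: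
  assumes "prime q" "q \<notin> P" "\<And>r. r \<in> P \<Longrightarrow> prime r"
  shows "mertens_sifted (insert q P) n = mertens_sifted P n + mertens_sifted (insert q P) (n div q)"
proof -
  have q: "q > 0" using assms prime_gt_0_nat by blast
  let ?f = "\<lambda>m. real_of_int (moebius m)"
  let ?A = "{m. m \<in> {1..n} \<and> (\<forall>r\<in>insert q P. \<not> r dvd m)}"
  let ?B = "{m. m \<in> {1..n div q} \<and> (\<forall>r\<in>P. \<not> r dvd m)}"
  have split: "{m. m \<in> {1..n} \<and> (\<forall>r\<in>P. \<not> r dvd m)} = ?A \<union> (\<lambda>m. q * m) ` ?B"
  proof (intro equalityI subsetI)
    fix m assume m: "m \<in> {m. m \<in> {1..n} \<and> (\<forall>r\<in>P. \<not> r dvd m)}"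
    show "m \<in> ?A \<union> (\<lambda>m. q * m) ` ?B"
    proof (cases "q dvd m")
      case True
      then obtain e where "m = q * e" by blast
      then show ?thesis using m q
        by (auto simp: less_eq_div_iff_mult_less_eq mult.commute intro!: image_eqI[of _ _ e])
    qed (use m in auto)
  next
    fix m assume m: "m \<in> ?A \<union> (\<lambda>m. q * m) ` ?B"
    have "\<not> r dvd q" if "r \<in> P" for r
      using that assms primes_dvd_imp_eq by blast
    then show "m \<in> {m. m \<in> {1..n} \<and> (\<forall>r\<in>P. \<not> r dvd m)}"
      using m q assms by (auto simp: less_eq_div_iff_mult_less_eq mult.commute prime_dvd_mult_iff)
  qed
  have "mertens_sifted P n = (\<Sum>m\<in>?A. ?f m) + (\<Sum>m\<in>(\<lambda>m. q * m) ` ?B. ?f m)"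
    unfolding mertens_sifted_def split by (rule sum.union_disjoint) auto
  also have "(\<Sum>m\<in>(\<lambda>m. q * m) ` ?B. ?f m) = (\<Sum>m\<in>?B. ?f (q * m))"
    using q by (subst sum.reindex) (auto simp: inj_on_def)
  also have "\<dots> = (\<Sum>m\<in>?B. if q dvd m then 0 else - ?f m)"
    using assms by (intro sum.cong) (auto simp: moebius_prime_mult)
  also have "\<dots> = (\<Sum>m | m \<in> ?B \<and> \<not> q dvd m. - ?f m)"
    by (simp add: sum.If_cases Int_def cong: if_cong)
  also have "{m. m \<in> ?B \<and> \<not> q dvd m} = {m. m \<in> {1..n div q} \<and> (\<forall>r\<in>insert q P. \<not> r dvd m)}"
    by auto
  finally show ?thesis by (simp add: mertens_sifted_def sum_negf)
qed

text \<open>Sifting multiplies 1/zeta by the factors 1 / (1 - q^(-s)), whose product has the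
  indicator of \<open>smooths\<close> as coefficients. The outer induction adds a prime, the inner
  one follows the recursion that both sides share.\<close>

lemma abs_mertens_sifted_le:
  assumes "finite P" "\<And>q. q \<in> P \<Longrightarrow> prime q"
  shows "\<bar>mertens_sifted P n\<bar> \<le> (\<Sum>d\<in>smooths P n. \<bar>mertens (n div d)\<bar>)"
  using assms
proof (induction P arbitrary: n rule: finite_induct)
  case empty
  then show ?case
    by (cases "n = 0") (simp_all add: mertens_sifted_def mertens_def smooths_empty atLeastAtMost_def atLeast_def atMost_def Int_def)
next
  case (insert q P)
  have q: "prime q" using insert by auto
  show ?case
  proof (induction n rule: less_induct)
    case (less n)
    show ?case
    proof (cases "n = 0")
      case True
      then show ?thesis by (simp add: mertens_sifted_def)
    next
      case False
      then have "n div q < n" using prime_gt_1_nat[OF q] by simp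
      then have "\<bar>mertens_sifted (insert q P) (n div q)\<bar>
          \<le> (\<Sum>d\<in>smooths (insert q P) (n div q). \<bar>mertens (n div q div d)\<bar>)"
        by (rule less)
      moreover have "\<bar>mertens_sifted P n\<bar> \<le> (\<Sum>d\<in>smooths P n. \<bar>mertens (n div d)\<bar>)"
        using insert by auto
      moreover have "mertens_sifted (insert q P) n = mertens_sifted P n + mertens_sifted (insert q P) (n div q)"
        using mertens_sifted_insert[of q P n] insert.hyps insert.prems by auto
      moreover have "(\<Sum>d\<in>smooths (insert q P) n. \<bar>mertens (n div d)\<bar>) =
          (\<Sum>d\<in>smooths P n. \<bar>mertens (n div d)\<bar>) +
          (\<Sum>d\<in>smooths (insert q P) (n div q). \<bar>mertens (n div q div d)\<bar>)"
        using insert.hyps q by (subst sum_smooths_insert) (auto simp: div_mult2_eq)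
      ultimately show ?thesis by linarith
    qed
  qed
qed

section \<open>Dirichlet series and the zeta function\<close>

text \<open>The summand at \<open>n = 0\<close> vanishes because \<open>0 powr z = 0\<close>.\<close>

definition dirichlet_series :: "(nat \<Rightarrow> complex) \<Rightarrow> complex \<Rightarrow> complex" where
  "dirichlet_series f s = (\<Sum>n. f n * of_nat n powr (- s))"

lemma norm_of_nat_powr [simp]: "norm (of_nat n powr s :: complex) = real n powr Re s"
  using norm_powr_real_powr[of "of_nat n" s] by simp

text \<open>A single half-plane of absolute convergence serves all coefficients in use, because it
  is preserved when they are multiplied by powers of the logarithm.\<close>

definition dirichlet_summable :: "(nat \<Rightarrow> complex) \<Rightarrow> bool" where
  "dirichlet_summable f \<longleftrightarrow> (\<forall>\<sigma>>1. summable (\<lambda>n. norm (f n) * real n powr (- \<sigma>)))"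

lemma dsummableI:
  assumes "\<And>e. e > 0 \<Longrightarrow> \<exists>C. \<forall>n>0. norm (f n) \<le> C * real n powr e"
  shows "dirichlet_summable f"
  unfolding dirichlet_summable_def
proof (intro allI impI)
  fix \<sigma> :: real assume s: "\<sigma> > 1"
  obtain C where C: "\<forall>n>0. norm (f n) \<le> C * real n powr ((\<sigma> - 1) / 2)"
    using assms[of "(\<sigma> - 1) / 2"] s by auto
  show "summable (\<lambda>n. norm (f n) * real n powr (- \<sigma>))"
  proof (rule summable_comparison_test'[of _ 1])
    show "summable (\<lambda>n. C * real n powr (- ((\<sigma> + 1) / 2)))"
      using s by (intro summable_mult) (simp add: summable_real_powr_iff)
    fix n :: nat assume n: "n \<ge> 1"
    have "norm (f n) * real n powr (- \<sigma>) \<le> C * real n powr ((\<sigma> - 1) / 2) * real n powr (- \<sigma>)"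
      using C n by (intro mult_right_mono) auto
    also have "\<dots> = C * real n powr ((\<sigma> - 1) / 2 - \<sigma>)"
      using n by (simp add: powr_add[symmetric])
    also have "(\<sigma> - 1) / 2 - \<sigma> = - ((\<sigma> + 1) / 2)" by (simp add: field_simps)
    finally show "norm (norm (f n) * real n powr (- \<sigma>)) \<le> C * real n powr (- ((\<sigma> + 1) / 2))"
      by simp
  qed
qed

lemma dirichlet_summable_norm:
  assumes "dirichlet_summable f" "Re s > 1"
  shows "summable (\<lambda>n. norm (f n * of_nat n powr (- s)))"
  using assms by (simp add: dirichlet_summable_def norm_mult)

lemma dirichlet_series_sums:
  assumes "dirichlet_summable f" "Re s > 1"
  shows "(\<lambda>n. f n * of_nat n powr (- s)) sums dirichlet_series f s"
  unfolding dirichlet_series_def by (rule summable_sums[OF summable_norm_cancel[OF dirichlet_summable_norm[OF assms]]])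

lemma dirichlet_summable_ln:
  assumes "dirichlet_summable f"
  shows "dirichlet_summable (\<lambda>n. - of_real (ln (real n)) * f n)"
  unfolding dirichlet_summable_def
proof (intro allI impI)
  fix \<sigma> :: real assume s: "\<sigma> > 1"
  define e where "e = (\<sigma> - 1) / 2"
  have e: "e > 0" using s by (simp add: e_def)
  show "summable (\<lambda>n. norm (- of_real (ln (real n)) * f n) * real n powr (- \<sigma>))"
  proof (rule summable_comparison_test'[of _ 1])
    show "summable (\<lambda>n. 1 / e * (norm (f n) * real n powr (- ((\<sigma> + 1) / 2))))"
      using s assms by (intro summable_mult) (simp add: dirichlet_summable_def)
    fix n :: nat assume n: "n \<ge> 1"
    have "ln (real n) \<le> real n powr e / e"
      using ln_powr_bound[of "real n" e] n e by simp
    then have "ln (real n) * norm (f n) * real n powr (- \<sigma>) \<le> real n powr e / e * norm (f n) * real n powr (- \<sigma>)"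
      by (intro mult_right_mono) auto
    also have "\<dots> = 1 / e * (norm (f n) * (real n powr e * real n powr (- \<sigma>)))" by simp
    also have "real n powr e * real n powr (- \<sigma>) = real n powr (e - \<sigma>)"
      using n by (simp add: powr_add[symmetric])
    also have "e - \<sigma> = - ((\<sigma> + 1) / 2)" by (simp add: field_simps e_def)
    finally show "norm (norm (- of_real (ln (real n)) * f n) * real n powr (- \<sigma>))
        \<le> 1 / e * (norm (f n) * real n powr (- ((\<sigma> + 1) / 2)))"
      using n by (simp add: norm_mult)
  qed
qed

lemma dirichlet_summable_ln_power:
  assumes "dirichlet_summable f"
  shows "dirichlet_summable (\<lambda>n. (- of_real (ln (real n))) ^ k * f n)"
proof (induction k)
  case (Suc k)
  from dirichlet_summable_ln[OF this] show ?case by (simp add: mult.assoc)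
qed (use assms in simp)

lemma of_nat_powr_has_field_derivative:
  "((\<lambda>s. of_nat n powr (- s)) has_field_derivative (- of_real (ln (real n)) * of_nat n powr (- s) :: complex)) (at s)"
proof (cases "n = 0")
  case False
  have "((\<lambda>s. exp (- s * of_real (ln (real n)))) has_field_derivative
      (- of_real (ln (real n)) * exp (- s * of_real (ln (real n))) :: complex)) (at s)"
    by (auto intro!: derivative_eq_intros)
  then show ?thesis using False by (simp add: powr_def Ln_of_nat)
qed simp

lemma dirichlet_series_has_field_derivative:
  assumes "dirichlet_summable f" "Re s > 1"
  shows "(dirichlet_series f has_field_derivative dirichlet_series (\<lambda>n. - of_real (ln (real n)) * f n) s) (at s)"
proof -
  \<comment> \<open>Midway between 1 and Re s: the half-plane to the right of it contains s, and on
    it one convergent series dominates all terms uniformly.\<close>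
  define \<sigma> where "\<sigma> = (1 + Re s) / 2"
  let ?S = "{z. \<sigma> < Re z}"
  have \<sigma>: "\<sigma> > 1" "s \<in> ?S" using assms by (auto simp: \<sigma>_def)
  have op: "open ?S" by (rule open_halfspace_Re_gt)
  have sm: "summable (\<lambda>n. norm (f n) * real n powr (- \<sigma>))"
    using assms \<sigma> by (simp add: dirichlet_summable_def)
  have ev: "\<forall>\<^sub>F n in sequentially. \<forall>x\<in>?S. norm (f n * of_nat n powr (- x)) \<le> norm (f n) * real n powr (- \<sigma>)"
    using eventually_ge_at_top[of 1]
    by eventually_elim (auto simp: norm_mult intro!: mult_left_mono powr_mono)
  have der: "((\<lambda>s. f n * of_nat n powr (- s)) has_field_derivative
      (- of_real (ln (real n)) * f n * of_nat n powr (- x))) (at x)" for n x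
    by (rule DERIV_cong[OF DERIV_cmult[OF of_nat_powr_has_field_derivative]]) simp
  obtain g g' where g: "\<forall>x\<in>?S. (\<lambda>n. f n * of_nat n powr (- x)) sums g x \<and>
      (\<lambda>n. - of_real (ln (real n)) * f n * of_nat n powr (- x)) sums g' x \<and> (g has_field_derivative g' x) (at x)"
    by (rule series_and_derivative_comparison[OF op sm der ev])
  have "(g has_field_derivative g' s) (at s)" using g \<sigma> by blast
  moreover have "g' s = dirichlet_series (\<lambda>n. - of_real (ln (real n)) * f n) s"
    using g \<sigma> by (simp add: dirichlet_series_def sums_iff)
  moreover have "g x = dirichlet_series f x" if "x \<in> ?S" for x
    using g that by (simp add: dirichlet_series_def sums_iff)
  ultimately show ?thesis
    using has_field_derivative_transform_within_open[OF _ op \<sigma>(2)] by metis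
qed

lemma dirichlet_series_higher_deriv:
  assumes "dirichlet_summable f" "Re s > 1"
  shows "(deriv ^^ k) (dirichlet_series f) s = dirichlet_series (\<lambda>n. (- of_real (ln (real n))) ^ k * f n) s"
proof -
  show ?thesis using assms(2)
  proof (induction k arbitrary: s)
    case (Suc k)
    have "(deriv ^^ Suc k) (dirichlet_series f) s = deriv ((deriv ^^ k) (dirichlet_series f)) s" by simp
    also have "\<dots> = deriv (dirichlet_series (\<lambda>n. (- of_real (ln (real n))) ^ k * f n)) s"
    proof (rule deriv_cong_ev)
      have "eventually (\<lambda>x. x \<in> {z. 1 < Re z}) (nhds s)"
        using Suc.prems by (intro eventually_nhds_in_open open_halfspace_Re_gt) auto
      then show "\<forall>\<^sub>F x in nhds s. (deriv ^^ k) (dirichlet_series f) x = dirichlet_series (\<lambda>n. (- of_real (ln (real n))) ^ k * f n) x"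
        by eventually_elim (use Suc.IH in auto)
    qed simp
    also have "\<dots> = dirichlet_series (\<lambda>n. - of_real (ln (real n)) * ((- of_real (ln (real n))) ^ k * f n)) s"
      by (intro DERIV_imp_deriv dirichlet_series_has_field_derivative dirichlet_summable_ln_power assms(1) Suc.prems)
    finally show ?case by (simp add: mult.assoc)
  qed simp
qed

text \<open>The unconditional sum over pairs (a, b) is regrouped by n = a b with d = a. Index 0 has
  to be removed first, since otherwise the pairs would not correspond to the divisors of n.\<close>

lemma dirichlet_series_mult:
  assumes "dirichlet_summable f" "dirichlet_summable g" "Re s > 1"
    and h: "\<And>n. n > 0 \<Longrightarrow> h n = (\<Sum>d | d dvd n. f d * g (n div d))"
  shows "dirichlet_series f s * dirichlet_series g s = dirichlet_series h s"
proof -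
  let ?F = "\<lambda>n. f n * of_nat n powr (- s)" and ?G = "\<lambda>n. g n * of_nat n powr (- s)"
  let ?H = "\<lambda>n. h n * of_nat n powr (- s)"
  let ?N = "{0<..} :: nat set"
  have F: "(\<lambda>n. norm (?F n)) summable_on ?N" "(?F has_sum dirichlet_series f s) ?N"
    and G: "(\<lambda>n. norm (?G n)) summable_on ?N" "(?G has_sum dirichlet_series g s) ?N"
  proof -
    have *: "(\<lambda>n. norm (f n * of_nat n powr (- s))) summable_on ?N \<and> ((\<lambda>n. f n * of_nat n powr (- s)) has_sum dirichlet_series f s) ?N"
      if "dirichlet_summable f" for f
    proof
      show "(\<lambda>n. norm (f n * of_nat n powr (- s))) summable_on ?N"
        by (rule summable_on_subset_banach[of _ UNIV])
          (use dirichlet_summable_norm[OF that assms(3)] in \<open>simp_all add: norm_summable_imp_summable_on\<close>)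
      have "((\<lambda>n. f n * of_nat n powr (- s)) has_sum dirichlet_series f s) UNIV"
        by (intro norm_summable_imp_has_sum dirichlet_summable_norm dirichlet_series_sums that assms)
      then show "((\<lambda>n. f n * of_nat n powr (- s)) has_sum dirichlet_series f s) ?N"
        by (rule has_sum_cong_neutral[THEN iffD1, rotated -1]) auto
    qed
    show "(\<lambda>n. norm (?F n)) summable_on ?N" "(?F has_sum dirichlet_series f s) ?N" "(\<lambda>n. norm (?G n)) summable_on ?N" "(?G has_sum dirichlet_series g s) ?N"
      using *[OF assms(1)] *[OF assms(2)] by auto
  qed
  have "(\<lambda>(a, b). ?F a * ?G b) summable_on ?N \<times> ?N"
  proof (rule Infinite_Sum.abs_summable_summable, subst Infinite_Sum.abs_summable_on_Sigma_iff, intro conjI ballI)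
    show "(\<lambda>y. norm (case (x, y) of (a, b) \<Rightarrow> ?F a * ?G b)) summable_on ?N" for x
      using summable_on_cmult_right[OF G(1), of "norm (?F x)"] by (simp add: norm_mult)
    have "(\<lambda>x. norm (\<Sum>\<^sub>\<infinity>y\<in>?N. norm (case (x, y) of (a, b) \<Rightarrow> ?F a * ?G b))) =
        (\<lambda>x. norm (?F x) * (\<Sum>\<^sub>\<infinity>y\<in>?N. norm (?G y)))"
      by (rule ext) (simp add: norm_mult infsum_cmult_right' infsum_nonneg abs_mult)
    then show "(\<lambda>x. norm (\<Sum>\<^sub>\<infinity>y\<in>?N. norm (case (x, y) of (a, b) \<Rightarrow> ?F a * ?G b))) summable_on ?N"
      using summable_on_cmult_left[OF F(1)] by simp
  qed
  then obtain S where S: "((\<lambda>(a, b). ?F a * ?G b) has_sum S) (?N \<times> ?N)"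
    unfolding summable_on_def by blast
  have "((\<lambda>a. ?F a * dirichlet_series g s) has_sum S) ?N"
    by (rule has_sum_SigmaD[OF S]) (simp add: has_sum_cmult_right[OF G(2)])
  moreover have "((\<lambda>a. ?F a * dirichlet_series g s) has_sum dirichlet_series f s * dirichlet_series g s) ?N"
    by (rule has_sum_cmult_left[OF F(2)])
  ultimately have S_eq: "S = dirichlet_series f s * dirichlet_series g s" by (rule has_sum_unique)
  have "((\<lambda>(n, d). ?F d * ?G (n div d)) has_sum S) (SIGMA n:?N. {d. d dvd n})"
    using S by (subst (asm) has_sum_reindex_bij_witness[where j = "\<lambda>(a, b). (a * b, a)"
          and i = "\<lambda>(n, d). (d, n div d)" and T = "SIGMA n:?N. {d. d dvd n}"
          and h = "\<lambda>(n, d). ?F d * ?G (n div d)" and s' = S]) (auto elim!: dvdE)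
  then have "((\<lambda>n. ?H n) has_sum S) ?N"
  proof (rule has_sum_SigmaD)
    fix n :: nat assume n: "n \<in> ?N"
    have "?F d * ?G (n div d) = f d * g (n div d) * of_nat n powr (- s)" if "d dvd n" for d
    proof -
      from that obtain e where e: "n = d * e" by blast
      then have "of_nat n powr (- s) = (of_nat d powr (- s) * of_nat e powr (- s) :: complex)"
        by (simp add: powr_times_real)
      then show ?thesis using e n by simp
    qed
    then have "(\<Sum>d | d dvd n. ?F d * ?G (n div d)) = (\<Sum>d | d dvd n. f d * g (n div d) * of_nat n powr (- s))"
      by (intro sum.cong refl) blast
    then have "(\<Sum>d | d dvd n. ?F d * ?G (n div d)) = ?H n"
      using n by (simp add: h sum_distrib_right)
    then show "((\<lambda>d. case (n, d) of (n, d) \<Rightarrow> ?F d * ?G (n div d)) has_sum ?H n) {d. d dvd n}"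
      using n by (intro has_sum_finiteI) auto
  qed
  then have "(?H has_sum S) UNIV"
    by (rule has_sum_cong_neutral[THEN iffD1, rotated -1]) auto
  then have "?H sums S" by (rule has_sum_imp_sums)
  then show ?thesis using S_eq by (simp add: dirichlet_series_def sums_iff)
qed

text \<open>The second and third summand telescope, so that \<open>zeta_reg s\<close> is \<open>(s - 1) * zeta s\<close> for \<open>Re s > 1\<close>;
  they make the series converge for \<open>Re s > 0\<close>.\<close>

definition zeta_reg_term :: "nat \<Rightarrow> complex \<Rightarrow> complex" where
  "zeta_reg_term n s = (s - 1) * of_nat n powr (- s) + of_nat (Suc n) powr (1 - s) - of_nat n powr (1 - s)"

definition zeta_reg :: "complex \<Rightarrow> complex" where
  "zeta_reg s = 1 + (\<Sum>n. zeta_reg_term (Suc n) s)"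

text \<open>The term is s - 1 times the integral of n^(-s) - u^(-s) over n \<le> u \<le> n + 1.
  Instead of integrating, the mean value estimate is applied twice: to the power u^(-s), and to the
  primitive \<open>?f\<close> of the integrand.\<close>

lemma norm_zeta_reg_term_le:
  assumes n: "n > 0" and s: "Re s > 0"
  shows "norm (zeta_reg_term n s) \<le> norm (s - 1) * norm s * real n powr (- Re s - 1)"
proof -
  let ?S = "closed_segment (of_nat n) (of_nat (Suc n)) :: complex set"
  have S: "\<exists>u. z = of_real u \<and> real n \<le> u \<and> u \<le> real n + 1" if "z \<in> ?S" for z
  proof -
    have "?S = of_real ` closed_segment (real n) (real (Suc n))"
      by (metis closed_segment_of_real of_real_of_nat_eq)
    then show ?thesis using that by (auto simp: closed_segment_eq_real_ivl)
  qed
  have nonpos: "z \<notin> \<real>\<^sub>\<le>\<^sub>0" if "z \<in> ?S" for z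
    using S[OF that] n by (auto simp: complex_nonpos_Reals_iff)
  have 1: "norm (of_nat n powr (- s) - z powr (- s)) \<le> norm s * real n powr (- Re s - 1)" if z: "z \<in> ?S" for z
  proof -
    have "norm (of_nat n powr (- s) - z powr (- s)) \<le> norm s * real n powr (- Re s - 1) * norm (of_nat n - z)"
    proof (rule field_differentiable_bound[where S = ?S and f' = "\<lambda>z. - s * z powr (- s - 1)"])
      fix z assume z: "z \<in> ?S"
      show "((\<lambda>z. z powr - s) has_field_derivative - s * z powr (- s - 1)) (at z within ?S)"
        using nonpos[OF z] by (auto intro!: derivative_eq_intros)
      obtain u where u: "z = of_real u" "real n \<le> u" using S[OF z] by auto
      then have "norm (z powr (- s - 1)) = u powr (- Re s - 1)"
        using n norm_powr_real_powr[of z "- s - 1"] by simp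
      also have "\<dots> \<le> real n powr (- Re s - 1)"
        using u n s by (intro powr_mono2') auto
      finally show "norm (- s * z powr (- s - 1)) \<le> norm s * real n powr (- Re s - 1)"
        by (simp add: norm_mult mult_left_mono)
    qed (use z in auto)
    also have "\<dots> \<le> norm s * real n powr (- Re s - 1) * 1"
    proof (rule mult_left_mono)
      obtain u where u: "z = of_real u" "real n \<le> u" "u \<le> real n + 1" using S[OF z] by auto
      have "of_nat n - z = of_real (real n - u)" using u by simp
      then have "norm (of_nat n - z) = \<bar>real n - u\<bar>" by (simp only: norm_of_real)
      then show "norm (of_nat n - z) \<le> 1" using u by simp
    qed simp
    finally show ?thesis by simp
  qed
  let ?f = "\<lambda>z. (s - 1) * (z - of_nat n) * of_nat n powr (- s) + z powr (1 - s)"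
  have "norm (?f (of_nat (Suc n)) - ?f (of_nat n)) \<le>
      norm (s - 1) * (norm s * real n powr (- Re s - 1)) * norm (of_nat (Suc n) - of_nat n :: complex)"
  proof (rule field_differentiable_bound[where S = ?S and f' = "\<lambda>z. (s - 1) * (of_nat n powr (- s) - z powr (- s))"])
    fix z assume z: "z \<in> ?S"
    show "(?f has_field_derivative (s - 1) * (of_nat n powr (- s) - z powr (- s))) (at z within ?S)"
      using nonpos[OF z] by (auto intro!: derivative_eq_intros simp: algebra_simps)
    show "norm ((s - 1) * (of_nat n powr (- s) - z powr (- s))) \<le> norm (s - 1) * (norm s * real n powr (- Re s - 1))"
      unfolding norm_mult by (intro mult_left_mono 1 z) auto
  qed auto
  also have "?f (of_nat (Suc n)) - ?f (of_nat n) = zeta_reg_term n s"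
    by (simp add: zeta_reg_term_def)
  finally show ?thesis by (simp add: mult.assoc)
qed

lemma summable_zeta_reg_term_bound:
  assumes "Re s > 0"
  shows "summable (\<lambda>n. norm (s - 1) * norm s * real (Suc n) powr (- Re s - 1))"
proof -
  have "summable (\<lambda>n. real n powr (- Re s - 1))" using assms by (simp add: summable_real_powr_iff)
  then have "summable (\<lambda>n. real (Suc n) powr (- Re s - 1))" by (rule summable_Suc_iff[THEN iffD2])
  then show ?thesis by (rule summable_mult)
qed

lemma summable_norm_zeta_reg_term:
  assumes "Re s > 0"
  shows "summable (\<lambda>n. norm (zeta_reg_term (Suc n) s))"
  by (rule summable_comparison_test'[OF summable_zeta_reg_term_bound[OF assms], of 0])
    (use norm_zeta_reg_term_le[of "Suc _" s] assms in auto)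

lemma zeta_reg_holomorphic: "zeta_reg holomorphic_on {s. Re s > 0}"
proof -
  let ?S = "{s. Re s > 0}"
  have op: "open ?S" by (rule open_halfspace_Re_gt)
  have "\<exists>g g'. \<forall>x\<in>?S. (\<lambda>n. zeta_reg_term (Suc n) x) sums g x \<and> (\<lambda>n. deriv (zeta_reg_term (Suc n)) x) sums g' x \<and> (g has_field_derivative g' x) (at x)"
  proof (rule series_and_derivative_comparison_complex[OF op])
    fix n x
    have "zeta_reg_term (Suc n) holomorphic_on UNIV"
      unfolding zeta_reg_term_def by (intro holomorphic_intros holomorphic_on_powr_right) (simp_all del: of_nat_Suc)
    then have "zeta_reg_term (Suc n) field_differentiable (at x)"
      by (rule holomorphic_on_imp_differentiable_at) auto
    then show "(zeta_reg_term (Suc n) has_field_derivative deriv (zeta_reg_term (Suc n)) x) (at x)"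
      by (simp add: field_differentiable_derivI)
  next
    fix x assume x: "x \<in> ?S"
    \<comment> \<open>On the ball of radius d around x the real part stays at least d, which bounds
      the exponent, and K bounds the two norms in front of the power.\<close>
    define d where "d = Re x / 2"
    have d: "d > 0" using x by (simp add: d_def)
    define K where "K = (norm x + d + 1) ^ 2"
    let ?h = "\<lambda>n. of_real (K * real (Suc n) powr (- d - 1)) :: complex"
    have "summable (\<lambda>n. real n powr (- d - 1))" using d by (simp add: summable_real_powr_iff)
    then have "summable (\<lambda>n. real (Suc n) powr (- d - 1))" by (rule summable_Suc_iff[THEN iffD2])
    then have A: "summable ?h" by (intro summable_of_real summable_mult)
    have R: "range ?h \<subseteq> \<real>\<^sub>\<ge>\<^sub>0"
      by (intro image_subsetI, subst nonneg_Reals_of_real_iff) (simp add: K_def)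
    have N: "norm (zeta_reg_term (Suc n) y) \<le> norm (?h n)" if y: "y \<in> ball x d \<inter> ?S" for n y
    proof -
      have "norm (y - x) < d" using y by (simp add: dist_norm norm_minus_commute)
      moreover have "\<bar>Re (y - x)\<bar> \<le> norm (y - x)" by (rule abs_Re_le_cmod)
      ultimately have re: "Re y \<ge> d" by (simp add: d_def)
      have ny: "norm y \<le> norm x + d"
        using norm_triangle_ineq[of x "y - x"] \<open>norm (y - x) < d\<close> by simp
      have "norm (y - 1) \<le> norm x + d + 1" using norm_triangle_ineq4[of y 1] ny by simp
      then have "norm (y - 1) * norm y \<le> K"
        unfolding K_def power2_eq_square using ny d by (intro mult_mono) (auto intro: add_nonneg_nonneg)
      moreover have "real (Suc n) powr (- Re y - 1) \<le> real (Suc n) powr (- d - 1)"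
        using re by (intro powr_mono) auto
      ultimately have "norm (y - 1) * norm y * real (Suc n) powr (- Re y - 1) \<le> K * real (Suc n) powr (- d - 1)"
        by (intro mult_mono) (auto simp: K_def)
      moreover have "norm (?h n) = K * real (Suc n) powr (- d - 1)"
        by (simp only: norm_of_real) (simp add: K_def abs_mult)
      moreover have "norm (zeta_reg_term (Suc n) y) \<le> norm (y - 1) * norm y * real (Suc n) powr (- Re y - 1)"
        using norm_zeta_reg_term_le[of "Suc n" y] y by simp
      ultimately show ?thesis by linarith
    qed
    show "\<exists>d h. 0 < d \<and> summable (h :: nat \<Rightarrow> complex) \<and> range h \<subseteq> \<real>\<^sub>\<ge>\<^sub>0 \<and>
        (\<forall>\<^sub>F n in sequentially. \<forall>y\<in>ball x d \<inter> ?S. norm (zeta_reg_term (Suc n) y) \<le> norm (h n))"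
      by (intro exI[of _ d] exI[of _ ?h] conjI always_eventually allI ballI d A R N)
  qed
  then obtain g g' where g: "\<forall>x\<in>?S. (\<lambda>n. zeta_reg_term (Suc n) x) sums g x \<and> (g has_field_derivative g' x) (at x)"
    by blast
  have "(\<lambda>s. 1 + g s) holomorphic_on ?S"
    using g by (intro holomorphic_intros) (auto simp: holomorphic_on_open[OF op])
  moreover have "1 + g s = zeta_reg s" if "s \<in> ?S" for s
    using g that by (simp add: zeta_reg_def sums_iff)
  ultimately show ?thesis by (rule holomorphic_transform)
qed

lemma sum_zeta_reg_term:
  "(\<Sum>k<m. zeta_reg_term (Suc k) s) =
     (s - 1) * (\<Sum>k<m. of_nat (Suc k) powr (- s)) + of_nat (Suc m) powr (1 - s) - 1"
  by (induction m) (simp_all add: zeta_reg_term_def algebra_simps)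

abbreviation zeta :: "complex \<Rightarrow> complex" where
  "zeta \<equiv> dirichlet_series (\<lambda>_. 1)"

lemma dirichlet_summable_1 [simp]: "dirichlet_summable (\<lambda>_. 1)"
  by (simp add: dirichlet_summable_def summable_real_powr_iff)

lemma zeta_reg_eq_zeta:
  assumes "Re s > 1"
  shows "zeta_reg s = (s - 1) * zeta s"
proof -
  have "(\<lambda>n. of_nat n powr (- s)) sums zeta s"
    using dirichlet_series_sums[OF dirichlet_summable_1 assms] by simp
  then have "(\<lambda>n. of_nat (Suc n) powr (- s)) sums (zeta s - of_nat 0 powr (- s))"
    by (subst sums_Suc_iff) simp
  then have 1: "(\<lambda>m. \<Sum>k<m. of_nat (Suc k) powr (- s)) \<longlonglongrightarrow> zeta s" by (simp add: sums_def)
  have 2: "(\<lambda>m. of_nat (Suc m) powr (1 - s)) \<longlonglongrightarrow> 0"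
  proof (rule Lim_null_comparison)
    show "\<forall>\<^sub>F m in sequentially. norm (of_nat (Suc m) powr (1 - s)) \<le> real (Suc m) powr (1 - Re s)"
      by (auto intro!: always_eventually simp del: of_nat_Suc)
    show "(\<lambda>m. real (Suc m) powr (1 - Re s)) \<longlonglongrightarrow> 0"
      using assms by real_asymp
  qed
  have "(\<lambda>m. \<Sum>k<m. zeta_reg_term (Suc k) s) \<longlonglongrightarrow> (s - 1) * zeta s + 0 - 1"
    unfolding sum_zeta_reg_term by (intro tendsto_intros 1 2)
  then have "(\<lambda>k. zeta_reg_term (Suc k) s) sums ((s - 1) * zeta s - 1)" by (simp add: sums_def)
  then show ?thesis by (simp add: zeta_reg_def sums_iff)
qed

section \<open>Growth of zeta slightly to the left of Re s = 1\<close>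

lemma sum_tail_three_halves:
  assumes "m > 0"
  shows "summable (\<lambda>k. real (Suc (k + m)) powr (- 3 / 2))"
    and "(\<Sum>k. real (Suc (k + m)) powr (- 3 / 2)) \<le> 2 / sqrt (real m)"
proof -
  have "summable (\<lambda>n. real n powr (- 3 / 2))" by (simp add: summable_real_powr_iff)
  then have "summable (\<lambda>k. real (k + Suc m) powr (- 3 / 2))" by (rule summable_ignore_initial_segment)
  then show 1: "summable (\<lambda>k. real (Suc (k + m)) powr (- 3 / 2))" by simp
  \<comment> \<open>The integral of u^(-3/2) from m to infinity is 2 / sqrt m; the increments of
    this primitive replace the integral test.\<close>
  let ?g = "\<lambda>k. 2 / sqrt (real (k + m))"
  have "?g \<longlonglongrightarrow> 0" by real_asymp
  then have 2: "(\<lambda>k. ?g k - ?g (Suc k)) sums (?g 0 - 0)" by (rule telescope_sums')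
  have "(\<Sum>k. real (Suc (k + m)) powr (- 3 / 2)) \<le> (\<Sum>k. ?g k - ?g (Suc k))"
  proof (rule suminf_le[OF _ 1 sums_summable[OF 2]])
    fix k
    define a b where "a = sqrt (real (k + m))" and "b = sqrt (real (Suc (k + m)))"
    have ab: "0 < a" "a \<le> b" "b ^ 2 - a ^ 2 = 1" using assms by (auto simp: a_def b_def)
    have "real (Suc (k + m)) powr (- 3 / 2) = (real (Suc (k + m)) powr (1 / 2)) powr (- 3)"
      by (simp only: powr_powr) simp
    also have "\<dots> = b powr (- 3)" by (simp only: powr_half_sqrt b_def of_nat_0_le_iff)
    also have "\<dots> = 1 / b ^ 3" using ab powr_realpow[of b 3] by (simp add: powr_minus_divide)
    also have "\<dots> \<le> 2 / a - 2 / b"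
    proof -
      have "(b - a) * (b + a) = 1" using ab(3) by (simp add: power2_eq_square algebra_simps)
      then have "2 * (b - a) * b \<ge> 1" using ab mult_left_mono[of "b + a" "2 * b" "b - a"] by (simp add: algebra_simps)
      have "a * b \<le> b * b" using ab by simp
      then have "a * b \<le> 2 * (b - a) * b * (b * b)"
        using \<open>2 * (b - a) * b \<ge> 1\<close> ab mult_mono[of 1 "2 * (b - a) * b" "a * b" "b * b"] by simp
      then have "a \<le> 2 * (b - a) * b * b" using ab by (simp add: mult_ac)
      moreover have "2 / a - 2 / b = 2 * (b - a) / (a * b)" using ab by (simp add: field_simps)
      ultimately show ?thesis using ab by (simp add: divide_simps power3_eq_cube mult_ac)
    qed
    finally show "real (Suc (k + m)) powr (- 3 / 2) \<le> ?g k - ?g (Suc k)" by (simp add: a_def b_def)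
  qed
  also have "\<dots> = 2 / sqrt (real m)" using 2 by (simp add: sums_iff)
  finally show "(\<Sum>k. real (Suc (k + m)) powr (- 3 / 2)) \<le> 2 / sqrt (real m)" .
qed

text \<open>The series is cut at m of size exp (2 L), the square of the maximal height. In a strip
  of width 1/L to the left of the line, k^(1 - Re s) stays below exp 3 for k \<le> m + 1, so the
  partial sum is O(L) like a harmonic sum; the tail is of order norm (s - 1) * norm s / sqrt m and
  norm s is O(exp L). The height bound \<tau> allows the boundary term to be compared with norm (s -
  1).\<close>

lemma norm_zeta_reg_le:
  fixes L \<tau> :: real
  assumes L: "L \<ge> 2" and \<tau>: "\<tau> > 0" and s: "\<tau> \<le> \<bar>Im s\<bar>" "\<bar>Im s\<bar> \<le> exp L" "1 - 1 / L \<le> Re s" "Re s \<le> 3"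
  shows "norm (zeta_reg s) \<le> (4 * exp 3 + exp 3 / \<tau> + 8) * L * norm (s - 1)"
proof -
  define m where "m = nat \<lceil>exp (2 * L)\<rceil>"
  define N where "N = norm (s - 1)"
  have N: "N > 0" using s \<tau> by (auto simp: N_def complex_eq_iff)
  have Nt: "\<tau> \<le> N" using abs_Im_le_cmod[of "s - 1"] s by (simp add: N_def)
  have half: "1 / L \<le> 1 / 2" using L by (intro divide_left_mono) auto
  then have re: "Re s \<ge> 1 / 2" using s by simp
  have m1: "exp (2 * L) \<le> real m" unfolding m_def by linarith
  have m2: "real m \<le> exp (2 * L) + 1" unfolding m_def using exp_gt_zero[of "2 * L"] by linarith
  have m0: "m > 0" unfolding m_def by simp
  have eL: "exp L \<ge> 3" using exp_ge_add_one_self[of L] L by linarith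
  have e2L: "exp (2 * L) \<ge> 3" using exp_ge_add_one_self[of "2 * L"] L by linarith
  have "exp (3 * L) = exp (2 * L) * exp L" by (simp add: exp_add[symmetric])
  also have "\<dots> \<ge> exp (2 * L) * 3" using eL by (intro mult_left_mono) auto
  finally have m3: "real (Suc m) \<le> exp (3 * L)" using m2 e2L by simp
  have pw: "real (Suc k) powr (1 - Re s) \<le> exp 3" if "k \<le> m" for k
  proof -
    have "real (Suc k) powr (1 - Re s) \<le> real (Suc k) powr (1 / L)"
      using s by (intro powr_mono) auto
    also have "\<dots> \<le> exp (3 * L) powr (1 / L)"
      using that m3 L by (intro powr_mono2) auto
    also have "\<dots> = exp 3" using L by (simp add: exp_powr_real)
    finally show ?thesis .
  qed
  have sm: "summable (\<lambda>n. zeta_reg_term (Suc n) s)"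
    by (rule summable_norm_cancel[OF summable_norm_zeta_reg_term]) (use re in simp)
  have "zeta_reg s = 1 + ((\<Sum>k. zeta_reg_term (Suc (k + m)) s) + (\<Sum>k<m. zeta_reg_term (Suc k) s))"
    unfolding zeta_reg_def by (subst suminf_split_initial_segment[OF sm, of m]) simp
  then have eq: "zeta_reg s = (s - 1) * (\<Sum>k<m. of_nat (Suc k) powr (- s)) + of_nat (Suc m) powr (1 - s)
      + (\<Sum>k. zeta_reg_term (Suc (k + m)) s)"
    by (simp only: sum_zeta_reg_term) (simp add: algebra_simps)
  have "norm (\<Sum>k<m. of_nat (Suc k) powr (- s)) \<le> (\<Sum>k<m. exp 3 * (1 / real (Suc k)))"
  proof (rule sum_norm_le)
    fix k assume k: "k \<in> {..<m}"
    have "norm (of_nat (Suc k) powr (- s)) = real (Suc k) powr (1 - Re s - 1)"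
      by (simp only: norm_of_nat_powr) simp
    also have "\<dots> = real (Suc k) powr (1 - Re s) / real (Suc k)"
      by (simp only: powr_diff) simp
    also have "\<dots> \<le> exp 3 / real (Suc k)" using pw[of k] k by (intro divide_right_mono) auto
    finally show "norm (of_nat (Suc k) powr (- s)) \<le> exp 3 * (1 / real (Suc k))" by simp
  qed
  also have "\<dots> = exp 3 * (\<Sum>k<m. 1 / real (Suc k))" by (rule sum_distrib_left[symmetric])
  also have "\<dots> \<le> exp 3 * (1 + ln (real m))"
    using sum_reciprocals_le[OF m0] by (intro mult_left_mono) (auto simp: sum.atLeast1_atMost_eq)
  also have "ln (real m) \<le> ln (exp (3 * L))" using m3 m0 by (subst ln_le_cancel_iff) auto
  also have "ln (exp (3 * L)) = 3 * L" by simp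
  also have "1 + 3 * L \<le> 4 * L" using L by simp
  finally have 1: "norm (\<Sum>k<m. of_nat (Suc k) powr (- s)) \<le> 4 * exp 3 * L" by simp
  have "norm (of_nat (Suc m) powr (1 - s)) \<le> exp 3"
    using pw[of m] by (simp only: norm_of_nat_powr) simp
  also have "exp 3 = exp 3 / \<tau> * \<tau>" using \<tau> by simp
  also have "\<dots> \<le> exp 3 / \<tau> * N" using Nt \<tau> by (intro mult_left_mono) auto
  also have "\<dots> \<le> exp 3 / \<tau> * L * N" using \<tau> L N by (simp add: divide_simps)
  finally have 2: "norm (of_nat (Suc m) powr (1 - s)) \<le> exp 3 / \<tau> * L * N" .
  have "norm (\<Sum>k. zeta_reg_term (Suc (k + m)) s) \<le> (\<Sum>k. N * norm s * real (Suc (k + m)) powr (- 3 / 2))"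
  proof (rule norm_suminf_le)
    show "summable (\<lambda>k. N * norm s * real (Suc (k + m)) powr (- 3 / 2))"
      by (intro summable_mult sum_tail_three_halves m0)
    fix k
    have "norm (zeta_reg_term (Suc (k + m)) s) \<le> N * norm s * real (Suc (k + m)) powr (- Re s - 1)"
      using norm_zeta_reg_term_le[of "Suc (k + m)" s] re by (simp add: N_def)
    also have "\<dots> \<le> N * norm s * real (Suc (k + m)) powr (- 3 / 2)"
      using re N by (intro mult_left_mono powr_mono) auto
    finally show "norm (zeta_reg_term (Suc (k + m)) s) \<le> N * norm s * real (Suc (k + m)) powr (- 3 / 2)" .
  qed
  also have "\<dots> = N * norm s * (\<Sum>k. real (Suc (k + m)) powr (- 3 / 2))"
    by (intro suminf_mult sum_tail_three_halves m0)
  also have "\<dots> \<le> N * norm s * (2 / sqrt (real m))"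
    using N by (intro mult_left_mono sum_tail_three_halves m0) auto
  also have "\<dots> \<le> N * (4 * exp L) * (2 / exp L)"
  proof (intro mult_mono mult_left_mono divide_left_mono)
    have "norm s \<le> \<bar>Re s\<bar> + \<bar>Im s\<bar>" by (rule cmod_le)
    then show "norm s \<le> 4 * exp L" using s re eL by linarith
    have "exp L = sqrt (exp (2 * L))" by (rule real_sqrt_unique[symmetric]) (simp_all add: power2_eq_square exp_add[symmetric])
    also have "\<dots> \<le> sqrt (real m)" using m1 by simp
    finally show "exp L \<le> sqrt (real m)" .
  qed (use N m0 in auto)
  also have "\<dots> = 8 * N" by simp
  also have "\<dots> \<le> 8 * L * N" using L N by simp
  finally have 3: "norm (\<Sum>k. zeta_reg_term (Suc (k + m)) s) \<le> 8 * L * N" .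
  have "norm (zeta_reg s) \<le> N * norm (\<Sum>k<m. of_nat (Suc k) powr (- s)) + norm (of_nat (Suc m) powr (1 - s))
      + norm (\<Sum>k. zeta_reg_term (Suc (k + m)) s)"
    unfolding eq N_def norm_mult[symmetric] by (intro order_trans[OF norm_triangle_ineq] add_mono norm_triangle_ineq) auto
  also have "\<dots> \<le> N * (4 * exp 3 * L) + exp 3 / \<tau> * L * N + 8 * L * N"
    using N by (intro add_mono mult_left_mono 1 2 3) auto
  also have "\<dots> = (4 * exp 3 + exp 3 / \<tau> + 8) * L * N" by (simp add: algebra_simps)
  finally show ?thesis by (simp add: N_def)
qed

section \<open>The logarithm of zeta and the 3-4-1 inequality\<close>

lemma tendsto_dirichlet_series_at_top:
  assumes "dirichlet_summable f"
  shows "((\<lambda>\<sigma>. dirichlet_series f (of_real \<sigma>)) \<longlongrightarrow> f 1) at_top"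
proof -
  define K where "K = (\<Sum>n. norm (f n) * real n powr (- 2))"
  have sm: "summable (\<lambda>n. norm (f n) * real n powr (- 2))" using assms by (simp add: dirichlet_summable_def)
  have "norm (dirichlet_series f (of_real \<sigma>) - f 1) \<le> 2 powr (2 - \<sigma>) * K" if \<sigma>: "\<sigma> \<ge> 2" for \<sigma>
  proof -
    have "(\<lambda>n. f n * of_nat n powr (- of_real \<sigma>)) sums dirichlet_series f (of_real \<sigma>)"
      by (rule dirichlet_series_sums) (use assms \<sigma> in auto)
    moreover have "(\<lambda>n. if n = 1 then f n else 0) sums f 1" by (rule sums_single)
    ultimately have "(\<lambda>n. f n * of_nat n powr (- of_real \<sigma>) - (if n = 1 then f n else 0)) sums (dirichlet_series f (of_real \<sigma>) - f 1)"
      by (rule sums_diff)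
    then have "dirichlet_series f (of_real \<sigma>) - f 1 = (\<Sum>n. f n * of_nat n powr (- of_real \<sigma>) - (if n = 1 then f n else 0))"
      by (simp add: sums_iff)
    also have "norm \<dots> \<le> (\<Sum>n. 2 powr (2 - \<sigma>) * (norm (f n) * real n powr (- 2)))"
    proof (rule norm_suminf_le[OF _ summable_mult[OF sm]])
      fix n :: nat
      consider "n = 0" | "n = 1" | "n \<ge> 2" by linarith
      then show "norm (f n * of_nat n powr (- of_real \<sigma>) - (if n = 1 then f n else 0)) \<le>
          2 powr (2 - \<sigma>) * (norm (f n) * real n powr (- 2))"
      proof cases
        case 3
        \<comment> \<open>Every term with n \<ge> 2 is its value at \<sigma> = 2 times a factor that
          is at most 2^(2 - \<sigma>), uniformly in n.\<close>
        have "real n powr (- \<sigma>) = real n powr (2 - \<sigma>) * real n powr (- 2)"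
          using 3 by (simp add: powr_add[symmetric])
        also have "\<dots> \<le> 2 powr (2 - \<sigma>) * real n powr (- 2)"
          using 3 \<sigma> by (intro mult_right_mono powr_mono2') auto
        finally have "norm (f n) * real n powr (- \<sigma>) \<le> norm (f n) * (2 powr (2 - \<sigma>) * real n powr (- 2))"
          by (intro mult_left_mono) auto
        then show ?thesis using 3 by (simp add: norm_mult mult_ac)
      qed auto
    qed
    also have "\<dots> = 2 powr (2 - \<sigma>) * K" unfolding K_def by (rule suminf_mult[OF sm])
    finally show ?thesis .
  qed
  then have "\<forall>\<^sub>F \<sigma> in at_top. norm (dirichlet_series f (of_real \<sigma>) - f 1) \<le> 2 powr (2 - \<sigma>) * K"
    by (auto simp: eventually_at_top_linorder)
  moreover have "((\<lambda>\<sigma>::real. 2 powr (2 - \<sigma>) * K) \<longlongrightarrow> 0) at_top" by real_asymp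
  ultimately have "((\<lambda>\<sigma>. dirichlet_series f (of_real \<sigma>) - f 1) \<longlongrightarrow> 0) at_top"
    by (rule Lim_null_comparison)
  then show ?thesis by (simp add: LIM_zero_iff)
qed

lemma dirichlet_summable_mangoldt: "dirichlet_summable mangoldt"
proof (rule dsummableI)
  fix e :: real assume e: "e > 0"
  have "norm (mangoldt n :: complex) \<le> 1 / e * real n powr e" if "n > 0" for n
    using mangoldt_le[OF that] ln_powr_bound[of "real n" e] that e by simp
  then show "\<exists>C. \<forall>n>0. norm (mangoldt n :: complex) \<le> C * real n powr e" by blast
qed

lemma dirichlet_summable_bounded:
  assumes "\<And>n. norm (f n) \<le> 1"
  shows "dirichlet_summable f"
proof (rule dsummableI)
  fix e :: real assume e: "e > 0"
  have "norm (f n) \<le> 1 * real n powr e" if "n > 0" for n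
    using assms[of n] ge_one_powr_ge_zero[of "real n" e] that e by (simp add: order_trans)
  then show "\<exists>C. \<forall>n>0. norm (f n) \<le> C * real n powr e" by blast
qed

lemma dirichlet_summable_moebius: "dirichlet_summable (\<lambda>n. of_int (moebius n))"
proof (rule dirichlet_summable_bounded)
  fix n
  have "norm (complex_of_int (moebius n)) = \<bar>real_of_int (moebius n)\<bar>" by (rule norm_of_int)
  then show "norm (complex_of_int (moebius n)) \<le> 1" using abs_moebius_le[of n] by linarith
qed

lemma dirichlet_series_moebius_mult_zeta:
  assumes "Re s > 1"
  shows "dirichlet_series (\<lambda>n. of_int (moebius n)) s * zeta s = 1"
proof -
  have "dirichlet_series (\<lambda>n. of_int (moebius n)) s * zeta s = dirichlet_series (\<lambda>n. if n = 1 then 1 else 0) s"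
  proof (rule dirichlet_series_mult[OF dirichlet_summable_moebius dirichlet_summable_1 assms])
    fix n :: nat assume "n > 0"
    then have "of_int (\<Sum>d | d dvd n. moebius d) = (if n = 1 then 1 else (0::complex))"
      by (simp only: sum_moebius_divisors) simp
    then show "(if n = 1 then 1 else 0) = (\<Sum>d | d dvd n. of_int (moebius d) * (1::complex))"
      by simp
  qed
  also have "\<dots> = (\<Sum>n. if n = 1 then 1 else 0)"
    unfolding dirichlet_series_def by (intro suminf_cong) auto
  also have "\<dots> = 1" using sums_single[of 1 "\<lambda>_. 1 :: complex"] by (simp add: sums_iff)
  finally show ?thesis .
qed

lemma zeta_nonzero: "Re s > 1 \<Longrightarrow> zeta s \<noteq> 0"
  using dirichlet_series_moebius_mult_zeta[of s] by auto

lemma zeta_has_field_derivative: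
  assumes "Re s > 1"
  shows "(zeta has_field_derivative - (zeta s * dirichlet_series mangoldt s)) (at s)"
proof -
  have "dirichlet_series mangoldt s * zeta s = dirichlet_series (\<lambda>n. of_real (ln (real n))) s"
    by (rule dirichlet_series_mult[OF dirichlet_summable_mangoldt dirichlet_summable_1 assms]) (simp add: mangoldt_sum)
  also have "\<dots> = - dirichlet_series (\<lambda>n. - of_real (ln (real n)) * 1) s"
    using sums_minus[OF dirichlet_series_sums[OF dirichlet_summable_ln[OF dirichlet_summable_1] assms]]
    by (simp add: dirichlet_series_def sums_iff)
  finally show ?thesis
    using dirichlet_series_has_field_derivative[OF dirichlet_summable_1 assms] by (simp add: mult.commute)
qed

text \<open>The coefficient at a prime power p^k is 1/k; at all other n, in particular at 1,
  \<open>mangoldt\<close> vanishes and the coefficient is 0.\<close>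

definition ln_zeta :: "complex \<Rightarrow> complex" where
  "ln_zeta = dirichlet_series (\<lambda>n. mangoldt n / of_real (ln (real n)))"

lemma dirichlet_summable_ln_zeta: "dirichlet_summable (\<lambda>n. mangoldt n / of_real (ln (real n)))"
proof (rule dirichlet_summable_bounded)
  fix n
  show "norm (mangoldt n / of_real (ln (real n)) :: complex) \<le> 1"
  proof (cases "n \<ge> 2")
    case True
    then show ?thesis using mangoldt_le[of n] by (simp add: norm_divide divide_simps)
  next
    case False
    then have "n = 0 \<or> n = 1" by linarith
    then show ?thesis by auto
  qed
qed

text \<open>The product of zeta and exp (- ln_zeta) has derivative 0, and its constant value is 1 by
  the limit along the real axis. No branch of the complex logarithm and no infinite product has to
  be handled.\<close>

lemma zeta_eq_exp_ln_zeta: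
  assumes s: "Re s > 1"
  shows "zeta s = exp (ln_zeta s)"
proof -
  let ?S = "{s. Re s > 1}"
  have "((\<lambda>s. zeta s * exp (- ln_zeta s)) has_field_derivative 0) (at s)" if "Re s > 1" for s
  proof -
    have "(ln_zeta has_field_derivative dirichlet_series (\<lambda>n. - of_real (ln (real n)) * (mangoldt n / of_real (ln (real n)))) s) (at s)"
      unfolding ln_zeta_def by (rule dirichlet_series_has_field_derivative[OF dirichlet_summable_ln_zeta that])
    also have "(\<lambda>n. - of_real (ln (real n)) * (mangoldt n / of_real (ln (real n)))) = (\<lambda>n. - mangoldt n :: complex)"
    proof
      fix n :: nat
      consider "n = 0" | "n = 1" | "n \<ge> 2" by linarith
      then show "- of_real (ln (real n)) * (mangoldt n / of_real (ln (real n))) = (- mangoldt n :: complex)"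
        by cases auto
    qed
    also have "dirichlet_series (\<lambda>n. - mangoldt n) s = - dirichlet_series mangoldt s"
      using sums_minus[OF dirichlet_series_sums[OF dirichlet_summable_mangoldt that]] by (simp add: dirichlet_series_def sums_iff)
    finally show ?thesis
      using zeta_has_field_derivative[OF that] by (auto intro!: derivative_eq_intros)
  qed
  then have "\<exists>c. \<forall>s\<in>?S. zeta s * exp (- ln_zeta s) = c"
    by (intro has_field_derivative_zero_constant convex_halfspace_Re_gt) (auto intro: has_field_derivative_at_within)
  then obtain c where c: "\<And>s. Re s > 1 \<Longrightarrow> zeta s * exp (- ln_zeta s) = c" by auto
  have "((\<lambda>\<sigma>. zeta (of_real \<sigma>) * exp (- ln_zeta (of_real \<sigma>))) \<longlongrightarrow> 1 * exp (- (mangoldt 1 / of_real (ln (real 1))))) at_top"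
    unfolding ln_zeta_def by (intro tendsto_intros tendsto_dirichlet_series_at_top dirichlet_summable_1 dirichlet_summable_ln_zeta)
  moreover have "\<forall>\<^sub>F \<sigma> in at_top. zeta (of_real \<sigma>) * exp (- ln_zeta (of_real \<sigma>)) = c"
    using eventually_gt_at_top[of 1] by eventually_elim (simp add: c)
  ultimately have "((\<lambda>_::real. c) \<longlongrightarrow> 1) at_top"
    by (auto elim: Lim_transform_eventually)
  then have "c = 1" by (simp add: tendsto_const_iff)
  then show ?thesis using c[OF s] by (simp add: exp_minus field_simps)
qed

text \<open>After taking logarithms, the coefficient at n is a nonnegative multiple of the real part
  of 3 + 4 w + w^2 with w = n^(-it). As w lies on the unit circle, this real part is the square 2 (1
  + Re w)^2.\<close>

lemma zeta_3_4_1: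
  assumes "\<sigma> > 1"
  shows "norm (zeta (of_real \<sigma>)) ^ 3 * norm (zeta (Complex \<sigma> t)) ^ 4 * norm (zeta (Complex \<sigma> (2 * t))) \<ge> 1"
proof -
  let ?c = "\<lambda>n. mangoldt n / of_real (ln (real n)) :: complex"
  have 1: "(\<lambda>n. ?c n * of_nat n powr (- s)) sums ln_zeta s" if "Re s > 1" for s
    unfolding ln_zeta_def by (rule dirichlet_series_sums[OF dirichlet_summable_ln_zeta that])
  have "(\<lambda>n. 3 * (?c n * of_nat n powr (- of_real \<sigma>)) + 4 * (?c n * of_nat n powr (- Complex \<sigma> t))
      + ?c n * of_nat n powr (- Complex \<sigma> (2 * t))) sums
     (3 * ln_zeta (of_real \<sigma>) + 4 * ln_zeta (Complex \<sigma> t) + ln_zeta (Complex \<sigma> (2 * t)))"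
    using assms by (intro sums_add sums_mult 1) auto
  then have "(\<lambda>n. Re (3 * (?c n * of_nat n powr (- of_real \<sigma>)) + 4 * (?c n * of_nat n powr (- Complex \<sigma> t))
      + ?c n * of_nat n powr (- Complex \<sigma> (2 * t)))) sums
     Re (3 * ln_zeta (of_real \<sigma>) + 4 * ln_zeta (Complex \<sigma> t) + ln_zeta (Complex \<sigma> (2 * t)))"
    by (rule sums_Re)
  moreover have "Re (3 * (?c n * of_nat n powr (- of_real \<sigma>)) + 4 * (?c n * of_nat n powr (- Complex \<sigma> t))
      + ?c n * of_nat n powr (- Complex \<sigma> (2 * t))) \<ge> 0" for n
  proof (cases "n = 0")
    case False
    define w :: complex where "w = of_nat n powr (- (\<i> * of_real t))"
    have "norm w = 1" using False by (simp add: w_def)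
    then have w: "Re w ^ 2 + Im w ^ 2 = 1" by (metis cmod_power2 one_power2)
    have r: "of_nat n powr (- of_real \<sigma>) = (of_real (real n powr (- \<sigma>)) :: complex)"
      by (metis of_nat_0_le_iff of_real_minus of_real_of_nat_eq powr_of_real)
    have a: "of_nat n powr (- Complex \<sigma> t) = of_real (real n powr (- \<sigma>)) * w"
      unfolding r[symmetric] w_def by (simp add: powr_add[symmetric] Complex_eq)
    have b: "of_nat n powr (- Complex \<sigma> (2 * t)) = of_real (real n powr (- \<sigma>)) * w ^ 2"
      unfolding r[symmetric] w_def power2_eq_square by (simp add: powr_add[symmetric] Complex_eq algebra_simps)
    define q where "q = mangoldt n / ln (real n) * real n powr (- \<sigma>)"
    have q: "q \<ge> 0" using False by (simp add: q_def mangoldt_nonneg)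
    have "3 * (?c n * of_nat n powr (- of_real \<sigma>)) + 4 * (?c n * of_nat n powr (- Complex \<sigma> t))
      + ?c n * of_nat n powr (- Complex \<sigma> (2 * t)) = of_real q * (3 + 4 * w + w ^ 2)"
      unfolding a b r q_def by (simp add: algebra_simps add_divide_distrib)
    also have "Re \<dots> = q * (3 + 4 * Re w + (Re w ^ 2 - Im w ^ 2))"
      by (simp add: power2_eq_square)
    also have "3 + 4 * Re w + (Re w ^ 2 - Im w ^ 2) = 2 * (1 + Re w) ^ 2"
      using w by (simp add: power2_eq_square algebra_simps)
    finally show ?thesis using q by simp
  qed simp
  ultimately have nn: "Re (3 * ln_zeta (of_real \<sigma>) + 4 * ln_zeta (Complex \<sigma> t) + ln_zeta (Complex \<sigma> (2 * t))) \<ge> 0"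
    by (metis (no_types, lifting) sums_le sums_zero)
  have "norm (zeta (of_real \<sigma>)) ^ 3 * norm (zeta (Complex \<sigma> t)) ^ 4 * norm (zeta (Complex \<sigma> (2 * t)))
      = exp (3 * Re (ln_zeta (of_real \<sigma>))) * exp (4 * Re (ln_zeta (Complex \<sigma> t))) * exp (Re (ln_zeta (Complex \<sigma> (2 * t))))"
    using assms by (simp add: zeta_eq_exp_ln_zeta exp_of_nat_mult[of 3, simplified] exp_of_nat_mult[of 4, simplified])
  also have "\<dots> = exp (Re (3 * ln_zeta (of_real \<sigma>) + 4 * ln_zeta (Complex \<sigma> t) + ln_zeta (Complex \<sigma> (2 * t))))"
    by (simp add: exp_add[symmetric])
  also have "\<dots> \<ge> 1" using nn by simp
  finally show ?thesis .
qed

section \<open>Lower bounds for zeta and the derivatives of its inverse\<close>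

lemma zeta_reg_1: "zeta_reg 1 = 1"
  by (simp add: zeta_reg_def zeta_reg_term_def del: of_nat_Suc)

text \<open>Let Z be the quotient of \<open>zeta_reg s\<close> by s - 1. For Re s \<ge> 1 + \<eta>
  the 3-4-1 inequality, with K / \<eta> at the real point and C L at twice the height, yields norm
  (Z s) ^ 4 \<ge> \<eta>^3 / (B L). Further left, Cauchy's estimate limits the change of Z to D L^2
  per unit length, over a distance of at most 2 \<eta>. For \<eta> = b^4 / L^9 both quantities have
  order L^(-7), and a small b makes the lower bound win.\<close>

lemma zeta_reg_lower:
  fixes \<tau> :: real
  assumes \<tau>: "0 < \<tau>" "\<tau> \<le> 1"
  obtains c \<beta> where "c > 0" "0 < \<beta>" "\<beta> \<le> 1"
    "\<And>L s. L \<ge> 2 \<Longrightarrow> \<tau> \<le> \<bar>Im s\<bar> \<Longrightarrow> 2 * \<bar>Im s\<bar> + 1 \<le> exp L \<Longrightarrow> 1 - \<beta> / L ^ 9 \<le> Re s \<Longrightarrow> Re s \<le> 5 / 2 \<Longrightarrow>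
       norm (zeta_reg s) \<ge> c / L ^ 7 * norm (s - 1)"
proof -
  define Z where "Z = (\<lambda>s. zeta_reg s / (s - 1))"
  have hol: "zeta_reg holomorphic_on {s. 0 < Re s}" by (rule zeta_reg_holomorphic)
  have "bounded (zeta_reg ` (of_real ` {1..3}))"
    by (intro compact_imp_bounded compact_continuous_image continuous_on_of_real continuous_on_id compact_Icc
        continuous_on_subset[OF holomorphic_on_imp_continuous_on[OF hol]]) auto
  then obtain K0 where K0: "\<And>\<sigma>. 1 \<le> \<sigma> \<Longrightarrow> \<sigma> \<le> 3 \<Longrightarrow> norm (zeta_reg (of_real \<sigma>)) \<le> K0"
    unfolding bounded_iff by (metis atLeastAtMost_iff imageI)
  define K where "K = max 1 K0"
  have K: "K \<ge> 1" "\<And>\<sigma>. 1 < \<sigma> \<Longrightarrow> \<sigma> \<le> 3 \<Longrightarrow> norm (zeta (of_real \<sigma>)) \<le> K / (\<sigma> - 1)"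
  proof -
    show "K \<ge> 1" by (simp add: K_def)
    fix \<sigma> :: real assume \<sigma>: "1 < \<sigma>" "\<sigma> \<le> 3"
    have "zeta_reg (of_real \<sigma>) = of_real (\<sigma> - 1) * zeta (of_real \<sigma>)"
      using zeta_reg_eq_zeta[of "of_real \<sigma>"] \<sigma> by simp
    then have "norm (zeta_reg (of_real \<sigma>)) = (\<sigma> - 1) * norm (zeta (of_real \<sigma>))"
      using \<sigma> by (simp only: norm_mult norm_of_real)
    then show "norm (zeta (of_real \<sigma>)) \<le> K / (\<sigma> - 1)"
      using K0[of \<sigma>] \<sigma> by (simp add: K_def field_simps)
  qed
  define C where "C = 4 * exp 3 + exp 3 / (\<tau> / 2) + 8"
  have C: "C \<ge> 1" using \<tau> by (simp add: C_def add_nonneg_nonneg)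
  have Zle: "norm (Z s) \<le> C * L" if "L \<ge> 2" "\<tau> / 2 \<le> \<bar>Im s\<bar>" "\<bar>Im s\<bar> \<le> exp L" "1 - 1 / L \<le> Re s" "Re s \<le> 3" for s L
  proof -
    have "s \<noteq> 1" using that \<tau> by auto
    then show ?thesis using norm_zeta_reg_le[of L "\<tau> / 2" s] that \<tau> by (simp add: Z_def norm_divide C_def field_simps)
  qed
  have Zhol: "Z holomorphic_on {s. 0 < Re s} - {1}"
    unfolding Z_def by (intro holomorphic_intros holomorphic_on_subset[OF hol]) auto
  define D where "D = 2 * C / \<tau>"
  have D: "D \<ge> 1" using C \<tau> by (simp add: D_def field_simps)
  have dZ: "norm (deriv Z s) \<le> D * L ^ 2" if L: "L \<ge> 2" and s: "\<tau> \<le> \<bar>Im s\<bar>" "\<bar>Im s\<bar> + 1 \<le> exp L" "1 - 1 / (2 * L) \<le> Re s" "Re s \<le> 11 / 4" for s L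
  proof -
    \<comment> \<open>Discs of this radius stay in the strip of the upper bound, at heights at least
      \<tau>/2 and thus away from the pole; dividing C L by r gives D L^2.\<close>
    define r where "r = \<tau> / (2 * L)"
    have r: "r > 0" "r \<le> 1 / (2 * L)" "r \<le> \<tau> / 4" "r \<le> 1 / 4" using \<tau> L by (auto simp: r_def field_simps)
    have near: "\<tau> / 2 \<le> \<bar>Im w\<bar>" "\<bar>Im w\<bar> \<le> exp L" "1 - 1 / L \<le> Re w" "Re w \<le> 3" if "norm (s - w) \<le> r" for w
    proof -
      have "\<bar>Im s - Im w\<bar> \<le> r" "\<bar>Re s - Re w\<bar> \<le> r"
        using that abs_Im_le_cmod[of "s - w"] abs_Re_le_cmod[of "s - w"] by auto
      moreover have "1 / L = 1 / (2 * L) + 1 / (2 * L)" by (simp add: field_simps)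
      ultimately show "\<tau> / 2 \<le> \<bar>Im w\<bar>" "\<bar>Im w\<bar> \<le> exp L" "1 - 1 / L \<le> Re w" "Re w \<le> 3"
        using r s \<tau> by linarith+
    qed
    have "cball s r \<subseteq> {s. 0 < Re s} - {1}"
    proof
      fix w assume "w \<in> cball s r"
      then have n: "norm (s - w) \<le> r" by (simp add: dist_norm)
      have "1 / L \<le> 1 / 2" using L by (simp add: field_simps)
      then show "w \<in> {s. 0 < Re s} - {1}" using near[OF n] \<tau> by auto
    qed
    then have h: "Z holomorphic_on cball s r" using Zhol holomorphic_on_subset by blast
    have "norm ((deriv ^^ 1) Z s) \<le> fact 1 * (C * L) / r ^ 1"
      using h r
      by (intro Cauchy_inequality holomorphic_on_imp_continuous_on holomorphic_on_subset[OF h] Zle near)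
        (use L in auto)
    also have "\<dots> = D * L ^ 2" using \<tau> L by (simp add: r_def D_def power2_eq_square)
    finally show ?thesis by simp
  qed
  define B where "B = K ^ 3 * C"
  have B: "B \<ge> 1" using K C by (simp add: B_def mult_ge1_I one_le_power)
  \<comment> \<open>With this value the loss 2 D b^4 from the derivative is exactly half of the
    3-4-1 bound b^3 / B.\<close>
  define b where "b = 1 / (4 * B * D)"
  have b: "0 < b" "b \<le> 1 / 4"
    using B D mult_mono[of 1 B 1 D] by (auto simp: b_def divide_simps)
  have b4: "b ^ 4 \<le> 1 / 4" using power_decreasing[of 1 4 b] b by simp
  \<comment> \<open>The scale \<open>b ^ 4 / L ^ 9\<close> makes the fourth root of the 3-4-1 bound exact.\<close>
  have right: "norm (Z s) \<ge> b ^ 3 / (B * L ^ 7)"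
    if L: "L \<ge> 2" and s: "\<tau> \<le> \<bar>Im s\<bar>" "2 * \<bar>Im s\<bar> + 1 \<le> exp L" "1 + b ^ 4 / L ^ 9 \<le> Re s" "Re s \<le> 3" for s L
  proof -
    define \<eta> where "\<eta> = b ^ 4 / L ^ 9"
    have \<eta>: "\<eta> > 0" using b L by (simp add: \<eta>_def)
    have s1: "Re s > 1" using s \<eta> by (simp add: \<eta>_def)
    have Zz: "zeta w = Z w" if "Re w > 1" for w
      using zeta_reg_eq_zeta[OF that] that by (auto simp: Z_def)
    have "norm (zeta (of_real (Re s))) ^ 3 \<le> (K / (Re s - 1)) ^ 3"
      using K(2)[of "Re s"] s s1 by (intro power_mono) auto
    also have "\<dots> \<le> (K / \<eta>) ^ 3"
      using \<eta> s s1 K(1) unfolding \<eta>_def[symmetric] by (intro power_mono divide_left_mono mult_pos_pos) auto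
    finally have 1: "norm (zeta (of_real (Re s))) ^ 3 \<le> (K / \<eta>) ^ 3" .
    have 2: "norm (zeta (Complex (Re s) (2 * Im s))) \<le> C * L"
    proof -
      have "norm (Z (Complex (Re s) (2 * Im s))) \<le> C * L"
        using L s s1 \<tau> by (intro Zle) (auto intro: order_trans[of _ 1])
      then show ?thesis using s1 by (simp add: Zz)
    qed
    have "1 \<le> norm (zeta (of_real (Re s))) ^ 3 * norm (zeta s) ^ 4 * norm (zeta (Complex (Re s) (2 * Im s)))"
      using zeta_3_4_1[OF s1, of "Im s"] by simp
    also have "\<dots> \<le> (K / \<eta>) ^ 3 * norm (zeta s) ^ 4 * (C * L)"
      using K \<eta> C L by (intro mult_mono 1 2) auto
    also have "\<dots> = norm (zeta s) ^ 4 * (B * L / \<eta> ^ 3)"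
      by (simp add: B_def power_divide)
    finally have "\<eta> ^ 3 / (B * L) \<le> norm (zeta s) ^ 4"
      using \<eta> B L by (simp add: field_simps)
    moreover have "(b ^ 3 / (B * L ^ 7)) ^ 4 \<le> \<eta> ^ 3 / (B * L)"
    proof -
      have "(b ^ 3 / (B * L ^ 7)) ^ 4 = b ^ 12 / (B ^ 4 * L ^ 28)"
        by (simp add: power_divide power_mult_distrib flip: power_mult)
      also have "\<dots> \<le> b ^ 12 / (B * L ^ 28)"
        using B L b power_increasing[of 1 4 B] by (intro divide_left_mono mult_right_mono) auto
      also have "\<dots> = \<eta> ^ 3 / (B * L)"
      proof -
        have "L ^ 28 = L ^ 27 * L" using power_add[of L 27 1] by simp
        then show ?thesis by (simp add: \<eta>_def power_divide mult_ac flip: power_mult)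
      qed
      finally show ?thesis .
    qed
    ultimately have "(b ^ 3 / (B * L ^ 7)) ^ 4 \<le> norm (zeta s) ^ 4" by linarith
    then have "b ^ 3 / (B * L ^ 7) \<le> norm (zeta s)" by (rule power_le_imp_le_base[of _ 3, simplified]) simp
    then show ?thesis using Zz[OF s1] by simp
  qed
  have all: "norm (Z s) \<ge> b ^ 3 / (2 * B) / L ^ 7"
    if L: "L \<ge> 2" and s: "\<tau> \<le> \<bar>Im s\<bar>" "2 * \<bar>Im s\<bar> + 1 \<le> exp L" "1 - b ^ 4 / L ^ 9 \<le> Re s" "Re s \<le> 5 / 2" for s L
  proof (cases "1 + b ^ 4 / L ^ 9 \<le> Re s")
    case True
    then have "b ^ 3 / (B * L ^ 7) \<le> norm (Z s)" using right[OF L s(1,2)] s by simp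
    moreover have "b ^ 3 / (2 * B) / L ^ 7 \<le> b ^ 3 / (B * L ^ 7)"
      using b B L by (simp add: divide_simps)
    ultimately show ?thesis by linarith
  next
    case False
    define \<eta> where "\<eta> = b ^ 4 / L ^ 9"
    have L9: "1 / L ^ 9 \<le> 1 / L" using L power_increasing[of 1 9 L] by (intro divide_left_mono) auto
    have \<eta>: "\<eta> > 0" using b L by (simp add: \<eta>_def)
    have "b ^ 4 * (1 / L ^ 9) \<le> 1 / 4 * (1 / L)" using b4 L9 b L by (intro mult_mono) auto
    then have \<eta>2: "\<eta> \<le> 1 / (4 * L)" by (simp add: \<eta>_def)
    have L4: "1 / (4 * L) \<le> 1 / 8" "1 / (4 * L) \<le> 1 / (2 * L)" using L by (auto simp: field_simps)
    define s' where "s' = Complex (1 + \<eta>) (Im s)"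
    have "norm (Z s') \<ge> b ^ 3 / (B * L ^ 7)"
    proof (intro right)
      have "\<eta> \<le> 2" using L4 \<eta>2 by linarith
      then show "Re s' \<le> 3" by (simp add: s'_def)
    qed (use s L in \<open>auto simp: s'_def \<eta>_def\<close>)
    moreover have "norm (Z s' - Z s) \<le> D * L ^ 2 * norm (s' - s)"
    proof (rule field_differentiable_bound[where S = "closed_segment s s'" and f' = "deriv Z"])
      fix z assume z: "z \<in> closed_segment s s'"
      have "Im z = Im s \<and> Re s \<le> Re z \<and> Re z \<le> 1 + \<eta>"
      proof -
        have "z \<in> closed_segment (Complex (Re s) (Im s)) (Complex (1 + \<eta>) (Im s))" using z by (simp add: s'_def)
        then have "Im z = Im s \<and> Re z \<in> closed_segment (Re s) (1 + \<eta>)"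
          by (auto simp: closed_segment_same_Im)
        then show ?thesis using False by (auto simp: closed_segment_eq_real_ivl \<eta>_def split: if_splits)
      qed
      then have zz: "Im z = Im s" "1 - 1 / (2 * L) \<le> Re z" "Re z \<le> 11 / 4"
        using s L4 \<eta>2 unfolding \<eta>_def[symmetric] by auto
      then show "norm (deriv Z z) \<le> D * L ^ 2" using L s \<tau> by (intro dZ) auto
      have "z \<in> {s. 0 < Re s} - {1}" using zz s \<tau> L4 by auto
      moreover have "open ({s. 0 < Re s} - {1::complex})" by (intro open_Diff open_halfspace_Re_gt) auto
      ultimately show "(Z has_field_derivative deriv Z z) (at z within closed_segment s s')"
        using Zhol holomorphic_derivI has_field_derivative_at_within by blast
    qed auto
    moreover have "D * L ^ 2 * norm (s' - s) \<le> D * L ^ 2 * (2 * \<eta>)"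
    proof (rule mult_left_mono)
      have "s' - s = of_real (1 + \<eta> - Re s)" by (simp add: s'_def complex_eq_iff)
      then have "norm (s' - s) = \<bar>1 + \<eta> - Re s\<bar>" by (simp only: norm_of_real)
      then show "norm (s' - s) \<le> 2 * \<eta>" using False s unfolding \<eta>_def[symmetric] by linarith
    qed (use D in auto)
    moreover have "D * L ^ 2 * (2 * \<eta>) = b ^ 3 / (2 * B) / L ^ 7"
    proof -
      have L9: "L ^ 9 = L ^ 7 * L ^ 2" using power_add[of L 7 2] by simp
      have "b ^ 4 = b ^ 3 * (1 / (4 * B * D))" using b_def power_Suc2[of b 3] by (simp add: numeral_eq_Suc)
      then have b3: "b ^ 3 = b ^ 4 * (4 * B * D)" using B D by (simp add: field_simps)
      show ?thesis unfolding \<eta>_def L9 b3 using D B L by (simp add: divide_simps)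
    qed
    moreover have "b ^ 3 / (B * L ^ 7) = b ^ 3 / (2 * B) / L ^ 7 + b ^ 3 / (2 * B) / L ^ 7"
      using B L by (simp add: divide_simps)
    moreover have "norm (Z s') \<le> norm (Z s' - Z s) + norm (Z s)"
      using norm_triangle_ineq[of "Z s' - Z s" "Z s"] by simp
    ultimately show ?thesis by linarith
  qed
  show thesis
  proof (rule that[of "b ^ 3 / (2 * B)" "b ^ 4"])
    show "b ^ 3 / (2 * B) > 0" "0 < b ^ 4" "b ^ 4 \<le> 1" using b B b4 by auto
    fix L s assume *: "L \<ge> 2" "\<tau> \<le> \<bar>Im s\<bar>" "2 * \<bar>Im s\<bar> + 1 \<le> exp L" "1 - b ^ 4 / L ^ 9 \<le> Re s" "Re s \<le> 5 / 2"
    have "s \<noteq> 1" using *(2) \<tau> by auto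
    then show "b ^ 3 / (2 * B) / L ^ 7 * norm (s - 1) \<le> norm (zeta_reg s)"
      using all[OF *] by (simp add: Z_def norm_divide pos_le_divide_eq)
  qed
qed

text \<open>To the right of the line the Moebius series inverts zeta, and at s = 1 the value is 1.
  At any other point of the line the quantitative bound is used at that height, with \<tau> and L
  adapted to it.\<close>

lemma zeta_reg_nonzero:
  assumes "Re s \<ge> 1"
  shows "zeta_reg s \<noteq> 0"
proof (cases "Im s = 0")
  case True
  show ?thesis
  proof (cases "s = 1")
    case False
    then have "Re s > 1" using True assms by (auto simp: complex_eq_iff)
    then show ?thesis using zeta_reg_eq_zeta[of s] zeta_nonzero[of s] False by simp
  qed (simp add: zeta_reg_1)
next
  case False
  show ?thesis
  proof (cases "Re s > 1")
    case True
    then show ?thesis using zeta_reg_eq_zeta[of s] zeta_nonzero[of s] by auto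
  next
    case gt: False
    define \<tau> where "\<tau> = min 1 \<bar>Im s\<bar>"
    have \<tau>: "0 < \<tau>" "\<tau> \<le> 1" "\<tau> \<le> \<bar>Im s\<bar>" using False by (auto simp: \<tau>_def)
    obtain c \<beta> where c: "c > 0" "0 < \<beta>"
      "\<And>L s. L \<ge> 2 \<Longrightarrow> \<tau> \<le> \<bar>Im s\<bar> \<Longrightarrow> 2 * \<bar>Im s\<bar> + 1 \<le> exp L \<Longrightarrow> 1 - \<beta> / L ^ 9 \<le> Re s \<Longrightarrow> Re s \<le> 5 / 2 \<Longrightarrow>
       norm (zeta_reg s) \<ge> c / L ^ 7 * norm (s - 1)"
      using zeta_reg_lower[OF \<tau>(1,2)] by metis
    define L where "L = 2 * \<bar>Im s\<bar> + 2"
    have L: "L \<ge> 2" "2 * \<bar>Im s\<bar> + 1 \<le> exp L"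
      using exp_ge_add_one_self[of L] by (auto simp: L_def)
    have "1 - \<beta> / L ^ 9 \<le> Re s" using c L assms by (intro order_trans[OF _ assms]) simp
    then have "norm (zeta_reg s) \<ge> c / L ^ 7 * norm (s - 1)" using gt by (intro c L \<tau>) auto
    moreover have "s \<noteq> 1" using False by auto
    then have "c / L ^ 7 * norm (s - 1) > 0" using c L by simp
    ultimately show ?thesis by auto
  qed
qed

lemma power_le_fact_exp:
  assumes "x \<ge> (0::real)"
  shows "x ^ m \<le> fact m * exp x"
proof -
  have "(\<lambda>n. x ^ n /\<^sub>R fact n) sums exp x" by (rule exp_converges)
  then have "(\<Sum>n\<in>{m}. x ^ n /\<^sub>R fact n) \<le> exp x"
    using sum_le_suminf[of "\<lambda>n. x ^ n /\<^sub>R fact n" "{m}"] assms by (simp add: sums_iff)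
  then show ?thesis by (simp add: field_simps)
qed

text \<open>This is 1/zeta in a form that makes sense across the line Re s = 1, where the Dirichlet
  series of zeta is no longer available; the pole of zeta becomes the zero at s = 1.\<close>

definition inv_zeta :: "complex \<Rightarrow> complex" where
  "inv_zeta s = (s - 1) / zeta_reg s"

lemma inv_zeta_eq_dirichlet_series:
  assumes "Re s > 1"
  shows "inv_zeta s = dirichlet_series (\<lambda>n. of_int (moebius n)) s"
proof -
  have "s \<noteq> 1" using assms by auto
  then show ?thesis
    unfolding inv_zeta_def zeta_reg_eq_zeta[OF assms]
    using dirichlet_series_moebius_mult_zeta[OF assms] zeta_nonzero[OF assms]
    by (simp add: divide_eq_eq)
qed

text \<open>At small height compactness suffices. At larger height, Cauchy's estimate is applied on
  a disc that reaches to the left of the line only as far as the lower bound for zeta does. All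
  resulting powers of ln |Im s| are then given away for a square root, which the kernel can still
  integrate.\<close>

lemma inv_zeta_higher_deriv_bound:
  obtains C where "C > 0"
    "\<And>s. 1 \<le> Re s \<Longrightarrow> Re s \<le> 2 \<Longrightarrow> norm ((deriv ^^ k) inv_zeta s) \<le> C * sqrt (1 + \<bar>Im s\<bar>)"
proof -
  let ?H = "{s. 0 < Re s}"
  define U where "U = {s \<in> ?H. zeta_reg s \<noteq> 0}"
  have opH: "open ?H" by (rule open_halfspace_Re_gt)
  have cont: "continuous_on ?H zeta_reg" using zeta_reg_holomorphic by (rule holomorphic_on_imp_continuous_on)
  have "open (?H \<inter> zeta_reg -` (- {0}))"
    by (rule continuous_open_preimage[OF cont opH]) auto
  also have "?H \<inter> zeta_reg -` (- {0}) = U" by (auto simp: U_def)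
  finally have opU: "open U" .
  have holU: "inv_zeta holomorphic_on U"
    unfolding inv_zeta_def by (intro holomorphic_intros holomorphic_on_subset[OF zeta_reg_holomorphic]) (auto simp: U_def)
  let ?K = "cbox (Complex 1 (- 2)) (Complex 2 2)"
  have KU: "?K \<subseteq> U" using zeta_reg_nonzero by (auto simp: U_def in_cbox_complex_iff)
  have "bounded ((deriv ^^ k) inv_zeta ` ?K)"
    by (intro compact_imp_bounded compact_continuous_image holomorphic_on_imp_continuous_on
        holomorphic_on_subset[OF holomorphic_higher_deriv[OF holU opU] KU]) auto
  then obtain C1 where C1: "\<And>s. s \<in> ?K \<Longrightarrow> norm ((deriv ^^ k) inv_zeta s) \<le> C1"
    unfolding bounded_iff by blast
  obtain c \<beta> where c: "c > 0" "0 < \<beta>" "\<beta> \<le> 1"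
    "\<And>L s. L \<ge> 2 \<Longrightarrow> 1 \<le> \<bar>Im s\<bar> \<Longrightarrow> 2 * \<bar>Im s\<bar> + 1 \<le> exp L \<Longrightarrow> 1 - \<beta> / L ^ 9 \<le> Re s \<Longrightarrow> Re s \<le> 5 / 2 \<Longrightarrow>
       norm (zeta_reg s) \<ge> c / L ^ 7 * norm (s - 1)"
    by (rule zeta_reg_lower[of 1]) auto
  \<comment> \<open>Seven logarithms come from the bound for 1/zeta itself, and nine for each
    derivative from the radius \<beta> / L^9 of the disc.\<close>
  define m where "m = 7 + 9 * k"
  define C2 where "C2 = fact k / c / \<beta> ^ k * (2 ^ m * fact m * exp 1 * sqrt 2)"
  have C2: "C2 \<ge> 0" using c by (simp add: C2_def)
  have large: "norm ((deriv ^^ k) inv_zeta s) \<le> C2 * sqrt (1 + \<bar>Im s\<bar>)"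
    if s: "1 \<le> Re s" "Re s \<le> 2" "\<bar>Im s\<bar> \<ge> 2" for s
  proof -
    define L where "L = ln (2 * (1 + \<bar>Im s\<bar>)) + 2"
    have L: "L \<ge> 2" by (simp add: L_def)
    have eL: "exp L = 2 * (1 + \<bar>Im s\<bar>) * exp 2" by (simp add: L_def exp_add)
    have "2 * (1 + \<bar>Im s\<bar>) * 1 \<le> 2 * (1 + \<bar>Im s\<bar>) * exp 2" by (intro mult_left_mono) auto
    then have eL2: "2 * \<bar>Im s\<bar> + 2 \<le> exp L" by (simp only: eL) simp
    define r where "r = \<beta> / L ^ 9"
    have "2 ^ 9 \<le> L ^ 9" using L by (intro power_mono) auto
    then have r: "r > 0" "r \<le> 1 / 2" using c L by (auto simp: r_def divide_simps)
    have near: "1 \<le> \<bar>Im w\<bar>" "2 * \<bar>Im w\<bar> + 1 \<le> exp L" "1 - \<beta> / L ^ 9 \<le> Re w" "Re w \<le> 5 / 2"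
      if "norm (s - w) \<le> r" for w
    proof -
      have "\<bar>Im s - Im w\<bar> \<le> r" "\<bar>Re s - Re w\<bar> \<le> r"
        using that abs_Im_le_cmod[of "s - w"] abs_Re_le_cmod[of "s - w"] by auto
      then show "1 \<le> \<bar>Im w\<bar>" "2 * \<bar>Im w\<bar> + 1 \<le> exp L" "1 - \<beta> / L ^ 9 \<le> Re w" "Re w \<le> 5 / 2"
        using r s eL2 unfolding r_def[symmetric] by linarith+
    qed
    have bnd: "norm (zeta_reg w) \<ge> c / L ^ 7 * norm (w - 1)" if "norm (s - w) \<le> r" for w
      by (intro c(4) near[OF that] L)
    have "cball s r \<subseteq> U"
    proof
      fix w assume "w \<in> cball s r"
      then have n: "norm (s - w) \<le> r" by (simp add: dist_norm)
      then have "w \<noteq> 1" "Re w > 0" using near[OF n] s r unfolding r_def[symmetric] by auto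
      then have "0 < c / L ^ 7 * norm (w - 1)" using c L by simp
      then have "zeta_reg w \<noteq> 0" using bnd[OF n] by auto
      then show "w \<in> U" using \<open>Re w > 0\<close> by (simp add: U_def)
    qed
    then have h: "inv_zeta holomorphic_on cball s r" using holU holomorphic_on_subset by blast
    have "norm ((deriv ^^ k) inv_zeta s) \<le> fact k * (L ^ 7 / c) / r ^ k"
    proof (rule Cauchy_inequality)
      show "inv_zeta holomorphic_on ball s r" "continuous_on (cball s r) inv_zeta"
        using h by (auto intro: holomorphic_on_imp_continuous_on holomorphic_on_subset[OF h])
      show "0 < r" by fact
      fix w assume "norm (s - w) = r"
      then have n: "norm (s - w) \<le> r" by simp
      then have "w \<noteq> 1" using near[OF n] by auto
      then have "0 < c / L ^ 7 * norm (w - 1)" using c L by simp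
      moreover note bnd[OF n]
      ultimately have "0 < norm (zeta_reg w)" by linarith
      then show "norm (inv_zeta w) \<le> L ^ 7 / c"
        using bnd[OF n] c L by (simp add: inv_zeta_def norm_divide divide_simps mult_ac)
    qed
    also have "\<dots> = fact k / c / \<beta> ^ k * L ^ m"
      using c L by (simp add: r_def m_def power_add power_divide power_mult)
    also have "\<dots> \<le> fact k / c / \<beta> ^ k * (2 ^ m * fact m * exp 1 * sqrt 2 * sqrt (1 + \<bar>Im s\<bar>))"
    proof (rule mult_left_mono)
      \<comment> \<open>Splitting off 2^m leaves exp (L/2) instead of exp L, and this is where the
        square root of the height comes from.\<close>
      have "L ^ m = 2 ^ m * (L / 2) ^ m" by (simp add: power_divide)
      also have "\<dots> \<le> 2 ^ m * (fact m * exp (L / 2))"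
        using L by (intro mult_left_mono power_le_fact_exp) auto
      also have "exp (L / 2) = exp 1 * sqrt 2 * sqrt (1 + \<bar>Im s\<bar>)"
      proof -
        have "exp (L / 2) = exp 1 * exp (ln (2 * (1 + \<bar>Im s\<bar>)) / 2)"
          by (simp add: L_def exp_add[symmetric] add_divide_distrib)
        also have "exp (ln (2 * (1 + \<bar>Im s\<bar>)) / 2) = sqrt (2 * (1 + \<bar>Im s\<bar>))"
          by (rule real_sqrt_unique[symmetric]) (auto simp: power2_eq_square exp_add[symmetric])
        finally show ?thesis by (simp only: real_sqrt_mult mult.assoc)
      qed
      finally show "L ^ m \<le> 2 ^ m * fact m * exp 1 * sqrt 2 * sqrt (1 + \<bar>Im s\<bar>)" by (simp add: mult_ac)
    qed (use c in auto)
    finally show ?thesis by (simp add: C2_def mult_ac)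
  qed
  show thesis
  proof (rule that[of "\<bar>C1\<bar> + C2 + 1"])
    show "\<bar>C1\<bar> + C2 + 1 > 0" using C2 by simp
    fix s assume s: "1 \<le> Re s" "Re s \<le> 2"
    show "norm ((deriv ^^ k) inv_zeta s) \<le> (\<bar>C1\<bar> + C2 + 1) * sqrt (1 + \<bar>Im s\<bar>)"
    proof (cases "\<bar>Im s\<bar> \<ge> 2")
      case True
      have "C2 * sqrt (1 + \<bar>Im s\<bar>) \<le> (\<bar>C1\<bar> + C2 + 1) * sqrt (1 + \<bar>Im s\<bar>)"
        by (intro mult_right_mono) auto
      then show ?thesis using large[OF s True] by linarith
    next
      case False
      then have "norm ((deriv ^^ k) inv_zeta s) \<le> C1" using s by (intro C1) (auto simp: in_cbox_complex_iff)
      also have "\<dots> \<le> (\<bar>C1\<bar> + C2 + 1) * 1" using C2 by simp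
      also have "\<dots> \<le> (\<bar>C1\<bar> + C2 + 1) * sqrt (1 + \<bar>Im s\<bar>)" using C2 by (intro mult_left_mono) auto
      finally show ?thesis .
    qed
  qed
qed

section \<open>Fourier inversion and the Cesaro kernel\<close>

lemma integrable_exp_decay:
  assumes "a > (0::real)"
  shows "integrable lborel (\<lambda>v. indicator {0..} v * exp (- a * v))"
proof (rule integrableI_nonneg)
  have "((\<lambda>v. - exp (- a * v) / a) \<longlongrightarrow> 0) at_top" using assms by real_asymp
  then have "(\<integral>\<^sup>+v. ennreal (exp (- a * v)) * indicator {0..} v \<partial>lborel) = ennreal (0 - (- exp (- a * 0) / a))"
    using assms by (intro nn_integral_FTC_atLeast) (auto intro!: derivative_eq_intros)
  also have "(\<integral>\<^sup>+v. ennreal (exp (- a * v)) * indicator {0..} v \<partial>lborel) =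
      (\<integral>\<^sup>+v. ennreal (indicator {0..} v * exp (- a * v)) \<partial>lborel)"
    by (intro nn_integral_cong) (auto simp: indicator_def)
  finally show "(\<integral>\<^sup>+v. ennreal (indicator {0..} v * exp (- a * v)) \<partial>lborel) < \<infinity>" by simp
qed auto

lemma laplace_exp:
  assumes "Re z > 0"
  shows "integrable lborel (\<lambda>v. indicator {0<..} v *\<^sub>R exp (- z * of_real v))"
    and "(LBINT v. indicator {0<..} v *\<^sub>R exp (- z * of_real v)) = 1 / z"
proof -
  show int: "integrable lborel (\<lambda>v. indicator {0<..} v *\<^sub>R exp (- z * of_real v))"
    by (rule Bochner_Integration.integrable_bound[OF integrable_exp_decay[OF assms]])
      (auto simp: indicator_def)
  have ei: "einterval 0 \<infinity> = {0<..}" by (auto simp: einterval_def)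
  have z: "z \<noteq> 0" using assms by auto
  have 1: "((\<lambda>v. - exp (- z * of_real v) / z) \<longlongrightarrow> 0) at_top"
  proof (rule Lim_null_comparison)
    show "\<forall>\<^sub>F v in at_top. norm (- exp (- z * of_real v) / z) \<le> exp (- Re z * v) / norm z"
      by (auto intro!: always_eventually simp: norm_divide)
    show "((\<lambda>v. exp (- Re z * v) / norm z) \<longlongrightarrow> 0) at_top" using assms z by real_asymp
  qed
  have 2: "((\<lambda>v. - exp (- z * of_real v) / z) \<longlongrightarrow> - 1 / z) (at_right 0)"
  proof -
    have "isCont (\<lambda>v::real. - exp (- z * of_real v) / z) 0" using z by (intro continuous_intros) auto
    then have "((\<lambda>v::real. - exp (- z * of_real v) / z) \<longlongrightarrow> - 1 / z) (at 0)" by (simp add: isCont_def)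
    then show ?thesis by (rule filterlim_mono) (auto simp: at_le)
  qed
  have "(LBINT v=0..\<infinity>. exp (- z * of_real v)) = 0 - (- 1 / z)"
  proof (rule interval_integral_FTC_integrable)
    show "set_integrable lborel (einterval 0 \<infinity>) (\<lambda>v. exp (- z * of_real v))"
      unfolding set_integrable_def ei by (rule int)
    fix v :: real
    show "((\<lambda>v. - exp (- z * of_real v) / z) has_vector_derivative exp (- z * of_real v)) (at v)"
    proof -
      have "((\<lambda>w. - exp (- z * w) / z) has_field_derivative exp (- z * of_real v)) (at (of_real v))"
        using z by (auto intro!: derivative_eq_intros)
      then show ?thesis
        using has_vector_derivative_real_field[of "\<lambda>w. - exp (- z * w) / z"] by simp
    qed
    show "isCont (\<lambda>v. exp (- z * of_real v)) v" by (intro continuous_intros)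
  next
    show "(((\<lambda>v. - exp (- z * of_real v) / z) \<circ> real_of_ereal) \<longlongrightarrow> - 1 / z) (at_right 0)"
      using 2 unfolding zero_ereal_def ereal_tendsto_simps .
    show "(((\<lambda>v. - exp (- z * of_real v) / z) \<circ> real_of_ereal) \<longlongrightarrow> 0) (at_left \<infinity>)"
      using 1 unfolding ereal_tendsto_simps .
  qed auto
  then show "(LBINT v. indicator {0<..} v *\<^sub>R exp (- z * of_real v)) = 1 / z"
    by (simp add: interval_lebesgue_integral_def ei set_lebesgue_integral_def)
qed

text \<open>For v = ln (x / n) and n \<le> x this is the Cesaro weight 1 - n/x times (n/x)^c, and
  for n \<ge> x it is 0. Writing it with max makes the continuity at v = 0, which Fourier inversion
  uses, evident.\<close>

definition cesaro_kernel :: "real \<Rightarrow> real \<Rightarrow> real" where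
  "cesaro_kernel c v = exp (- c * max v 0) * (1 - exp (- max v 0))"

lemma cesaro_kernel_eq:
  "cesaro_kernel c v = indicator {0<..} v * (exp (- c * v) - exp (- (c + 1) * v))"
  by (auto simp: cesaro_kernel_def indicator_def max_def algebra_simps exp_add[symmetric])

lemma cesaro_kernel_bounds:
  assumes "c > 0"
  shows "\<bar>cesaro_kernel c v\<bar> \<le> 1"
proof -
  have "exp (- c * max v 0) * (1 - exp (- max v 0)) \<le> 1 * 1"
    using assms by (intro mult_mono) auto
  moreover have "exp (- c * max v 0) * (1 - exp (- max v 0)) \<ge> 0" by simp
  ultimately show ?thesis by (simp add: cesaro_kernel_def)
qed

lemma continuous_cesaro_kernel: "isCont (cesaro_kernel c) v"
  unfolding cesaro_kernel_def by (intro continuous_intros)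

lemma integrable_cesaro_kernel:
  assumes "c > 0"
  shows "integrable lborel (cesaro_kernel c)"
proof (rule Bochner_Integration.integrable_bound[OF integrable_exp_decay[OF assms]])
  have "continuous_on UNIV (cesaro_kernel c)"
    by (simp add: continuous_on_eq_continuous_at continuous_cesaro_kernel)
  then show "cesaro_kernel c \<in> borel_measurable lborel"
    by (simp add: borel_measurable_continuous_onI)
  show "AE v in lborel. norm (cesaro_kernel c v) \<le> norm (indicator {0..} v * exp (- c * v))"
    by (auto simp: cesaro_kernel_def indicator_def max_def abs_mult intro!: mult_left_le AE_I2)
qed

text \<open>The kernel is a difference of two exponentials on the positive axis, and 1/z - 1/(z + 1)
  = 1 / (z (z + 1)).\<close>

lemma fourier_cesaro_kernel:
  assumes "c > 0"
  shows "(LBINT v. cesaro_kernel c v *\<^sub>R iexp (- (t * v))) = 1 / (Complex c t * Complex (c + 1) t)"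
proof -
  have "(LBINT v. cesaro_kernel c v *\<^sub>R iexp (- (t * v))) =
      (LBINT v. indicator {0<..} v *\<^sub>R exp (- Complex c t * of_real v) - indicator {0<..} v *\<^sub>R exp (- Complex (c + 1) t * of_real v))"
  proof (intro Bochner_Integration.integral_cong refl)
    fix v :: real
    have e: "exp (- Complex b t * of_real v) = of_real (exp (- b * v)) * iexp (- (t * v))" for b
      by (simp add: Complex_eq exp_of_real[symmetric] exp_add[symmetric] algebra_simps)
    show "cesaro_kernel c v *\<^sub>R iexp (- (t * v)) =
      indicator {0<..} v *\<^sub>R exp (- Complex c t * of_real v) - indicator {0<..} v *\<^sub>R exp (- Complex (c + 1) t * of_real v)"
      unfolding cesaro_kernel_eq e by (simp add: scaleR_conv_of_real algebra_simps)
  qed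
  also have "\<dots> = 1 / Complex c t - 1 / Complex (c + 1) t"
    using laplace_exp[of "Complex c t"] laplace_exp[of "Complex (c + 1) t"] assms
    by (subst Bochner_Integration.integral_diff) simp_all
  also have "\<dots> = 1 / (Complex c t * Complex (c + 1) t)"
  proof -
    have "Complex c t \<noteq> 0" "Complex (c + 1) t \<noteq> 0" "Complex (c + 1) t - Complex c t = 1"
      using assms by (auto simp: complex_eq_iff)
    then show ?thesis by (simp add: divide_simps)
  qed
  finally show ?thesis .
qed

section \<open>Fourier inversion by Gaussian damping\<close>

lemma gaussian_integrable: "integrable lborel (\<lambda>t::real. exp (- t\<^sup>2 / 2))"
proof -
  have "integrable lborel (\<lambda>t. sqrt (2 * pi) * std_normal_density t)" by (intro integrable_mult_right) simp
  then show ?thesis by (simp add: std_normal_density_def)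
qed

lemma gaussian_integrable_scaled:
  assumes "e \<noteq> 0" shows "integrable lborel (\<lambda>t::real. exp (- (e * t)\<^sup>2 / 2))"
  using lborel_integrable_real_affine_iff[of e "\<lambda>t. exp (- t\<^sup>2 / 2)" 0] assms gaussian_integrable by simp

lemma fourier_gaussian: "(LBINT t. exp (- t\<^sup>2 / 2) *\<^sub>R iexp (x * t)) = of_real (sqrt (2 * pi) * exp (- x\<^sup>2 / 2))"
proof -
  have "char std_normal_distribution x = (LBINT t. std_normal_density t *\<^sub>R iexp (x * t))"
    unfolding char_def by (rule integral_density) auto
  also have "\<dots> = (LBINT t. of_real (1 / sqrt (2 * pi)) * (exp (- t\<^sup>2 / 2) *\<^sub>R iexp (x * t)))"
    by (intro Bochner_Integration.integral_cong) (auto simp: std_normal_density_def scaleR_conv_of_real)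
  also have "\<dots> = of_real (1 / sqrt (2 * pi)) * (LBINT t. exp (- t\<^sup>2 / 2) *\<^sub>R iexp (x * t))"
    by (rule integral_mult_right_zero)
  finally show ?thesis by (simp add: char_std_normal_distribution field_simps)
qed

lemma fourier_gaussian_scaled:
  assumes "e > 0"
  shows "(LBINT t. exp (- (e * t)\<^sup>2 / 2) *\<^sub>R iexp (x * t)) = of_real (sqrt (2 * pi) / e * exp (- (x / e)\<^sup>2 / 2))"
proof -
  have "of_real (sqrt (2 * pi) * exp (- (x / e)\<^sup>2 / 2)) = (LBINT t. exp (- t\<^sup>2 / 2) *\<^sub>R iexp (x / e * t))"
    by (rule fourier_gaussian[symmetric])
  also have "\<dots> = \<bar>e\<bar> *\<^sub>R (LBINT t. exp (- (0 + e * t)\<^sup>2 / 2) *\<^sub>R iexp (x / e * (0 + e * t)))"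
    by (rule lborel_integral_real_affine) (use assms in simp)
  also have "\<dots> = e *\<^sub>R (LBINT t. exp (- (e * t)\<^sup>2 / 2) *\<^sub>R iexp (x * t))"
    using assms by simp
  finally show ?thesis using assms by (simp add: scaleR_conv_of_real field_simps)
qed

text \<open>A Gaussian factor exp (- (e t)^2 / 2) makes the double integral absolutely convergent.
  After Fubini it is the average of g over a Gaussian of width e around v. As e tends to 0,
  dominated convergence applies on both sides: with norm (h t) as majorant on one, and with the
  bound B and the continuity of g on the other.\<close>

lemma fourier_inversion:
  fixes g :: "real \<Rightarrow> real"
  assumes g: "integrable lborel g" "\<And>v. isCont g v" "\<And>v. \<bar>g v\<bar> \<le> B"
    and h: "integrable lborel h" "\<And>t. h t = (LBINT w. g w *\<^sub>R iexp (- (t * w)))"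
  shows "(LBINT t. h t * iexp (t * v)) = of_real (2 * pi * g v)"
proof -
  define e where "e = (\<lambda>m. 1 / real (Suc m))"
  have e: "e m > 0" for m by (simp add: e_def)
  have e0: "e \<longlonglongrightarrow> 0" unfolding e_def by (rule lim_1_over_n[THEN LIMSEQ_Suc])
  have [measurable]: "g \<in> borel_measurable borel" "h \<in> borel_measurable borel"
    using borel_measurable_integrable[OF g(1)] borel_measurable_integrable[OF h(1)] by simp_all
  let ?I = "\<lambda>m. LBINT t. exp (- (e m * t)\<^sup>2 / 2) *\<^sub>R (h t * iexp (t * v))"
  have lim1: "?I \<longlonglongrightarrow> (LBINT t. h t * iexp (t * v))"
  proof (rule integral_dominated_convergence[where w = "\<lambda>t. norm (h t)"])
    show "integrable lborel (\<lambda>t. norm (h t))" using h(1) by simp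
    show "AE t in lborel. (\<lambda>m. exp (- (e m * t)\<^sup>2 / 2) *\<^sub>R (h t * iexp (t * v))) \<longlonglongrightarrow> h t * iexp (t * v)"
    proof (rule AE_I2)
      fix t
      have "(\<lambda>m. exp (- (e m * t)\<^sup>2 / 2) *\<^sub>R (h t * iexp (t * v))) \<longlonglongrightarrow> exp (- (0 * t)\<^sup>2 / 2) *\<^sub>R (h t * iexp (t * v))"
        by (intro tendsto_intros e0) auto
      then show "(\<lambda>m. exp (- (e m * t)\<^sup>2 / 2) *\<^sub>R (h t * iexp (t * v))) \<longlonglongrightarrow> h t * iexp (t * v)" by simp
    qed
    show "AE t in lborel. norm (exp (- (e m * t)\<^sup>2 / 2) *\<^sub>R (h t * iexp (t * v))) \<le> norm (h t)" for m
      by (auto simp: norm_mult intro!: AE_I2 mult_left_le_one_le)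
  qed measurable
  have I_eq: "?I m = of_real (sqrt (2 * pi)) * (LBINT z. of_real (exp (- z\<^sup>2 / 2) * g (v + e m * z)))" for m
  proof -
    let ?F = "\<lambda>t w. exp (- (e m * t)\<^sup>2 / 2) *\<^sub>R (g w *\<^sub>R iexp (t * (v - w)))"
    have int: "integrable (lborel \<Otimes>\<^sub>M lborel) (\<lambda>(t, w). ?F t w)"
    proof (rule lborel_pair.Fubini_integrable)
      show "(\<lambda>(t, w). ?F t w) \<in> borel_measurable (lborel \<Otimes>\<^sub>M lborel)" by measurable
      have "integrable lborel (\<lambda>t. exp (- (e m * t)\<^sup>2 / 2) * (LBINT w. \<bar>g w\<bar>))"
        using e[of m] by (intro integrable_mult_left gaussian_integrable_scaled) simp
      then show "integrable lborel (\<lambda>t. LBINT w. norm (case (t, w) of (t, w) \<Rightarrow> ?F t w))"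
        by (simp add: abs_mult)
      show "AE t in lborel. integrable lborel (\<lambda>w. case (t, w) of (t, w) \<Rightarrow> ?F t w)"
      proof (rule AE_I2)
        fix t
        show "integrable lborel (\<lambda>w. case (t, w) of (t, w) \<Rightarrow> ?F t w)"
          by (rule Bochner_Integration.integrable_bound[OF g(1)])
            (auto simp: abs_mult intro!: AE_I2 mult_left_le_one_le)
      qed
    qed
    have "?I m = (LBINT t. LBINT w. ?F t w)"
    proof (intro Bochner_Integration.integral_cong refl)
      fix t
      have "h t * iexp (t * v) = (LBINT w. (g w *\<^sub>R iexp (- (t * w))) * iexp (t * v))"
        unfolding h(2) by (rule integral_mult_left_zero[symmetric])
      also have "\<dots> = (LBINT w. g w *\<^sub>R iexp (t * (v - w)))"
        by (intro Bochner_Integration.integral_cong refl) (simp add: exp_add[symmetric] algebra_simps)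
      finally have eq: "h t * iexp (t * v) = (LBINT w. g w *\<^sub>R iexp (t * (v - w)))" .
      show "exp (- (e m * t)\<^sup>2 / 2) *\<^sub>R (h t * iexp (t * v)) = (LBINT w. ?F t w)"
        unfolding eq by (rule integral_scaleR_right[symmetric])
    qed
    also have "\<dots> = (LBINT w. LBINT t. ?F t w)" by (rule lborel_pair.Fubini_integral[OF int, symmetric])
    also have "\<dots> = (LBINT w. of_real (g w * (sqrt (2 * pi) / e m * exp (- ((v - w) / e m)\<^sup>2 / 2))))"
    proof (intro Bochner_Integration.integral_cong refl)
      fix w
      have "(LBINT t. ?F t w) = (LBINT t. of_real (g w) * (exp (- (e m * t)\<^sup>2 / 2) *\<^sub>R iexp ((v - w) * t)))"
        by (intro Bochner_Integration.integral_cong refl) (simp add: scaleR_conv_of_real mult_ac)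
      also have "\<dots> = of_real (g w) * (LBINT t. exp (- (e m * t)\<^sup>2 / 2) *\<^sub>R iexp ((v - w) * t))"
        by (rule integral_mult_right_zero)
      also have "\<dots> = of_real (g w * (sqrt (2 * pi) / e m * exp (- ((v - w) / e m)\<^sup>2 / 2)))"
        by (subst fourier_gaussian_scaled[OF e]) simp
      finally show "(LBINT t. ?F t w) = of_real (g w * (sqrt (2 * pi) / e m * exp (- ((v - w) / e m)\<^sup>2 / 2)))" .
    qed
    also have "\<dots> = \<bar>e m\<bar> *\<^sub>R (LBINT z. of_real (g (v + e m * z) * (sqrt (2 * pi) / e m * exp (- ((v - (v + e m * z)) / e m)\<^sup>2 / 2))))"
      by (rule lborel_integral_real_affine) (use e[of m] in simp)
    also have "\<dots> = \<bar>e m\<bar> *\<^sub>R (LBINT z. of_real (sqrt (2 * pi) / e m) * of_real (exp (- z\<^sup>2 / 2) * g (v + e m * z)))"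
      using e[of m] by (intro arg_cong[where f = "\<lambda>x. \<bar>e m\<bar> *\<^sub>R x"] Bochner_Integration.integral_cong refl) (simp add: mult_ac)
    also have "\<dots> = of_real (sqrt (2 * pi)) * (LBINT z. of_real (exp (- z\<^sup>2 / 2) * g (v + e m * z)))"
      using e[of m] by (subst integral_mult_right_zero) (simp add: scaleR_conv_of_real)
    finally show ?thesis .
  qed
  have "(\<lambda>m. LBINT z. complex_of_real (exp (- z\<^sup>2 / 2) * g (v + e m * z))) \<longlonglongrightarrow> (LBINT z. of_real (exp (- z\<^sup>2 / 2) * g v))"
  proof (rule integral_dominated_convergence[where w = "\<lambda>z. exp (- z\<^sup>2 / 2) * B"])
    show "integrable lborel (\<lambda>z. exp (- z\<^sup>2 / 2) * B)" by (intro integrable_mult_left gaussian_integrable)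
    show "AE z in lborel. (\<lambda>m. complex_of_real (exp (- z\<^sup>2 / 2) * g (v + e m * z))) \<longlonglongrightarrow> of_real (exp (- z\<^sup>2 / 2) * g v)"
    proof (rule AE_I2)
      fix z
      have "(\<lambda>m. v + e m * z) \<longlonglongrightarrow> v + 0 * z" by (intro tendsto_intros e0)
      then have "(\<lambda>m. g (v + e m * z)) \<longlonglongrightarrow> g v" using isCont_tendsto_compose[OF g(2)] by simp
      then show "(\<lambda>m. complex_of_real (exp (- z\<^sup>2 / 2) * g (v + e m * z))) \<longlonglongrightarrow> of_real (exp (- z\<^sup>2 / 2) * g v)"
        by (intro tendsto_intros)
    qed
    show "AE z in lborel. norm (complex_of_real (exp (- z\<^sup>2 / 2) * g (v + e m * z))) \<le> exp (- z\<^sup>2 / 2) * B" for m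
      using g(3) by (auto simp: abs_mult norm_mult intro!: AE_I2 mult_left_mono)
  qed measurable
  then have "?I \<longlonglongrightarrow> of_real (sqrt (2 * pi)) * (LBINT z. of_real (exp (- z\<^sup>2 / 2) * g v))"
    unfolding I_eq by (intro tendsto_intros)
  also have "(LBINT z. complex_of_real (exp (- z\<^sup>2 / 2) * g v)) = of_real (sqrt (2 * pi) * g v)"
  proof -
    have "(LBINT z. complex_of_real (exp (- z\<^sup>2 / 2) * g v)) = (LBINT z. (exp (- z\<^sup>2 / 2) *\<^sub>R iexp (0 * z)) * of_real (g v))"
      by (intro Bochner_Integration.integral_cong refl) (simp add: scaleR_conv_of_real)
    also have "\<dots> = (LBINT z. exp (- z\<^sup>2 / 2) *\<^sub>R iexp (0 * z)) * of_real (g v)" by (rule integral_mult_left_zero)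
    finally show ?thesis unfolding fourier_gaussian by simp
  qed
  also have "of_real (sqrt (2 * pi)) * complex_of_real (sqrt (2 * pi) * g v) = of_real (sqrt (2 * pi) * sqrt (2 * pi) * g v)"
    by (simp only: of_real_mult mult.assoc)
  also have "sqrt (2 * pi) * sqrt (2 * pi) * g v = 2 * pi * g v" by simp
  finally show ?thesis using lim1 by (rule LIMSEQ_unique[OF _ , rotated])
qed

section \<open>Bounding the summatory Moebius function\<close>

lemma integrable_growth_kernel: "integrable lborel (\<lambda>t::real. sqrt (1 + \<bar>t\<bar>) / (1 + t\<^sup>2))"
proof -
  let ?f = "\<lambda>t::real. indicator {0..} t * (1 + t) powr (- 3 / 2)"
  have f: "integrable lborel ?f"
  proof (rule integrableI_nonneg)
    have "((\<lambda>t::real. - 2 * (1 + t) powr (- 1 / 2)) \<longlongrightarrow> 0) at_top" by real_asymp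
    then have "(\<integral>\<^sup>+t. ennreal ((1 + t) powr (- 3 / 2)) * indicator {0..} t \<partial>lborel) = ennreal (0 - (- 2 * (1 + 0) powr (- 1 / 2)))"
      by (intro nn_integral_FTC_atLeast) (auto intro!: derivative_eq_intros)
    also have "(\<integral>\<^sup>+t. ennreal ((1 + t) powr (- 3 / 2)) * indicator {0..} t \<partial>lborel) = (\<integral>\<^sup>+t. ennreal (?f t) \<partial>lborel)"
      by (intro nn_integral_cong) (auto simp: indicator_def)
    finally show "(\<integral>\<^sup>+t. ennreal (?f t) \<partial>lborel) < \<infinity>" by simp
  qed auto
  have f': "integrable lborel (\<lambda>t. ?f (- t))"
    using lborel_integrable_real_affine_iff[of "- 1" ?f 0] f by simp
  show ?thesis
  proof (rule Bochner_Integration.integrable_bound)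
    show "integrable lborel (\<lambda>t. 2 * (?f t + ?f (- t)))"
      by (intro integrable_mult_right Bochner_Integration.integrable_add f f')
    show "AE t in lborel. norm (sqrt (1 + \<bar>t\<bar>) / (1 + t\<^sup>2)) \<le> norm (2 * (?f t + ?f (- t)))"
    proof (rule AE_I2)
      fix t :: real
      define u where "u = 1 + \<bar>t\<bar>"
      have u: "u \<ge> 1" by (simp add: u_def)
      have "u powr (- 3 / 2) = u powr (1 / 2 - 2)" by simp
      also have "\<dots> = u powr (1 / 2) / u powr 2" by (rule powr_diff)
      finally have "u powr (- 3 / 2) = u powr (1 / 2) / u powr 2" .
      then have pw: "u powr (- 3 / 2) = sqrt u / u ^ 2" using u by (simp add: powr_half_sqrt)
      have "0 \<le> (1 - \<bar>t\<bar>) ^ 2" by simp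
      then have "u ^ 2 \<le> 2 * (1 + t ^ 2)" by (simp add: u_def power2_eq_square algebra_simps)
      moreover have "1 + t ^ 2 > 0" using zero_le_power2[of t] by linarith
      ultimately have "sqrt u / (1 + t ^ 2) \<le> 2 * (sqrt u / u ^ 2)"
        using u by (simp add: divide_simps mult_left_mono mult_ac)
      also have "\<dots> = 2 * u powr (- 3 / 2)" by (simp only: pw)
      also have "u powr (- 3 / 2) \<le> ?f t + ?f (- t)" by (auto simp: u_def indicator_def)
      finally show "norm (sqrt (1 + \<bar>t\<bar>) / (1 + t\<^sup>2)) \<le> norm (2 * (?f t + ?f (- t)))"
        by (simp add: u_def indicator_def)
    qed
  qed auto
qed

lemma norm_cesaro_transform_le:
  assumes "c \<ge> 1"
  shows "norm (1 / (Complex c t * Complex (c + 1) t)) \<le> 1 / (1 + t\<^sup>2)"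
proof -
  have 1: "sqrt (1 + t\<^sup>2) \<le> norm (Complex b t)" if "b \<ge> 1" for b
    using that power_mono[of 1 b 2] by (simp add: complex_norm)
  have "1 + t\<^sup>2 = sqrt (1 + t\<^sup>2) * sqrt (1 + t\<^sup>2)" by simp
  also have "\<dots> \<le> norm (Complex c t) * norm (Complex (c + 1) t)"
    using assms by (intro mult_mono 1) auto
  moreover have "1 + t ^ 2 > 0" using zero_le_power2[of t] by linarith
  ultimately show ?thesis by (simp add: norm_divide norm_mult frac_le)
qed

lemma fourier_cesaro_inverse:
  assumes "c \<ge> 1"
  shows "integrable lborel (\<lambda>t. 1 / (Complex c t * Complex (c + 1) t))"
    and "(LBINT t. 1 / (Complex c t * Complex (c + 1) t) * iexp (t * v)) = of_real (2 * pi * cesaro_kernel c v)"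
proof -
  have nz: "Complex c t \<noteq> 0" "Complex (c + 1) t \<noteq> 0" for t using assms by (auto simp: complex_eq_iff)
  have "continuous_on UNIV (\<lambda>t. 1 / (Complex c t * Complex (c + 1) t))"
    using nz unfolding Complex_eq by (intro continuous_intros) (auto simp: Complex_eq)
  then have m: "(\<lambda>t. 1 / (Complex c t * Complex (c + 1) t)) \<in> borel_measurable lborel"
    by (simp add: borel_measurable_continuous_onI)
  show int: "integrable lborel (\<lambda>t. 1 / (Complex c t * Complex (c + 1) t))"
  proof (rule Bochner_Integration.integrable_bound[OF integrable_growth_kernel m], rule AE_I2)
    fix t :: real
    have "norm (1 / (Complex c t * Complex (c + 1) t)) \<le> 1 / (1 + t\<^sup>2)"
      by (rule norm_cesaro_transform_le[OF assms])
    also have "\<dots> \<le> sqrt (1 + \<bar>t\<bar>) / (1 + t\<^sup>2)" by (intro divide_right_mono) auto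
    finally show "norm (1 / (Complex c t * Complex (c + 1) t)) \<le> norm (sqrt (1 + \<bar>t\<bar>) / (1 + t\<^sup>2))" by simp
  qed
  show "(LBINT t. 1 / (Complex c t * Complex (c + 1) t) * iexp (t * v)) = of_real (2 * pi * cesaro_kernel c v)"
    using assms by (intro fourier_inversion[where B = 1] int integrable_cesaro_kernel continuous_cesaro_kernel
        cesaro_kernel_bounds fourier_cesaro_kernel[symmetric]) auto
qed

text \<open>The factor n^(-c), which the Dirichlet series supplies on the line Re s = c, cancels the
  exponential in the kernel up to x^(-c), which no longer depends on n.\<close>

lemma cesaro_kernel_ln:
  assumes "x > 0" "n > 0"
  shows "cesaro_kernel c (ln x - ln n) * n powr (- c) = x powr (- c) * (if n \<le> x then 1 - n / x else 0)"
proof (cases "n \<le> x")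
  case True
  then have "ln n \<le> ln x" using assms by simp
  then have "cesaro_kernel c (ln x - ln n) = exp (- c * (ln x - ln n)) * (1 - exp (ln n - ln x))"
    by (simp add: cesaro_kernel_def max_def)
  also have "exp (ln n - ln x) = n / x" using assms by (simp add: exp_diff)
  finally have "cesaro_kernel c (ln x - ln n) * n powr (- c) =
      (exp (- c * (ln x - ln n)) * exp (- c * ln n)) * (1 - n / x)"
    using assms by (simp add: powr_def)
  also have "exp (- c * (ln x - ln n)) * exp (- c * ln n) = x powr (- c)"
    using assms by (simp add: powr_def exp_add[symmetric] algebra_simps)
  finally show ?thesis using True by simp
next
  case False
  then have "ln x \<le> ln n" using assms by simp
  then show ?thesis using False by (simp add: cesaro_kernel_def max_def)
qed

text \<open>The k-th derivative of 1/zeta has the coefficients mu(n) (- ln n)^k. Integrated termwise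
  against the transform of the kernel, which is legitimate for c > 1 by absolute convergence, its
  series gives the Cesaro mean; integrated as a function, it is bounded uniformly in 1 < c \<le> 2
  since the derivative bound holds up to the line.\<close>

lemma cesaro_moebius_bound:
  obtains C where "C > 0"
    "\<And>N. N \<ge> 3 \<Longrightarrow> \<bar>\<Sum>n\<in>{1..N}. real_of_int (moebius n) * ln (real n) ^ k * (real N - real n)\<bar> \<le> C * real N ^ 2"
proof -
  obtain C where C: "C > 0"
    "\<And>s. 1 \<le> Re s \<Longrightarrow> Re s \<le> 2 \<Longrightarrow> norm ((deriv ^^ k) inv_zeta s) \<le> C * sqrt (1 + \<bar>Im s\<bar>)"
    by (rule inv_zeta_higher_deriv_bound[where k = k]) blast
  define I where "I = (LBINT t::real. sqrt (1 + \<bar>t\<bar>) / (1 + t\<^sup>2))"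
  have I: "I \<ge> 0" unfolding I_def by (intro integral_nonneg_AE AE_I2) auto
  define a where "a = (\<lambda>n. (- of_real (ln (real n))) ^ k * of_int (moebius n) :: complex)"
  have ds: "dirichlet_summable a"
    unfolding a_def by (rule dirichlet_summable_ln_power[OF dirichlet_summable_moebius])
  have da: "dirichlet_series a s = (deriv ^^ k) inv_zeta s" if "Re s > 1" for s
  proof -
    have "dirichlet_series a s = (deriv ^^ k) (dirichlet_series (\<lambda>n. of_int (moebius n))) s"
      unfolding a_def by (rule dirichlet_series_higher_deriv[OF dirichlet_summable_moebius that, symmetric])
    also have "\<dots> = (deriv ^^ k) inv_zeta s"
    proof (rule higher_deriv_cong_ev)
      have "eventually (\<lambda>x. x \<in> {z. 1 < Re z}) (nhds s)"
        using that by (intro eventually_nhds_in_open open_halfspace_Re_gt) auto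
      then show "\<forall>\<^sub>F x in nhds s. dirichlet_series (\<lambda>n. of_int (moebius n)) x = inv_zeta x"
        by eventually_elim (simp add: inv_zeta_eq_dirichlet_series)
    qed simp
    finally show ?thesis .
  qed
  have main: "\<bar>\<Sum>n\<in>{1..N}. real_of_int (moebius n) * ln (real n) ^ k * (real N - real n)\<bar>
      \<le> (C * I * exp 1 + 1) * real N ^ 2" if N: "N \<ge> 3" for N
  proof -
    define x where "x = real N"
    have x: "x \<ge> 3" using N by (simp add: x_def)
    have lx: "ln x \<ge> 1" using x by (rule one_le_ln)
    \<comment> \<open>This makes x^c = e x, so that leaving the line Re s = 1 costs only the factor
      e.\<close>
    define c where "c = 1 + 1 / ln x"
    have c: "c > 1" "c \<le> 2" using lx by (auto simp: c_def field_simps)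
    have "c * ln x = ln x + 1" using lx by (simp add: c_def field_simps)
    then have xc: "x powr c = x * exp 1" using x by (simp add: powr_def exp_add)
    define h where "h = (\<lambda>t. 1 / (Complex c t * Complex (c + 1) t))"
    have h: "integrable lborel h" "\<And>v. (LBINT t. h t * iexp (t * v)) = of_real (2 * pi * cesaro_kernel c v)"
      unfolding h_def using c fourier_cesaro_inverse[of c] by simp_all
    have [measurable]: "h \<in> borel_measurable borel" using borel_measurable_integrable[OF h(1)] by simp
    define F where "F = (\<lambda>n t. (a n * of_real (real n powr (- c))) * (h t * iexp (t * (ln x - ln (real n)))))"
    have F_eq: "F n t = h t * iexp (t * ln x) * (a n * of_nat n powr (- Complex c t))" for n t
    proof (cases "n = 0")
      case False
      have "of_nat n powr (- Complex c t) = of_real (real n powr (- c)) * iexp (- (t * ln (real n)))"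
        using False by (simp add: powr_def Ln_of_nat exp_of_real[symmetric] exp_add[symmetric] Complex_eq algebra_simps)
      then show ?thesis by (simp add: F_def exp_add[symmetric] algebra_simps)
    qed (simp add: F_def)
    have F_int: "integrable lborel (F n)" for n
      unfolding F_def by (intro integrable_mult_right Bochner_Integration.integrable_bound[OF h(1)])
        (auto simp: norm_mult intro!: AE_I2)
    have F_norm: "norm (F n t) = norm (a n) * real n powr (- c) * norm (h t)" for n t
      by (simp add: F_def norm_mult)
    have sm: "summable (\<lambda>n. norm (a n) * real n powr (- c))" using ds c by (simp add: dirichlet_summable_def)
    have "(\<lambda>n. LBINT t. F n t) sums (LBINT t. (\<Sum>n. F n t))"
    proof (rule sums_integral[OF F_int])
      show "AE t in lborel. summable (\<lambda>n. norm (F n t))"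
        unfolding F_norm using sm by (intro AE_I2 summable_mult2)
      show "summable (\<lambda>n. LBINT t. norm (F n t))"
        unfolding F_norm by (simp add: summable_mult2 sm)
    qed
    moreover have "(LBINT t. F n t) = (if n \<in> {1..N} then a n * of_real (2 * pi * x powr (- c) * (1 - real n / x)) else 0)" for n
    proof -
      have "(LBINT t. F n t) = (a n * of_real (real n powr (- c))) * (LBINT t. h t * iexp (t * (ln x - ln (real n))))"
        unfolding F_def by (rule integral_mult_right_zero)
      also have "\<dots> = a n * of_real (2 * pi * (cesaro_kernel c (ln x - ln (real n)) * real n powr (- c)))"
        unfolding h(2) by simp
      also have "\<dots> = (if n \<in> {1..N} then a n * of_real (2 * pi * x powr (- c) * (1 - real n / x)) else 0)"
        using cesaro_kernel_ln[of x "real n" c] x by (cases "n = 0") (auto simp: x_def)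
      finally show ?thesis .
    qed
    ultimately have s1: "(\<lambda>n. if n \<in> {1..N} then a n * of_real (2 * pi * x powr (- c) * (1 - real n / x)) else 0)
        sums (LBINT t. (\<Sum>n. F n t))" by simp
    have s2: "(\<lambda>n. if n \<in> {1..N} then a n * of_real (2 * pi * x powr (- c) * (1 - real n / x)) else 0)
        sums (\<Sum>n\<in>{1..N}. a n * of_real (2 * pi * x powr (- c) * (1 - real n / x)))"
      by (rule sums_If_finite_set) simp
    have "(\<Sum>n\<in>{1..N}. a n * of_real (2 * pi * x powr (- c) * (1 - real n / x))) = (LBINT t. (\<Sum>n. F n t))"
      by (rule sums_unique2[OF s2 s1])
    also have "norm \<dots> \<le> (LBINT t. C * (sqrt (1 + \<bar>t\<bar>) / (1 + t\<^sup>2)))"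
    proof (rule order_trans[OF Bochner_Integration.integral_norm_bound integral_mono'])
      show "integrable lborel (\<lambda>t::real. C * (sqrt (1 + \<bar>t\<bar>) / (1 + t\<^sup>2)))"
        by (intro integrable_mult_right integrable_growth_kernel)
      show "norm (\<Sum>n. F n t) \<le> C * (sqrt (1 + \<bar>t\<bar>) / (1 + t\<^sup>2))" for t
      proof -
        have "(\<lambda>n. F n t) sums (h t * iexp (t * ln x) * dirichlet_series a (Complex c t))"
          unfolding F_eq by (intro sums_mult dirichlet_series_sums ds) (use c in simp)
        then have "(\<Sum>n. F n t) = h t * iexp (t * ln x) * dirichlet_series a (Complex c t)" by (simp add: sums_iff)
        then have "norm (\<Sum>n. F n t) = norm (h t) * norm ((deriv ^^ k) inv_zeta (Complex c t))"
          using c by (simp add: norm_mult da)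
        also have "\<dots> \<le> 1 / (1 + t\<^sup>2) * (C * sqrt (1 + \<bar>t\<bar>))"
          using c C(2)[of "Complex c t"] norm_cesaro_transform_le[of c t] unfolding h_def
          by (intro mult_mono) auto
        finally show ?thesis by simp
      qed
      show "0 \<le> C * (sqrt (1 + \<bar>t\<bar>) / (1 + t\<^sup>2))" for t using C(1) by simp
    qed
    also have "\<dots> = C * I" unfolding I_def by (rule integral_mult_right_zero)
    finally have "norm (\<Sum>n\<in>{1..N}. a n * of_real (2 * pi * x powr (- c) * (1 - real n / x))) \<le> C * I" .
    also have "(\<Sum>n\<in>{1..N}. a n * of_real (2 * pi * x powr (- c) * (1 - real n / x))) =
        of_real ((- 1) ^ k * (2 * pi * x powr (- c) / x)) *
        of_real (\<Sum>n\<in>{1..N}. real_of_int (moebius n) * ln (real n) ^ k * (real N - real n))"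
      unfolding of_real_mult[symmetric] of_real_sum sum_distrib_left
      by (intro sum.cong refl) (use x in \<open>simp add: a_def power_minus[of "of_real _"] field_simps x_def\<close>)
    also have "norm \<dots> = 2 * pi * x powr (- c) / x * \<bar>\<Sum>n\<in>{1..N}. real_of_int (moebius n) * ln (real n) ^ k * (real N - real n)\<bar>"
      using x by (simp only: norm_mult norm_of_real) (simp add: abs_mult power_abs)
    finally have *: "2 * pi * x powr (- c) / x * \<bar>\<Sum>n\<in>{1..N}. real_of_int (moebius n) * ln (real n) ^ k * (real N - real n)\<bar> \<le> C * I" .
    define T where "T = \<bar>\<Sum>n\<in>{1..N}. real_of_int (moebius n) * ln (real n) ^ k * (real N - real n)\<bar>"
    have "1 / (x ^ 2 * exp 1) * T \<le> 2 * pi * x powr (- c) / x * T"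
    proof (rule mult_right_mono)
      have "1 / (x ^ 2 * exp 1) = 1 * x powr (- c) / x"
        using x xc by (simp add: powr_minus divide_simps power2_eq_square)
      also have "\<dots> \<le> 2 * pi * x powr (- c) / x"
        using x pi_gt3 by (intro divide_right_mono mult_right_mono) auto
      finally show "1 / (x ^ 2 * exp 1) \<le> 2 * pi * x powr (- c) / x" .
    qed (simp add: T_def)
    then have "1 / (x ^ 2 * exp 1) * T \<le> C * I" using * by (simp add: T_def)
    then have "T \<le> C * I * (x ^ 2 * exp 1)" using x by (simp add: field_simps)
    also have "\<dots> \<le> (C * I * exp 1 + 1) * x ^ 2" by (simp add: algebra_simps)
    finally show ?thesis by (simp add: T_def x_def)
  qed
  show thesis
    by (rule that[of "C * I * exp 1 + 1"]) (use main C I in \<open>auto intro!: add_nonneg_pos\<close>)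
qed

section \<open>Removing the smoothing and the logarithmic weights\<close>

lemma abel_bound:
  fixes f b :: "nat \<Rightarrow> real"
  assumes B: "\<And>m. R < m \<Longrightarrow> m \<le> N \<Longrightarrow> \<bar>\<Sum>n\<in>{R<..m}. f n\<bar> \<le> B"
    and b: "\<And>m n. R < m \<Longrightarrow> m \<le> n \<Longrightarrow> b n \<le> b m" "\<And>n. R < n \<Longrightarrow> b n \<ge> 0" and N: "R < N"
  shows "\<bar>\<Sum>n\<in>{R<..N}. f n * b n\<bar> \<le> B * b (Suc R)"
proof -
  \<comment> \<open>Subtracting the boundary term makes the induction work: the increments of the
    error are then B times the decrements of b, which telescope.\<close>
  have "\<bar>(\<Sum>n\<in>{R<..m}. f n * b n) - (\<Sum>n\<in>{R<..m}. f n) * b m\<bar> \<le> B * (b (Suc R) - b m)"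
    if "Suc R \<le> m" "m \<le> N" for m
    using that
  proof (induction m rule: dec_induct)
    case base
    have "{R<..Suc R} = {Suc R}" by auto
    then show ?case by simp
  next
    case (step m)
    have ins: "{R<..Suc m} = insert (Suc m) {R<..m}" using step by auto
    have "(\<Sum>n\<in>{R<..Suc m}. f n * b n) - (\<Sum>n\<in>{R<..Suc m}. f n) * b (Suc m) =
        ((\<Sum>n\<in>{R<..m}. f n * b n) - (\<Sum>n\<in>{R<..m}. f n) * b m) + (\<Sum>n\<in>{R<..m}. f n) * (b m - b (Suc m))"
      unfolding ins by (simp add: algebra_simps)
    moreover have "\<bar>(\<Sum>n\<in>{R<..m}. f n) * (b m - b (Suc m))\<bar> \<le> B * (b m - b (Suc m))"
      using B[of m] b(1)[of m "Suc m"] step by (auto simp: abs_mult intro!: mult_right_mono)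
    ultimately show ?case using step.IH step.prems by (simp add: algebra_simps)
  qed
  from this[of N] have "\<bar>(\<Sum>n\<in>{R<..N}. f n * b n) - (\<Sum>n\<in>{R<..N}. f n) * b N\<bar> \<le> B * b (Suc R) - B * b N"
    using N by (simp add: right_diff_distrib)
  moreover have "\<bar>(\<Sum>n\<in>{R<..N}. f n) * b N\<bar> \<le> B * b N"
    using B[of N] b(2)[of N] N by (auto simp: abs_mult intro!: mult_right_mono)
  ultimately show ?thesis by linarith
qed

text \<open>The difference of the Cesaro sums at N + H and N is H times the plain sum up to N, plus
  an error \<open>?E\<close> over the short interval that is bounded trivially.\<close>

lemma moebius_ln_power_bound:
  obtains C where "C > 0"
    "\<And>N. N \<ge> 3 \<Longrightarrow> \<bar>\<Sum>n\<in>{1..N}. real_of_int (moebius n) * ln (real n) ^ 8\<bar> \<le> C * real N * ln (real N) ^ 4"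
proof -
  obtain C where C: "C > 0"
    "\<And>N. N \<ge> 3 \<Longrightarrow> \<bar>\<Sum>n\<in>{1..N}. real_of_int (moebius n) * ln (real n) ^ 8 * (real N - real n)\<bar> \<le> C * real N ^ 2"
    by (rule cesaro_moebius_bound[where k = 8]) blast
  let ?a = "\<lambda>n. real_of_int (moebius n) * ln (real n) ^ 8"
  have a: "\<bar>?a n\<bar> \<le> ln (real n) ^ 8" if "n > 0" for n
  proof -
    have "\<bar>real_of_int (moebius n)\<bar> \<le> 1" using abs_moebius_le[of n] by linarith
    then show ?thesis using that by (simp add: abs_mult mult_left_le_one_le)
  qed
  have main: "\<bar>\<Sum>n\<in>{1..N}. ?a n\<bar> \<le> (5 * C + 256 * 25) * real N * ln (real N) ^ 4" if N: "N \<ge> 3" for N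
  proof -
    define L where "L = ln (real N)"
    have L1: "L \<ge> 1" unfolding L_def using N by (intro one_le_ln) simp
    have L4: "L ^ 4 \<le> 24 * real N"
      using power_le_fact_exp[of L 4] L1 N by (simp add: L_def fact_numeral)
    \<comment> \<open>This balances the two errors after division by H: the Cesaro sums give N^2 / H
      and the short interval gives H L^8, both of order N L^4.\<close>
    define H where "H = nat \<lceil>real N / L ^ 4\<rceil>"
    have H1: "real N / L ^ 4 \<le> real H" "real H \<le> real N / L ^ 4 + 1"
      unfolding H_def using L1 by (auto simp: of_nat_ceiling)
    have "real N / L ^ 4 \<le> real N / 1" using L1 by (intro divide_left_mono) (auto simp: one_le_power)
    then have "real N / L ^ 4 \<le> real N" by simp
    then have HN: "H \<le> N" unfolding H_def by (simp add: nat_le_iff ceiling_le_iff)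
    have "real N / L ^ 4 > 0" using L1 N by (intro divide_pos_pos) auto
    then have Hpos: "real H > 0" using H1(1) by linarith
    have L8: "L ^ 8 = L ^ 4 * L ^ 4" using power_add[of L 4 4] by simp
    have H25: "real H \<le> 25 * (real N / L ^ 4)"
      using H1(2) L4 L1 by (simp add: field_simps)
    let ?T = "\<lambda>N. \<Sum>n\<in>{1..N}. ?a n * (real N - real n)"
    let ?E = "\<Sum>n\<in>{N<..N + H}. ?a n * (real (N + H) - real n)"
    have "{1..N + H} = {1..N} \<union> {N<..N + H}" using N by auto
    then have "?T (N + H) = (\<Sum>n\<in>{1..N}. ?a n * (real (N + H) - real n)) + ?E"
      by (simp only:) (rule sum.union_disjoint; auto)
    also have "(\<Sum>n\<in>{1..N}. ?a n * (real (N + H) - real n)) = ?T N + real H * (\<Sum>n\<in>{1..N}. ?a n)"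
      by (simp add: sum_distrib_left sum.distrib[symmetric] algebra_simps)
    finally have eq: "real H * (\<Sum>n\<in>{1..N}. ?a n) = ?T (N + H) - ?T N - ?E" by simp
    have lN: "ln (real (N + H)) \<le> 2 * L"
    proof -
      have "2 * real N \<le> real N * real N" using N by (intro mult_right_mono) auto
      then have "real (N + H) \<le> real N * real N" using HN by linarith
      then have "ln (real (N + H)) \<le> ln (real N * real N)" using N by (subst ln_le_cancel_iff) auto
      then show ?thesis using N by (simp add: ln_mult L_def)
    qed
    have "\<bar>?E\<bar> \<le> (\<Sum>n\<in>{N<..N + H}. 256 * L ^ 8 * real H)"
    proof (rule order_trans[OF sum_abs sum_mono])
      fix n assume n: "n \<in> {N<..N + H}"
      then have "ln (real n) \<le> ln (real (N + H))" by (subst ln_le_cancel_iff) auto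
      then have "ln (real n) \<le> 2 * L" using lN by linarith
      then have "ln (real n) ^ 8 \<le> (2 * L) ^ 8" using n N by (intro power_mono) auto
      then have "\<bar>?a n\<bar> \<le> 256 * L ^ 8" using a[of n] n by (simp add: power_mult_distrib)
      moreover have "\<bar>real (N + H) - real n\<bar> \<le> real H" using n by auto
      ultimately have "\<bar>?a n\<bar> * \<bar>real (N + H) - real n\<bar> \<le> 256 * L ^ 8 * real H"
        using L1 by (intro mult_mono) auto
      then show "\<bar>?a n * (real (N + H) - real n)\<bar> \<le> 256 * L ^ 8 * real H" by (simp only: abs_mult)
    qed
    then have E: "\<bar>?E\<bar> \<le> real H * (256 * L ^ 8 * real H)" by simp
    have "(real (N + H)) ^ 2 \<le> (2 * real N) ^ 2" using HN by (intro power_mono) auto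
    then have T1: "\<bar>?T (N + H)\<bar> \<le> C * (2 * real N) ^ 2"
      using C(2)[of "N + H"] N C(1) by (meson mult_left_mono order_trans less_imp_le le_add1)
    have T2: "\<bar>?T N\<bar> \<le> C * real N ^ 2" using C(2)[of N] N by simp
    have "real H * \<bar>\<Sum>n\<in>{1..N}. ?a n\<bar> = \<bar>?T (N + H) - ?T N - ?E\<bar>"
      unfolding eq[symmetric] by (simp add: abs_mult)
    also have "\<dots> \<le> 5 * C * real N ^ 2 + real H * (256 * L ^ 8 * real H)"
      using T1 T2 E by (simp add: power_mult_distrib)
    also have "real N ^ 2 = (real N / L ^ 4) * (real N * L ^ 4)" using L1 by (simp add: power2_eq_square)
    also have "5 * C * \<dots> \<le> 5 * C * (real H * (real N * L ^ 4))"
      using H1(1) C(1) L1 by (intro mult_left_mono mult_right_mono) auto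
    also have "real H * (256 * L ^ 8 * real H) \<le> real H * (256 * L ^ 8 * (25 * (real N / L ^ 4)))"
      using H25 L1 by (intro mult_left_mono) auto
    also have "256 * L ^ 8 * (25 * (real N / L ^ 4)) = 256 * 25 * real N * L ^ 4"
    proof -
      have "256 * (A * A) * (25 * (real N / A)) = 256 * 25 * real N * A" if "A \<noteq> 0" for A
        using that by simp
      from this[of "L ^ 4"] show ?thesis unfolding L8 using L1 by (metis power_not_zero not_one_le_zero)
    qed
    finally have "real H * \<bar>\<Sum>n\<in>{1..N}. ?a n\<bar> \<le> real H * ((5 * C + 256 * 25) * real N * L ^ 4)"
      by (simp add: algebra_simps)
    then show ?thesis using Hpos by (simp add: L_def)
  qed
  show thesis by (rule that[of "5 * C + 256 * 25"]) (use main C in auto)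
qed

text \<open>Partial summation divides by ln n ^ 8. It is done only above sqrt N, where ln n is at
  least half of ln N, so that the division costs the constant 2^8; the terms up to sqrt N are
  estimated trivially. Of the eight logarithms four are used up by the bound for the weighted
  sum.\<close>

lemma mertens_bound:
  obtains C where "C > 0" "\<And>N. N \<ge> 2 \<Longrightarrow> \<bar>mertens N\<bar> \<le> C * real N / ln (real N) ^ 4"
proof -
  obtain C where C: "C > 0"
    "\<And>N. N \<ge> 3 \<Longrightarrow> \<bar>\<Sum>n\<in>{1..N}. real_of_int (moebius n) * ln (real n) ^ 8\<bar> \<le> C * real N * ln (real N) ^ 4"
    by (rule moebius_ln_power_bound) blast
  let ?a = "\<lambda>n. real_of_int (moebius n) * ln (real n) ^ 8"
  have large: "\<bar>mertens N\<bar> \<le> (384 + 512 * C) * real N / ln (real N) ^ 4" if N: "N \<ge> 9" for N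
  proof -
    define R where "R = nat \<lfloor>sqrt (real N)\<rfloor>"
    define L where "L = ln (real N)"
    have L1: "L \<ge> 1" unfolding L_def using N by (intro one_le_ln) simp
    have s3: "3 \<le> sqrt (real N)" by (rule real_le_rsqrt) (use N in simp)
    then have R3: "R \<ge> 3" unfolding R_def by (simp add: le_nat_floor)
    have R1: "real R \<le> sqrt (real N)" unfolding R_def using s3 by (simp add: of_nat_floor)
    have R2: "sqrt (real N) \<le> real (Suc R)" unfolding R_def using s3 by linarith
    have "real N * 1 < real N * real N" using N by (intro mult_strict_left_mono) auto
    then have "sqrt (real N) < real N" by (intro real_less_lsqrt) (auto simp: power2_eq_square)
    then have RN: "R < N" using R1 by linarith
    have half: "ln (sqrt (real N)) = L / 2" using N by (simp add: L_def ln_sqrt)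
    have sq: "sqrt (real N) \<le> 384 * real N / L ^ 4"
    proof -
      have "(L / 2) ^ 4 \<le> fact 4 * exp (L / 2)" using L1 by (intro power_le_fact_exp) simp
      also have "exp (L / 2) = sqrt (real N)" using N unfolding half[symmetric] by simp
      finally have "L ^ 4 \<le> 384 * sqrt (real N)" by (simp add: power_divide fact_numeral)
      then have "L ^ 4 * sqrt (real N) \<le> 384 * sqrt (real N) * sqrt (real N)" by (intro mult_right_mono) auto
      also have "\<dots> = 384 * real N" by (simp only: mult.assoc real_sqrt_mult_self abs_of_nat)
      finally show ?thesis using L1 by (simp add: pos_le_divide_eq mult.commute)
    qed
    have aA: "\<bar>\<Sum>n\<in>{R<..m}. ?a n\<bar> \<le> 2 * C * real N * L ^ 4" if m: "R < m" "m \<le> N" for m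
    proof -
      have bnd: "\<bar>\<Sum>n\<in>{1..j}. ?a n\<bar> \<le> C * real N * L ^ 4" if "3 \<le> j" "j \<le> N" for j
      proof -
        have "ln (real j) ^ 4 \<le> L ^ 4" using that unfolding L_def by (intro power_mono) auto
        then have "C * real j * ln (real j) ^ 4 \<le> C * real N * L ^ 4"
          using that C(1) by (intro mult_mono) auto
        then show ?thesis using C(2)[of j] that by linarith
      qed
      have "{1..m} = {1..R} \<union> {R<..m}" using m by auto
      then have "(\<Sum>n\<in>{1..m}. ?a n) = (\<Sum>n\<in>{1..R}. ?a n) + (\<Sum>n\<in>{R<..m}. ?a n)"
        by (simp only:) (rule sum.union_disjoint; auto)
      then show ?thesis using bnd[of m] bnd[of R] m R3 by linarith
    qed
    have "\<bar>\<Sum>n\<in>{R<..N}. ?a n * (1 / ln (real n) ^ 8)\<bar> \<le> 2 * C * real N * L ^ 4 * (1 / ln (real (Suc R)) ^ 8)"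
    proof (rule abel_bound[OF aA _ _ RN])
      show "1 / ln (real n) ^ 8 \<le> 1 / ln (real m) ^ 8" if "R < m" "m \<le> n" for m n
        using that R3 by (intro divide_left_mono power_mono mult_pos_pos zero_less_power) auto
      show "0 \<le> 1 / ln (real n) ^ 8" if "R < n" for n using that by simp
    qed
    also have "1 / ln (real (Suc R)) ^ 8 \<le> 1 / (L / 2) ^ 8"
    proof (intro divide_left_mono power_mono mult_pos_pos zero_less_power)
      show "L / 2 \<le> ln (real (Suc R))" unfolding half[symmetric] using R2 s3 N by (subst ln_le_cancel_iff) auto
    qed (use L1 R3 in auto)
    then have "2 * C * real N * L ^ 4 * (1 / ln (real (Suc R)) ^ 8) \<le> 2 * C * real N * L ^ 4 * (1 / (L / 2) ^ 8)"
      using C(1) L1 by (intro mult_left_mono) auto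
    also have "2 * C * real N * L ^ 4 * (1 / (L / 2) ^ 8) = 512 * C * real N / L ^ 4"
    proof -
      have L8: "L ^ 8 = L ^ 4 * L ^ 4" using power_add[of L 4 4] by simp
      have "2 * C * real N * A * (1 / (A * A / 2 ^ 8)) = 512 * C * real N / A" if "A \<noteq> 0" for A
        using that by simp
      from this[of "L ^ 4"] show ?thesis unfolding power_divide L8 using L1 by (metis power_not_zero not_one_le_zero)
    qed
    also have "(\<Sum>n\<in>{R<..N}. ?a n * (1 / ln (real n) ^ 8)) = (\<Sum>n\<in>{R<..N}. real_of_int (moebius n))"
      using R3 by (intro sum.cong refl) auto
    finally have tail: "\<bar>\<Sum>n\<in>{R<..N}. real_of_int (moebius n)\<bar> \<le> 512 * C * real N / L ^ 4" .
    have "{1..N} = {1..R} \<union> {R<..N}" using RN by auto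
    then have "mertens N = mertens R + (\<Sum>n\<in>{R<..N}. real_of_int (moebius n))"
      unfolding mertens_def by (simp only:) (rule sum.union_disjoint; auto)
    then have "\<bar>mertens N\<bar> \<le> 384 * real N / L ^ 4 + 512 * C * real N / L ^ 4"
      using tail abs_mertens_le[of R] R1 sq by linarith
    then show ?thesis by (simp add: L_def algebra_simps add_divide_distrib)
  qed
  have small: "\<bar>mertens N\<bar> \<le> 4096 * real N / ln (real N) ^ 4" if N: "N \<ge> 2" "N < 9" for N
  proof -
    have "ln (real N) \<le> 8" using ln_le_minus_one[of "real N"] N by simp
    then have "ln (real N) ^ 4 \<le> 8 ^ 4" using N by (intro power_mono) auto
    moreover have "ln (real N) ^ 4 > 0" using N by simp
    ultimately have "real N \<le> 4096 * real N / ln (real N) ^ 4"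
      by (simp add: pos_le_divide_eq mult_left_mono mult.commute)
    then show ?thesis using abs_mertens_le[of N] by linarith
  qed
  show thesis
  proof (rule that[of "4096 + 512 * C"])
    show "4096 + 512 * C > 0" using C by simp
    fix N :: nat assume N: "N \<ge> 2"
    have l: "ln (real N) ^ 4 > 0" using N by simp
    have "384 + 512 * C \<le> 4096 + 512 * C" "4096 \<le> 4096 + 512 * C" using C by auto
    then have "(384 + 512 * C) * real N / ln (real N) ^ 4 \<le> (4096 + 512 * C) * real N / ln (real N) ^ 4"
      "4096 * real N / ln (real N) ^ 4 \<le> (4096 + 512 * C) * real N / ln (real N) ^ 4"
      using l by (intro divide_right_mono mult_right_mono; simp)+
    then show "\<bar>mertens N\<bar> \<le> (4096 + 512 * C) * real N / ln (real N) ^ 4"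
      using large[of N] small[of N] N by (cases "N \<ge> 9") (auto intro: order_trans)
  qed
qed

section \<open>Sums with a prescribed least prime factor\<close>

text \<open>For k \<le> sqrt n the quotient n / k is at least sqrt n. A cube in place of the square
  absorbs the rounding of \<open>div\<close>, so that its logarithm is still at least a third of ln
  n.\<close>

lemma div_cube_ge:
  fixes k n :: nat
  assumes "k > 0" "k ^ 2 \<le> n" "n \<ge> 2"
  shows "n div k \<ge> 2" and "n \<le> (n div k) ^ 3" and "ln (real n) \<le> 3 * ln (real (n div k))"
proof -
  let ?z = "n div k"
  have kz: "k \<le> ?z" using assms by (simp add: less_eq_div_iff_mult_less_eq power2_eq_square)
  have "n < k * (?z + 1)" using assms dividend_less_times_div[of k n] by (simp add: mult.commute)
  also have "\<dots> \<le> ?z * (?z + 1)" using kz by (intro mult_right_mono) auto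
  finally have 1: "n < ?z * (?z + 1)" .
  show z2: "?z \<ge> 2"
  proof (rule ccontr)
    assume "\<not> ?z \<ge> 2"
    then have "?z * (?z + 1) \<le> 1 * (1 + 1)" by (intro mult_mono) auto
    then show False using 1 assms by simp
  qed
  have "?z + 1 \<le> ?z * ?z" using z2 mult_le_mono1[OF z2, of ?z] by linarith
  then have "?z * (?z + 1) \<le> ?z * (?z * ?z)" by (rule mult_le_mono2)
  then show 2: "n \<le> ?z ^ 3" using 1 by (simp add: power3_eq_cube)
  have "ln (real n) \<le> ln (real (?z ^ 3))" using 2 assms z2 by (subst ln_le_cancel_iff) auto
  also have "\<dots> = 3 * ln (real ?z)" using z2 by (simp add: ln_realpow)
  finally show "ln (real n) \<le> 3 * ln (real ?z)" .
qed

lemma real_div_le: "real (n div k) \<le> real n / real k"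
proof (cases "k = 0")
  case False
  have "real (n div k * k) \<le> real n" by (subst of_nat_le_iff) (rule div_times_less_eq_dividend)
  then show ?thesis using False by (simp add: pos_le_divide_eq)
qed simp

lemma inverse_one_minus_le_exp:
  assumes "0 \<le> x" "x \<le> (3 / 4 :: real)"
  shows "1 / (1 - x) \<le> exp (4 * x)"
proof -
  have "1 / (1 - x) \<le> 1 + 4 * x"
  proof -
    have "x * (3 - 4 * x) \<ge> 0" using assms by (intro mult_nonneg_nonneg) auto
    then show ?thesis using assms by (simp add: divide_le_eq algebra_simps)
  qed
  also have "\<dots> \<le> exp (4 * x)" by simp
  finally show ?thesis .
qed

lemma abs_mertens_sifted_le_card:
  "\<bar>mertens_sifted P t\<bar> \<le> real (card {m. m \<in> {1..t} \<and> squarefree m \<and> (\<forall>q\<in>P. \<not> q dvd m)})"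
proof -
  let ?A = "{m. m \<in> {1..t} \<and> (\<forall>q\<in>P. \<not> q dvd m)}"
  have "\<bar>mertens_sifted P t\<bar> \<le> (\<Sum>m\<in>?A. \<bar>real_of_int (moebius m)\<bar>)"
    unfolding mertens_sifted_def by (rule sum_abs)
  also have "\<dots> = (\<Sum>m\<in>?A. if squarefree m then 1 else 0)"
    by (intro sum.cong refl) (auto simp: moebius_def power_abs)
  also have "\<dots> = real (card {m \<in> ?A. squarefree m})"
    by (simp add: sum.If_cases Int_def)
  also have "{m \<in> ?A. squarefree m} = {m. m \<in> {1..t} \<and> squarefree m \<and> (\<forall>q\<in>P. \<not> q dvd m)}" by auto
  finally show ?thesis .
qed

text \<open>The exponent \<open>\<delta> = 1 / (4 ln p)\<close> of Rankin's trick keeps every Euler factor \<open>r powr (\<delta> - 1)\<close>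
  with \<open>r \<le> p\<close> below both \<open>3 / 4\<close> and \<open>2 / r\<close>.\<close>

lemma sum_large_smooths_le:
  fixes v :: nat
  assumes p: "prime p" and q: "prime q" and n: "n \<ge> 3" and v: "real v \<ge> 216 * ln (ln (real n))"
    and t: "p ^ v \<le> t" "t \<le> n" "p \<le> n"
  defines "P \<equiv> insert q {r. prime r \<and> r \<le> p}"
  shows "(\<Sum>d | d \<in> smooths P t \<and> t < d ^ 2. 1 / real d) \<le> exp 100 / ln (real n) ^ 3"
proof -
  have p2: "p \<ge> 2" using p by (rule prime_ge_2_nat)
  have tp: "t > 0" using t(1) p2 by (metis gr_zeroI le_zero_eq power_eq_0_iff not_numeral_le_zero)
  have lp: "ln (real p) \<ge> 2 / 3"
  proof -
    have "ln 2 \<le> ln (real p)" using p2 by simp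
    then show ?thesis using ln2_ge_two_thirds by linarith
  qed
  define \<delta> where "\<delta> = 1 / (4 * ln (real p))"
  have \<delta>: "0 < \<delta>" "\<delta> \<le> 1 / 2" using lp by (auto simp: \<delta>_def divide_simps)
  have ln1: "ln (real n) \<ge> 1" using n by (intro one_le_ln) simp
  have Pprime: "\<And>r. r \<in> P \<Longrightarrow> prime r" and finP: "finite P" using q by (auto simp: P_def)
  let ?g = "\<lambda>d. real d powr (\<delta> - 1)"
  have g34: "?g r \<le> 3 / 4" if "r \<ge> 2" for r
  proof -
    have "?g r \<le> 2 powr (\<delta> - 1)" using that \<delta> by (intro powr_mono2') auto
    also have "\<dots> \<le> 2 powr (- (1 / 2))" using \<delta> by (intro powr_mono) auto
    also have "\<dots> = 1 / sqrt 2" by (simp add: powr_minus_divide powr_half_sqrt)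
    also have "\<dots> \<le> 3 / 4"
    proof -
      have "4 / 3 \<le> sqrt 2" by (rule real_le_rsqrt) (simp add: power2_eq_square)
      then show ?thesis by (simp add: divide_simps)
    qed
    finally show ?thesis .
  qed
  have "1 / real d \<le> real t powr (- \<delta> / 2) * ?g d" if "d \<in> smooths P t" "t < d ^ 2" for d
  proof -
    have d: "d > 0" using that by (simp add: smooths_def)
    have "real t < real (d ^ 2)" using that(2) by (subst of_nat_less_iff)
    then have "real t powr (\<delta> / 2) \<le> real (d ^ 2) powr (\<delta> / 2)" using \<delta> by (intro powr_mono2) auto
    also have "\<dots> = real d powr \<delta>" using d by (simp add: powr_powr flip: powr_numeral)
    finally have "real t powr (- \<delta> / 2) * real d powr \<delta> \<ge> 1"
      using tp by (simp add: powr_minus field_simps)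
    then have "1 / real d \<le> real t powr (- \<delta> / 2) * real d powr \<delta> / real d"
      using d by (intro divide_right_mono) auto
    then show ?thesis using d by (simp add: powr_diff)
  qed
  then have "(\<Sum>d | d \<in> smooths P t \<and> t < d ^ 2. 1 / real d)
      \<le> (\<Sum>d | d \<in> smooths P t \<and> t < d ^ 2. real t powr (- \<delta> / 2) * ?g d)"
    by (intro sum_mono) auto
  also have "\<dots> \<le> (\<Sum>d\<in>smooths P t. real t powr (- \<delta> / 2) * ?g d)"
    by (intro sum_mono2) auto
  also have "\<dots> = real t powr (- \<delta> / 2) * (\<Sum>d\<in>smooths P t. ?g d)" by (simp add: sum_distrib_left)
  also have "(\<Sum>d\<in>smooths P t. ?g d) \<le> (\<Prod>r\<in>P. 1 / (1 - ?g r))"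
  proof (rule sum_smooths_mult_le[OF finP Pprime])
    show "?g r < 1" if "r \<in> P" for r using g34[of r] Pprime[OF that] prime_ge_2_nat[of r] by linarith
  qed (auto simp: powr_mult)
  also have "\<dots> \<le> (\<Prod>r\<in>P. exp (4 * ?g r))"
  proof (intro prod_mono conjI)
    fix r assume "r \<in> P"
    then have "?g r \<le> 3 / 4" using g34[of r] Pprime[of r] prime_ge_2_nat[of r] by linarith
    then show "1 / (1 - ?g r) \<le> exp (4 * ?g r)" "0 \<le> 1 / (1 - ?g r)"
      by (auto intro: inverse_one_minus_le_exp)
  qed
  also have "\<dots> = exp (\<Sum>r\<in>P. 4 * ?g r)" using finP by (simp add: exp_sum)
  \<comment> \<open>The prime q may be much larger than p, so that \<delta> is not adapted to it; as
    a single factor it contributes only a bounded amount and is split off.\<close>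
  also have "(\<Sum>r\<in>P. 4 * ?g r) \<le> 4 + 8 * (3 * ln (ln (real n)) + 12)"
  proof -
    have "(\<Sum>r\<in>P. 4 * ?g r) \<le> (\<Sum>r\<in>{q}. 4 * ?g r) + (\<Sum>r | prime r \<and> r \<le> p. 4 * ?g r)"
    proof (cases "q \<in> {r. prime r \<and> r \<le> p}")
      case True
      then have "P = {r. prime r \<and> r \<le> p}" by (auto simp: P_def)
      then show ?thesis by simp
    qed (simp add: P_def)
    also have "(\<Sum>r\<in>{q}. 4 * ?g r) \<le> 4" using g34[of q] prime_ge_2_nat[OF q] by simp
    also have "(\<Sum>r | prime r \<and> r \<le> p. 4 * ?g r) \<le> (\<Sum>r | prime r \<and> r \<le> p. 8 * (1 / real r))"
    proof (rule sum_mono)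
      fix r assume r: "r \<in> {r. prime r \<and> r \<le> p}"
      then have r2: "r \<ge> 2" by (auto dest: prime_ge_2_nat)
      have "real r powr \<delta> \<le> real p powr \<delta>" using r \<delta> by (intro powr_mono2) auto
      also have "\<dots> = exp (1 / 4)" using p2 lp by (simp add: powr_def \<delta>_def)
      also have "\<dots> \<le> 2"
        using exp_bound[of "1/4"] by (simp add: power2_eq_square)
      finally show "4 * ?g r \<le> 8 * (1 / real r)" using r2 by (simp add: powr_diff divide_right_mono)
    qed
    also have "\<dots> = 8 * (\<Sum>r | prime r \<and> r \<le> p. 1 / real r)" by (rule sum_distrib_left[symmetric])
    also have "(\<Sum>r | prime r \<and> r \<le> p. 1 / real r) \<le> (\<Sum>r | prime r \<and> r \<le> n. 1 / real r)"
      using t by (intro sum_mono2) auto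
    also have "\<dots> \<le> 3 * ln (ln (real n)) + 12" by (rule sum_prime_reciprocals_le[OF n])
    finally show ?thesis by simp
  qed
  also have "exp (4 + 8 * (3 * ln (ln (real n)) + 12)) = exp 100 * ln (real n) ^ 24"
  proof -
    have "exp (4 + 8 * (3 * ln (ln (real n)) + 12)) = exp 100 * exp (real 24 * ln (ln (real n)))"
      by (simp add: exp_add[symmetric])
    also have "exp (real 24 * ln (ln (real n))) = ln (real n) ^ 24"
      unfolding exp_of_nat_mult using ln1 by simp
    finally show ?thesis .
  qed
  \<comment> \<open>Since t \<ge> p^v, the saving is at least exp (v \<delta> ln p / 2) = exp (v /
    8), and v / 8 is at least 27 ln ln n: this is the origin of 216. The Euler product loses 24 = 8
    * 3 of the 27 logarithms.\<close>
  also have "real t powr (- \<delta> / 2) \<le> 1 / ln (real n) ^ 27"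
  proof -
    have "ln (real n) ^ 27 = exp (real 27 * ln (ln (real n)))"
      unfolding exp_of_nat_mult using ln1 by simp
    also have "\<dots> \<le> exp (real v * ln (real p) * (\<delta> / 2))"
      using v lp by (simp add: \<delta>_def)
    also have "\<dots> = real (p ^ v) powr (\<delta> / 2)" using p2 by (simp add: powr_def ln_realpow mult_ac)
    also have "\<dots> \<le> real t powr (\<delta> / 2)" using t \<delta> by (intro powr_mono2) (auto simp del: of_nat_power)
    finally have "ln (real n) ^ 27 \<le> real t powr (\<delta> / 2)" .
    moreover have "ln (real n) ^ 27 > 0" using ln1 by simp
    ultimately have "1 / real t powr (\<delta> / 2) \<le> 1 / ln (real n) ^ 27" by (intro frac_le) auto
    then show ?thesis by (simp add: powr_minus_divide)
  qed
  finally have "(\<Sum>d | d \<in> smooths P t \<and> t < d ^ 2. 1 / real d) \<le> 1 / ln (real n) ^ 27 * (exp 100 * ln (real n) ^ 24)"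
    by (simp add: mult_left_mono mult_right_mono)
  also have "\<dots> = exp 100 / ln (real n) ^ 3"
  proof -
    have e27: "ln (real n) ^ 27 = ln (real n) ^ 24 * ln (real n) ^ 3"
      using power_add[of "ln (real n)" 24 3] by simp
    have "1 / (A * B) * (exp 100 * A) = exp 100 / B" if "A \<noteq> 0" for A B :: real
      using that by simp
    from this[of "ln (real n) ^ 24"] show ?thesis unfolding e27 using ln1 by (metis power_not_zero not_one_le_zero)
  qed
  finally show ?thesis .
qed

text \<open>The sum over d is cut at sqrt t. Below the cut ln (t div d) is at least a third of ln t,
  and the harmonic sum over d uses up one of the four logarithms, with 162 = 2 * 3^4. Above it M is
  bounded trivially and the sparseness of the smooth d is used instead.\<close>

lemma mertens_sifted_bound:
  assumes M: "\<And>N. N \<ge> 2 \<Longrightarrow> \<bar>mertens N\<bar> \<le> C * real N / ln (real N) ^ 4" and C: "C > 0"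
    and p: "prime p" and q: "prime q" and n: "n \<ge> 3" and v: "real v \<ge> 216 * ln (ln (real n))" "v \<ge> 2"
    and t: "p ^ v \<le> t" "t \<le> n"
  shows "\<bar>mertens_sifted (insert q {r. prime r \<and> r \<le> p}) t\<bar> \<le> (162 * C + exp 100) * real t / ln (real t) ^ 3"
proof -
  define P where "P = insert q {r. prime r \<and> r \<le> p}"
  have p2: "p \<ge> 2" using p by (rule prime_ge_2_nat)
  have "2 ^ 2 \<le> p ^ 2" using p2 by (intro power_mono) auto
  also have "p ^ 2 \<le> p ^ v" using p2 v by (intro power_increasing) auto
  finally have t4: "t \<ge> 4" using t by simp
  have "p ^ 1 \<le> p ^ v" using p2 v by (intro power_increasing) auto
  then have pn: "p \<le> n" using t by simp
  have lt: "ln (real t) \<ge> 1" using t4 by (intro one_le_ln) simp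
  have ltn: "ln (real t) \<le> ln (real n)" using t t4 by simp
  have Pprime: "\<And>r. r \<in> P \<Longrightarrow> prime r" and finP: "finite P" using q by (auto simp: P_def)
  have "\<bar>mertens_sifted P t\<bar> \<le> (\<Sum>d\<in>smooths P t. \<bar>mertens (t div d)\<bar>)"
    by (rule abs_mertens_sifted_le[OF finP Pprime])
  also have "\<dots> = (\<Sum>d | d \<in> smooths P t \<and> d ^ 2 \<le> t. \<bar>mertens (t div d)\<bar>) + (\<Sum>d | d \<in> smooths P t \<and> t < d ^ 2. \<bar>mertens (t div d)\<bar>)"
    by (subst sum.union_disjoint[symmetric]) (auto intro!: sum.cong)
  also have "(\<Sum>d | d \<in> smooths P t \<and> t < d ^ 2. \<bar>mertens (t div d)\<bar>) \<le> (\<Sum>d | d \<in> smooths P t \<and> t < d ^ 2. real t * (1 / real d))"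
  proof (rule sum_mono)
    fix d
    show "\<bar>mertens (t div d)\<bar> \<le> real t * (1 / real d)"
      using abs_mertens_le[of "t div d"] real_div_le[of t d] by simp
  qed
  also have "\<dots> = real t * (\<Sum>d | d \<in> smooths P t \<and> t < d ^ 2. 1 / real d)" by (rule sum_distrib_left[symmetric])
  also have "\<dots> \<le> real t * (exp 100 / ln (real n) ^ 3)"
    unfolding P_def by (intro mult_left_mono sum_large_smooths_le[OF p q n v(1) t pn]) auto
  also have "\<dots> \<le> real t * (exp 100 / ln (real t) ^ 3)"
    using lt ltn by (intro mult_left_mono divide_left_mono power_mono mult_pos_pos zero_less_power) auto
  also have "(\<Sum>d | d \<in> smooths P t \<and> d ^ 2 \<le> t. \<bar>mertens (t div d)\<bar>) \<le>
      (\<Sum>d | d \<in> smooths P t \<and> d ^ 2 \<le> t. 81 * C * real t / ln (real t) ^ 4 * (1 / real d))"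
  proof (rule sum_mono)
    fix d assume "d \<in> {d. d \<in> smooths P t \<and> d ^ 2 \<le> t}"
    then have d: "d > 0" "d ^ 2 \<le> t" by (auto simp: smooths_def)
    note dc = div_cube_ge[OF d]
    have z: "t div d \<ge> 2" "ln (real t) \<le> 3 * ln (real (t div d))" using dc t4 by auto
    have "\<bar>mertens (t div d)\<bar> \<le> C * real (t div d) / ln (real (t div d)) ^ 4" by (rule M[OF z(1)])
    also have "\<dots> \<le> C * (real t / real d) / (ln (real t) / 3) ^ 4"
      using z lt C real_div_le[of t d] by (intro frac_le mult_left_mono power_mono) auto
    finally show "\<bar>mertens (t div d)\<bar> \<le> 81 * C * real t / ln (real t) ^ 4 * (1 / real d)"
      by (simp add: power_divide field_simps)
  qed
  also have "\<dots> = 81 * C * real t / ln (real t) ^ 4 * (\<Sum>d | d \<in> smooths P t \<and> d ^ 2 \<le> t. 1 / real d)"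
    by (rule sum_distrib_left[symmetric])
  also have "\<dots> \<le> 81 * C * real t / ln (real t) ^ 4 * (2 * ln (real t))"
  proof (rule mult_left_mono)
    have "(\<Sum>d | d \<in> smooths P t \<and> d ^ 2 \<le> t. 1 / real d) \<le> (\<Sum>d\<in>{1..t}. 1 / real d)"
      by (intro sum_mono2) (auto simp: smooths_def)
    also have "\<dots> \<le> 1 + ln (real t)" using t4 by (intro sum_reciprocals_le) simp
    finally show "(\<Sum>d | d \<in> smooths P t \<and> d ^ 2 \<le> t. 1 / real d) \<le> 2 * ln (real t)" using lt by simp
  qed (use C lt in auto)
  also have "\<dots> = 162 * C * real t / ln (real t) ^ 3" using lt by (simp add: power4_eq_xxxx power3_eq_cube)
  finally show ?thesis by (simp add: P_def algebra_simps add_divide_distrib)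
qed

section \<open>Integers with one fixed small least prime factor\<close>

lemma sum_sifted_multiples:
  assumes "prime q" "q \<notin> P" "\<And>r. r \<in> P \<Longrightarrow> prime r"
  shows "(\<Sum>m | m \<in> {1..X} \<and> (\<forall>r\<in>P. \<not> r dvd m) \<and> q dvd m. real_of_int (moebius m))
    = - mertens_sifted (insert q P) (X div q)"
proof -
  have "{m. m \<in> {1..X} \<and> (\<forall>r\<in>P. \<not> r dvd m)} =
      {m. m \<in> {1..X} \<and> (\<forall>r\<in>insert q P. \<not> r dvd m)} \<union> {m. m \<in> {1..X} \<and> (\<forall>r\<in>P. \<not> r dvd m) \<and> q dvd m}"
    by auto
  then have "mertens_sifted P X = mertens_sifted (insert q P) X +
      (\<Sum>m | m \<in> {1..X} \<and> (\<forall>r\<in>P. \<not> r dvd m) \<and> q dvd m. real_of_int (moebius m))"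
    unfolding mertens_sifted_def by (simp only:) (rule sum.union_disjoint; auto)
  then show ?thesis using mertens_sifted_insert[OF assms, of X] by simp
qed

lemma least_prime_factor_eq_iff:
  assumes "m \<ge> 2"
  shows "least_prime_factor m = p \<longleftrightarrow> prime p \<and> p dvd m \<and> (\<forall>r. prime r \<longrightarrow> r dvd m \<longrightarrow> p \<le> r)"
proof -
  obtain q where "prime q" "q dvd m" using assms prime_factor_nat[of m] by auto
  then have "q \<in> prime_factors m" using assms by (simp add: in_prime_factors_iff)
  then have "prime_factors m \<noteq> {}" by blast
  then show ?thesis
    using assms unfolding least_prime_factor_def by (subst Min_eq_iff) (auto simp: in_prime_factors_iff)
qed

text \<open>For an integer p m with p not dividing m, mu changes sign and omega is 1 + omega(m). The
  1 gives the first term; omega(m), counted as the number of primes q dividing m, gives the sum over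
  q, where the sign of mu(q m') cancels the first one.\<close>

lemma sum_moebius_omega_least_prime_factor:
  fixes p n :: nat
  assumes p: "prime p"
  defines "X \<equiv> n div p" and "P \<equiv> {r. prime r \<and> r \<le> p}"
  shows "(\<Sum>m | m \<in> {2..n} \<and> least_prime_factor m = p. real_of_int (moebius m) * real (omega m))
    = - mertens_sifted P X + (\<Sum>q | prime q \<and> p < q \<and> q \<le> X. mertens_sifted (insert q P) (X div q))"
proof -
  have p2: "p \<ge> 2" using p by (rule prime_ge_2_nat)
  let ?T = "{m. m \<in> {1..X} \<and> (\<forall>r. prime r \<longrightarrow> r dvd m \<longrightarrow> p \<le> r)}"
  let ?A = "{m. m \<in> {1..X} \<and> (\<forall>r\<in>P. \<not> r dvd m)}"
  let ?Q = "{q. prime q \<and> p < q \<and> q \<le> X}"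
  let ?f = "\<lambda>m. real_of_int (moebius m)"
  have img: "{m. m \<in> {2..n} \<and> least_prime_factor m = p} = (\<lambda>m. p * m) ` ?T"
  proof (intro equalityI subsetI)
    fix m assume m: "m \<in> {m. m \<in> {2..n} \<and> least_prime_factor m = p}"
    then have *: "p dvd m" "\<forall>r. prime r \<longrightarrow> r dvd m \<longrightarrow> p \<le> r" "m \<ge> 2" "m \<le> n"
      using least_prime_factor_eq_iff[of m p] by auto
    then obtain e where e: "m = p * e" by blast
    then have "e \<in> ?T" using * p2 by (cases "e = 0") (auto simp: X_def less_eq_div_iff_mult_less_eq mult.commute)
    then show "m \<in> (\<lambda>m. p * m) ` ?T" using e by blast
  next
    fix m assume "m \<in> (\<lambda>m. p * m) ` ?T"
    then obtain e where e: "m = p * e" "e \<ge> 1" "e \<le> X" "\<forall>r. prime r \<longrightarrow> r dvd e \<longrightarrow> p \<le> r" by auto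
    have "m \<le> n" using e p2 by (simp add: X_def less_eq_div_iff_mult_less_eq mult.commute)
    moreover have "m \<ge> 2" using e p2 by (metis le_trans mult_le_mono2 mult.right_neutral)
    moreover have "p \<le> r" if "prime r" "r dvd m" for r
      using that e p by (auto simp: prime_dvd_mult_iff dest: primes_dvd_imp_eq)
    ultimately show "m \<in> {m. m \<in> {2..n} \<and> least_prime_factor m = p}"
      using e p by (auto simp: least_prime_factor_eq_iff)
  qed
  have "(\<Sum>m | m \<in> {2..n} \<and> least_prime_factor m = p. ?f m * real (omega m)) = (\<Sum>m\<in>?T. ?f (p * m) * real (omega (p * m)))"
    unfolding img using p2 by (subst sum.reindex) (auto simp: inj_on_def)
  also have "\<dots> = (\<Sum>m\<in>?T. if p dvd m then 0 else - (?f m * (1 + real (omega m))))"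
    using p by (intro sum.cong refl) (auto simp: moebius_prime_mult omega_prime_mult)
  also have "\<dots> = (\<Sum>m | m \<in> ?T \<and> \<not> p dvd m. - (?f m * (1 + real (omega m))))"
    by (simp add: sum.If_cases Int_def cong: if_cong)
  \<comment> \<open>Multiples of p drop out because mu vanishes at multiples of p^2; all primes up
    to p are then excluded, p included.\<close>
  also have "{m. m \<in> ?T \<and> \<not> p dvd m} = ?A"
  proof (intro equalityI subsetI)
    fix m assume m: "m \<in> {m. m \<in> ?T \<and> \<not> p dvd m}"
    have "\<not> r dvd m" if "r \<in> P" for r
      using m that by (auto simp: P_def dest: antisym)
    then show "m \<in> ?A" using m by auto
  next
    fix m assume m: "m \<in> ?A"
    then have "p \<le> r" if "prime r" "r dvd m" for r
      using that by (auto simp: P_def not_le[symmetric] intro: ccontr)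
    then show "m \<in> {m. m \<in> ?T \<and> \<not> p dvd m}" using m p by (auto simp: P_def)
  qed
  also have "(\<Sum>m\<in>?A. - (?f m * (1 + real (omega m)))) = - mertens_sifted P X - (\<Sum>m\<in>?A. ?f m * real (omega m))"
    unfolding mertens_sifted_def by (simp only: ring_distribs mult_1_right minus_add_distrib sum.distrib sum_negf)
  also have "(\<Sum>m\<in>?A. ?f m * real (omega m)) = (\<Sum>m\<in>?A. \<Sum>q | q \<in> ?Q \<and> q dvd m. ?f m)"
  proof (intro sum.cong refl)
    fix m assume m: "m \<in> ?A"
    have "prime_factors m = {q. q \<in> ?Q \<and> q dvd m}"
    proof (intro equalityI subsetI)
      fix q assume "q \<in> prime_factors m"
      then have q: "prime q" "q dvd m" by auto
      then have "\<not> q \<le> p" using m by (auto simp: P_def)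
      moreover have "q \<le> m" using q m by (intro dvd_imp_le) auto
      then have "q \<le> X" using m by simp
      ultimately show "q \<in> {q. q \<in> ?Q \<and> q dvd m}" using q by auto
    qed (use m in \<open>auto simp: in_prime_factors_iff\<close>)
    then show "?f m * real (omega m) = (\<Sum>q | q \<in> ?Q \<and> q dvd m. ?f m)"
      by (simp add: omega_def)
  qed
  also have "\<dots> = (\<Sum>q\<in>?Q. \<Sum>m | m \<in> ?A \<and> q dvd m. ?f m)"
    by (rule sum.swap_restrict) auto
  also have "\<dots> = (\<Sum>q\<in>?Q. - mertens_sifted (insert q P) (X div q))"
  proof (intro sum.cong refl)
    fix q assume q: "q \<in> ?Q"
    have "{m. m \<in> ?A \<and> q dvd m} = {m. m \<in> {1..X} \<and> (\<forall>r\<in>P. \<not> r dvd m) \<and> q dvd m}" by auto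
    moreover have "prime q" "q \<notin> P" "\<And>r. r \<in> P \<Longrightarrow> prime r" using q by (auto simp: P_def)
    then have "(\<Sum>m | m \<in> {1..X} \<and> (\<forall>r\<in>P. \<not> r dvd m) \<and> q dvd m. ?f m) = - mertens_sifted (insert q P) (X div q)"
      by (rule sum_sifted_multiples)
    ultimately show "(\<Sum>m | m \<in> ?A \<and> q dvd m. ?f m) = - mertens_sifted (insert q P) (X div q)"
      by (simp only:)
  qed
  finally show ?thesis by (simp add: sum_negf)
qed

text \<open>One logarithm is given away and 1 / (m ln m ^ 2) is compared with the decrement of 1 /
  ln. The term m = 2 is estimated separately because ln 1 = 0.\<close>

lemma sum_inverse_mult_ln_cube_le: "(\<Sum>m\<in>{2..N}. 1 / (real m * ln (real m) ^ 3)) \<le> 4"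
proof (cases "N \<ge> 2")
  case True
  have l2: "ln (2::real) \<ge> 2 / 3" by (rule ln2_ge_two_thirds)
  have first: "1 / (2 * ln (2::real) ^ 3) \<le> 2"
  proof -
    have "(2 / 3) ^ 3 \<le> ln (2::real) ^ 3" using l2 by (intro power_mono) auto
    then have "1 \<le> 4 * ln (2::real) ^ 3" by (simp add: power3_eq_cube)
    moreover have "ln (2::real) ^ 3 > 0" by simp
    ultimately show ?thesis by (simp add: divide_le_eq)
  qed
  have telescope: "1 / (real m * ln (real m) ^ 3) \<le> 1 / ln (real (m - 1)) - 1 / ln (real m)" if m: "m \<ge> 3" for m
  proof -
    define a b where "a = ln (real (m - 1))" and "b = ln (real m)"
    have b1: "b \<ge> 1" unfolding b_def using m by (intro one_le_ln) simp
    have a0: "a > 0" unfolding a_def using m by simp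
    have ab: "a \<le> b" unfolding a_def b_def using m by simp
    have "1 / real m \<le> b - a"
      using ln_diff_le[of "real (m - 1)" "real m"] m by (simp add: a_def b_def of_nat_diff field_simps)
    then have "1 / real m * (1 / b ^ 2) \<le> (b - a) * (1 / (a * b))"
      using a0 b1 ab by (intro mult_mono divide_left_mono) (auto simp: power2_eq_square)
    moreover have "(b - a) * (1 / (a * b)) = 1 / a - 1 / b" using a0 b1 by (simp add: field_simps)
    moreover have "1 / (real m * b ^ 3) \<le> 1 / real m * (1 / b ^ 2)"
      using b1 m power_increasing[of 2 3 b] by (auto intro!: divide_left_mono mult_left_mono)
    ultimately show ?thesis by (simp add: a_def b_def)
  qed
  have "(\<Sum>m\<in>{2..N}. 1 / (real m * ln (real m) ^ 3)) \<le> 2 + (1 / ln 2 - 1 / ln (real N))"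
    using True
  proof (induction N rule: dec_induct)
    case base
    then show ?case using first by simp
  next
    case (step n)
    then have "{2..Suc n} = insert (Suc n) {2..n}" by auto
    then show ?case using step.IH step.hyps telescope[of "Suc n"] by simp
  qed
  moreover have "1 / ln 2 \<le> (2::real)" using l2 by (simp add: divide_le_eq)
  moreover have "1 / ln (real N) \<ge> 0" using True by simp
  ultimately show ?thesis by linarith
qed simp

text \<open>The bounds for sifted sums up to t are majorised by sums of \<open>cc m\<close> over m
  \<le> t. With t = X div q the order of summation can then be exchanged: for fixed m one only
  counts primes q \<le> X / m, and Chebyshev's bound for this count supplies the factor 1 / ln
  n.\<close>

lemma abs_sum_least_prime_factor_eq_le:
  fixes v p n :: nat
  assumes M: "\<And>N. N \<ge> 2 \<Longrightarrow> \<bar>mertens N\<bar> \<le> C * real N / ln (real N) ^ 4" and C: "C > 0"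
    and p: "prime p" and n: "n \<ge> 3" and v: "real v \<ge> 216 * ln (ln (real n))" "v \<ge> 2"
    and pn: "p ^ (2 * (v + 1)) \<le> n"
  defines "D \<equiv> 162 * C + exp 100"
  shows "\<bar>\<Sum>m | m \<in> {2..n} \<and> least_prime_factor m = p. real_of_int (moebius m) * real (omega m)\<bar>
    \<le> (427 * D + 144 * exp 4) * real v ^ 3 * real n / ln (real n) * (1 / real p)"
proof -
  define X where "X = n div p"
  define P where "P = {r. prime r \<and> r \<le> p}"
  define Q where "Q = {q. prime q \<and> p < q \<and> q \<le> X}"
  define R where "R = {m \<in> smooths {r. prime r \<and> p < r \<and> r \<le> p ^ v} (p ^ v). squarefree m}"
  \<comment> \<open>The indicator of R serves t < p^v: it counts the squarefree integers without
    primes up to p. The other summand serves t \<ge> p^v and is decreasing in m, so its sum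
    dominates D t / ln t ^ 3; the factor 2 makes up for the missing m = 1.\<close>
  define cc where "cc = (\<lambda>m. (if m \<in> R then 1 else 0) + (if 2 \<le> m then 2 * D / ln (real m) ^ 3 else 0))"
  have p2: "p \<ge> 2" using p by (rule prime_ge_2_nat)
  have D: "D > 0" using C by (simp add: D_def add_pos_pos)
  have ln1: "ln (real n) \<ge> 1" using n by (intro one_le_ln) simp
  have fin: "finite P" "finite Q" "finite R" by (auto simp: P_def Q_def R_def)
  have pv1: "(p ^ (v + 1)) ^ 2 \<le> n" using pn by (simp only: power_mult[symmetric] mult.commute[of 2])
  have "p ^ (v + 1) \<le> p ^ (2 * (v + 1))" using p2 by (intro power_increasing) auto
  then have p1v: "p ^ (v + 1) \<le> n" using pn by linarith
  have pv: "p ^ v \<le> X" using p1v p2 by (simp add: X_def less_eq_div_iff_mult_less_eq mult.commute)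
  have Xn: "X \<le> n" by (simp add: X_def)
  have maj: "\<bar>mertens_sifted (insert q P) t\<bar> \<le> (\<Sum>m\<in>{1..t}. cc m)" if q: "prime q" and t: "t \<le> n" for q t
  proof (cases "p ^ v \<le> t")
    case True
    have "2 ^ 2 \<le> p ^ 2" using p2 by (intro power_mono) auto
    also have "p ^ 2 \<le> p ^ v" using p2 v by (intro power_increasing) auto
    finally have t4: "t \<ge> 4" using True by simp
    have "\<bar>mertens_sifted (insert q P) t\<bar> \<le> D * real t / ln (real t) ^ 3"
      unfolding P_def D_def by (rule mertens_sifted_bound[OF M C p q n v True t])
    also have "\<dots> \<le> (real t - 1) * (2 * D / ln (real t) ^ 3)"
      using D t4 by (auto simp: divide_simps)
    also have "\<dots> = (\<Sum>m\<in>{2..t}. 2 * D / ln (real t) ^ 3)" using t4 by (simp add: of_nat_diff)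
    also have "\<dots> \<le> (\<Sum>m\<in>{2..t}. cc m)"
    proof (rule sum_mono)
      fix m assume m: "m \<in> {2..t}"
      have "2 * D / ln (real t) ^ 3 \<le> 2 * D / ln (real m) ^ 3"
        using m D by (intro divide_left_mono power_mono mult_pos_pos zero_less_power) auto
      then show "2 * D / ln (real t) ^ 3 \<le> cc m" using m by (simp add: cc_def)
    qed
    also have "\<dots> \<le> (\<Sum>m\<in>{1..t}. cc m)"
      using D by (intro sum_mono2) (auto simp: cc_def)
    finally show ?thesis .
  next
    case False
    have "\<bar>mertens_sifted (insert q P) t\<bar> \<le> real (card {m. m \<in> {1..t} \<and> squarefree m \<and> (\<forall>r\<in>insert q P. \<not> r dvd m)})"
      by (rule abs_mertens_sifted_le_card)
    also have "card {m. m \<in> {1..t} \<and> squarefree m \<and> (\<forall>r\<in>insert q P. \<not> r dvd m)} \<le> card (R \<inter> {1..t})"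
    proof (rule card_mono)
      show "{m. m \<in> {1..t} \<and> squarefree m \<and> (\<forall>r\<in>insert q P. \<not> r dvd m)} \<subseteq> R \<inter> {1..t}"
      proof
        fix m assume m: "m \<in> {m. m \<in> {1..t} \<and> squarefree m \<and> (\<forall>r\<in>insert q P. \<not> r dvd m)}"
        have "p < r \<and> r \<le> p ^ v" if r: "prime r" "r dvd m" for r
        proof -
          have "r \<le> m" using r m by (intro dvd_imp_le) auto
          moreover have "\<not> r \<le> p" using r m by (auto simp: P_def)
          ultimately show ?thesis using m False by auto
        qed
        then show "m \<in> R \<inter> {1..t}" using m False by (auto simp: R_def smooths_def in_prime_factors_iff)
      qed
    qed simp
    also have "real (card (R \<inter> {1..t})) = (\<Sum>m\<in>{1..t}. if m \<in> R then 1 else 0)"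
      by (simp add: sum.If_cases Int_commute)
    also have "\<dots> \<le> (\<Sum>m\<in>{1..t}. cc m)" using D by (intro sum_mono) (auto simp: cc_def)
    finally show ?thesis by simp
  qed
  define w where "w = (\<lambda>m. real (card {q. prime q \<and> q \<le> X div m}))"
  have w1: "w m \<le> 18 * real n / (real p * real m * ln (real n))" if m: "m > 0" "(p * m) ^ 2 \<le> n" for m
  proof -
    have eq: "X div m = n div (p * m)" by (simp add: X_def div_mult2_eq)
    have pm: "p * m > 0" using m p2 by simp
    note dc = div_cube_ge[OF pm m(2)]
    have z: "n div (p * m) \<ge> 2" "ln (real n) / 3 \<le> ln (real (n div (p * m)))" using dc n by auto
    have "w m \<le> 6 * real (n div (p * m)) / ln (real (n div (p * m)))"
      unfolding w_def eq by (rule card_primes_le[OF z(1)])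
    also have "\<dots> \<le> 6 * (real n / real (p * m)) / (ln (real n) / 3)"
      using z ln1 real_div_le[of n "p * m"] by (intro frac_le mult_left_mono) auto
    finally show ?thesis by (simp add: field_simps)
  qed
  have w2: "w m \<le> real n / (real p * real m)" if m: "m > 0" for m
  proof -
    have "card {q. prime q \<and> q \<le> X div m} \<le> card {1..X div m}"
      by (intro card_mono) (auto simp: Suc_le_eq prime_gt_0_nat)
    then have "w m \<le> real (X div m)" by (simp add: w_def)
    also have "X div m = n div (p * m)" by (simp add: X_def div_mult2_eq)
    also have "real (n div (p * m)) \<le> real n / real (p * m)" by (rule real_div_le)
    finally show ?thesis by simp
  qed
  have w0: "w m \<ge> 0" for m by (simp add: w_def)
  have "(\<Sum>q\<in>Q. \<bar>mertens_sifted (insert q P) (X div q)\<bar>) \<le> (\<Sum>q\<in>Q. \<Sum>m\<in>{1..X div q}. cc m)"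
    by (intro sum_mono maj) (auto simp: Q_def intro: order_trans[OF div_le_dividend Xn])
  also have "\<dots> = (\<Sum>q\<in>Q. \<Sum>m | m \<in> {1..X} \<and> m * q \<le> X. cc m)"
  proof (intro sum.cong refl)
    fix q assume "q \<in> Q"
    then have q: "q > 0" by (auto simp: Q_def)
    have "m \<le> X" if "m * q \<le> X" for m
      using that q le_trans[of m "m * q" X] by simp
    then show "{1..X div q} = {m. m \<in> {1..X} \<and> m * q \<le> X}"
      using q by (auto simp: less_eq_div_iff_mult_less_eq)
  qed
  also have "\<dots> = (\<Sum>m\<in>{1..X}. \<Sum>q | q \<in> Q \<and> m * q \<le> X. cc m)"
    by (rule sum.swap_restrict) (use fin in auto)
  also have "\<dots> \<le> (\<Sum>m\<in>{1..X}. cc m * w m)"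
  proof (rule sum_mono)
    fix m assume m: "m \<in> {1..X}"
    have "card {q. q \<in> Q \<and> m * q \<le> X} \<le> card {q. prime q \<and> q \<le> X div m}"
      using m by (intro card_mono[OF finite_primes_le]) (auto simp: Q_def less_eq_div_iff_mult_less_eq mult.commute)
    then have "real (card {q. q \<in> Q \<and> m * q \<le> X}) * cc m \<le> w m * cc m"
      using D m by (intro mult_right_mono) (auto simp: w_def cc_def)
    then show "(\<Sum>q | q \<in> Q \<and> m * q \<le> X. cc m) \<le> cc m * w m" by (simp add: mult.commute)
  qed
  also have "\<dots> = (\<Sum>m\<in>{1..X}. if m \<in> R then w m else 0) + (\<Sum>m\<in>{1..X}. if 2 \<le> m then 2 * D / ln (real m) ^ 3 * w m else 0)"
    unfolding sum.distrib[symmetric] by (intro sum.cong refl) (auto simp: cc_def algebra_simps)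
  also have "(\<Sum>m\<in>{1..X}. if m \<in> R then w m else 0) \<le> 144 * exp 4 * real v ^ 3 * real n / ln (real n) * (1 / real p)"
  proof -
    have "(\<Sum>m\<in>{1..X}. if m \<in> R then w m else 0) = (\<Sum>m\<in>{1..X} \<inter> R. w m)"
      by (simp add: sum.inter_restrict)
    also have "\<dots> \<le> (\<Sum>m\<in>R. 18 * real n / (real p * ln (real n)) * (1 / real m))"
    proof (rule sum_le_included[where i = "\<lambda>m. m"])
      show "\<forall>m\<in>{1..X} \<inter> R. \<exists>m'\<in>R. m' = m \<and> w m \<le> 18 * real n / (real p * ln (real n)) * (1 / real m')"
      proof
        fix m assume m: "m \<in> {1..X} \<inter> R"
        then have "m > 0" "m \<le> p ^ v" by (auto simp: R_def smooths_def)
        \<comment> \<open>Chebyshev's bound gains a factor ln n only if p m \<le> sqrt n. For m in R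
          this follows from \<open>pn\<close>, which explains the exponent 2 (v + 1) there.\<close>
        then have "p * m \<le> p ^ (v + 1)" by simp
        then have "(p * m) ^ 2 \<le> (p ^ (v + 1)) ^ 2" by (rule power_mono) simp
        then have "w m \<le> 18 * real n / (real p * real m * ln (real n))"
          using w1[OF \<open>m > 0\<close>] pv1 by linarith
        then show "\<exists>m'\<in>R. m' = m \<and> w m \<le> 18 * real n / (real p * ln (real n)) * (1 / real m')"
          using m by (auto simp: mult_ac)
      qed
    qed (use fin ln1 in auto)
    also have "\<dots> = 18 * real n / (real p * ln (real n)) * (\<Sum>m\<in>R. 1 / real m)" by (rule sum_distrib_left[symmetric])
    also have "\<dots> \<le> 18 * real n / (real p * ln (real n)) * (8 * exp 4 * real v ^ 3)"
    proof (rule mult_left_mono)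
      have "(\<Sum>m\<in>R. 1 / real m) \<le> exp (\<Sum>r | prime r \<and> p < r \<and> r \<le> p ^ v. 1 / real r)"
        unfolding R_def by (rule sum_squarefree_reciprocals_le) auto
      also have "\<dots> \<le> 8 * exp 4 * real v ^ 3" by (rule exp_sum_prime_reciprocals_le[OF p2]) (use v in simp)
      finally show "(\<Sum>m\<in>R. 1 / real m) \<le> 8 * exp 4 * real v ^ 3" .
    qed (use ln1 in auto)
    finally show ?thesis by (simp add: field_simps)
  qed
  also have "(\<Sum>m\<in>{1..X}. if 2 \<le> m then 2 * D / ln (real m) ^ 3 * w m else 0) \<le> 400 * D * real n / ln (real n) * (1 / real p)"
  proof -
    let ?U = "2 * D * 18 * real n / (real p * ln (real n))" and ?V = "2 * D * 64 * real n / (real p * ln (real n) ^ 3)"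
    have "(\<Sum>m\<in>{1..X}. if 2 \<le> m then 2 * D / ln (real m) ^ 3 * w m else 0) = (\<Sum>m\<in>{2..X}. 2 * D / ln (real m) ^ 3 * w m)"
      by (intro sum.mono_neutral_cong_right) auto
    also have "\<dots> \<le> (\<Sum>m\<in>{2..X}. ?U * (1 / (real m * ln (real m) ^ 3)) + ?V * (1 / real m))"
    proof (rule sum_mono)
      fix m assume m: "m \<in> {2..X}"
      then have lm: "ln (real m) > 0" by simp
      have U0: "?U * (1 / (real m * ln (real m) ^ 3)) \<ge> 0" and V0: "?V * (1 / real m) \<ge> 0"
        using D ln1 lm by auto
      show "2 * D / ln (real m) ^ 3 * w m \<le> ?U * (1 / (real m * ln (real m) ^ 3)) + ?V * (1 / real m)"
      \<comment> \<open>In the first case the count of q gains the factor 1 / ln n. In the second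
        case m is large, and its weight already contains 1 / ln n ^ 3, so that the trivial count
        suffices.\<close>
      proof (cases "(p * m) ^ 2 \<le> n")
        case True
        have "2 * D / ln (real m) ^ 3 * w m \<le> 2 * D / ln (real m) ^ 3 * (18 * real n / (real p * real m * ln (real n)))"
          using w1[OF _ True] m D lm by (intro mult_left_mono) auto
        also have "\<dots> = ?U * (1 / (real m * ln (real m) ^ 3))" by (simp add: mult_ac)
        finally show ?thesis using V0 by linarith
      next
        case False
        \<comment> \<open>From p^4 \<le> n and n < (p m)^2 it follows that n < m^4, so that ln m is
          at least a quarter of ln n.\<close>
        have "p ^ 4 \<le> p ^ (2 * (v + 1))" using p2 v by (intro power_increasing) auto
        then have p4: "p ^ 4 \<le> n" using pn by linarith
        have "n * n < (p * m) ^ 2 * (p * m) ^ 2" using False p2 m by (intro mult_strict_mono) auto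
        also have "\<dots> = p ^ 4 * m ^ 4" by (simp add: power_mult_distrib power_add[symmetric] mult_ac)
        also have "\<dots> \<le> n * m ^ 4" using p4 by simp
        finally have "n < m ^ 4" by simp
        then have "ln (real n) \<le> ln (real (m ^ 4))" using n m by (subst ln_le_cancel_iff) auto
        also have "\<dots> = 4 * ln (real m)" using m by (simp add: ln_realpow)
        finally have "ln (real n) / 4 \<le> ln (real m)" by simp
        then have "2 * D / ln (real m) ^ 3 \<le> 2 * D / (ln (real n) / 4) ^ 3"
          using D ln1 lm by (intro divide_left_mono power_mono mult_pos_pos zero_less_power) auto
        then have "2 * D / ln (real m) ^ 3 * w m \<le> 2 * D / (ln (real n) / 4) ^ 3 * (real n / (real p * real m))"
          using w2[of m] w0[of m] m D ln1 by (intro mult_mono) auto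
        also have "\<dots> = ?V * (1 / real m)" by (simp add: power_divide field_simps)
        finally show ?thesis using U0 by linarith
      qed
    qed
    also have "\<dots> = ?U * (\<Sum>m\<in>{2..X}. 1 / (real m * ln (real m) ^ 3)) + ?V * (\<Sum>m\<in>{2..X}. 1 / real m)"
      by (simp only: sum.distrib sum_distrib_left)
    also have "\<dots> \<le> ?U * 4 + ?V * (2 * ln (real n))"
    proof (intro add_mono mult_left_mono sum_inverse_mult_ln_cube_le)
      have "(\<Sum>m\<in>{2..X}. 1 / real m) \<le> (\<Sum>m\<in>{1..n}. 1 / real m)" using Xn by (intro sum_mono2) auto
      also have "\<dots> \<le> 1 + ln (real n)" using n by (intro sum_reciprocals_le) simp
      finally show "(\<Sum>m\<in>{2..X}. 1 / real m) \<le> 2 * ln (real n)" using ln1 by simp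
    qed (use D ln1 in auto)
    also have "?U * 4 = 144 * (D * real n / ln (real n) * (1 / real p))" by simp
    also have "?V * (2 * ln (real n)) = 256 / ln (real n) * (D * real n / ln (real n) * (1 / real p))"
      using ln1 by (simp add: power3_eq_cube)
    also have "256 / ln (real n) * (D * real n / ln (real n) * (1 / real p)) \<le> 256 * (D * real n / ln (real n) * (1 / real p))"
      using D ln1 by (intro mult_right_mono) (auto simp: divide_le_eq)
    finally show ?thesis by (simp add: field_simps)
  qed
  finally have second: "(\<Sum>q\<in>Q. \<bar>mertens_sifted (insert q P) (X div q)\<bar>)
      \<le> 144 * exp 4 * real v ^ 3 * real n / ln (real n) * (1 / real p) + 400 * D * real n / ln (real n) * (1 / real p)" by simp
  have first: "\<bar>mertens_sifted P X\<bar> \<le> 27 * D * real n / ln (real n) * (1 / real p)"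
  proof -
    \<comment> \<open>The bound for sifted sums is stated with an extra prime q; choosing q = p
      covers the sum without one.\<close>
    have Pp: "insert p P = P" using p by (auto simp: P_def)
    have "p ^ 2 \<le> p ^ (2 * (v + 1))" using p2 by (intro power_increasing) auto
    then have "p ^ 2 \<le> n" using pn by linarith
    note dc = div_cube_ge[OF _ this]
    have z: "X \<ge> 2" "ln (real n) / 3 \<le> ln (real X)" using dc p2 n by (auto simp: X_def)
    have "\<bar>mertens_sifted P X\<bar> \<le> D * real X / ln (real X) ^ 3"
      using mertens_sifted_bound[OF M C p p n v pv Xn] unfolding P_def[symmetric] Pp D_def .
    also have "\<dots> \<le> D * (real n / real p) / (ln (real n) / 3) ^ 3"
      using z D ln1 real_div_le[of n p] by (intro frac_le mult_left_mono power_mono) (auto simp: X_def)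
    also have "\<dots> = 27 * D * real n * (1 / real p) / ln (real n) ^ 3" by (simp add: power_divide field_simps)
    also have "\<dots> \<le> 27 * D * real n * (1 / real p) / ln (real n)"
      using D ln1 power_increasing[of 1 3 "ln (real n)"] by (intro frac_le) auto
    finally show ?thesis by (simp add: field_simps)
  qed
  have "\<bar>\<Sum>m | m \<in> {2..n} \<and> least_prime_factor m = p. real_of_int (moebius m) * real (omega m)\<bar>
      \<le> \<bar>mertens_sifted P X\<bar> + \<bar>\<Sum>q\<in>Q. mertens_sifted (insert q P) (X div q)\<bar>"
    unfolding sum_moebius_omega_least_prime_factor[OF p] X_def P_def Q_def by linarith
  also have "\<dots> \<le> \<bar>mertens_sifted P X\<bar> + (\<Sum>q\<in>Q. \<bar>mertens_sifted (insert q P) (X div q)\<bar>)"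
    by (intro add_left_mono sum_abs)
  also have "\<dots> \<le> 427 * D * (real n / ln (real n) * (1 / real p)) + 144 * exp 4 * real v ^ 3 * (real n / ln (real n) * (1 / real p))"
    using first second by simp
  also have "\<dots> \<le> 427 * D * real v ^ 3 * (real n / ln (real n) * (1 / real p)) + 144 * exp 4 * real v ^ 3 * (real n / ln (real n) * (1 / real p))"
  proof (intro add_right_mono mult_right_mono)
    have "1 \<le> real v ^ 3" using v by (intro one_le_power) simp
    then show "427 * D \<le> 427 * D * real v ^ 3" using D by simp
  qed (use ln1 in auto)
  finally show ?thesis by (simp add: algebra_simps add_divide_distrib)
qed

section \<open>Integers with a large least prime factor\<close>

lemma ln_squarefree:
  assumes "squarefree (m::nat)"
  shows "ln (real m) = (\<Sum>r\<in>prime_factors m. ln (real r))"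
proof -
  have m: "m > 0" using assms by (cases m) auto
  have "m = (\<Prod>r\<in>prime_factors m. r ^ multiplicity r m)"
    by (rule prime_factorization_nat[OF m])
  also have "\<dots> = (\<Prod>r\<in>prime_factors m. r)"
  proof (intro prod.cong refl)
    fix r assume r: "r \<in> prime_factors m"
    have "multiplicity r m = 1"
      using assms r m squarefree_factorial_semiring'[of m] by auto
    then show "r ^ multiplicity r m = r" by simp
  qed
  finally have "real m = real (\<Prod>r\<in>prime_factors m. r)" by (rule arg_cong[where f = real])
  also have "\<dots> = (\<Prod>r\<in>prime_factors m. real r)" by simp
  finally have "ln (real m) = ln (\<Prod>r\<in>prime_factors m. real r)" by simp
  also have "\<dots> = (\<Sum>r\<in>prime_factors m. ln (real r))"
    by (intro ln_prod) (auto simp: in_prime_factors_iff prime_gt_0_nat)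
  finally show ?thesis .
qed

text \<open>This takes the place of a sieve. Splitting ln m over the primes r dividing m and writing
  m = r e turns the left side into Chebyshev sums theta(n / e) over e, each O(n / e). Dividing by ln
  n later turns the weighted sum into a count.\<close>

lemma sum_ln_squarefree_smooths_le:
  assumes P: "\<And>r. r \<in> P \<Longrightarrow> prime r" and n: "n > 0"
  defines "B \<equiv> {m \<in> smooths P n. squarefree m}"
  shows "(\<Sum>m\<in>B. ln (real m)) \<le> ln 4 * real n * (\<Sum>m\<in>B. 1 / real m)"
proof -
  have finB: "finite B" by (simp add: B_def)
  let ?S = "SIGMA m:B. prime_factors m" and ?T = "SIGMA m:B. {r. prime r \<and> r \<le> n div m}"
  let ?\<phi> = "\<lambda>(m, r). (m div r, r)"
  have inj: "inj_on ?\<phi> ?S"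
  proof (rule inj_onI)
    fix x y assume xy: "x \<in> ?S" "y \<in> ?S" "?\<phi> x = ?\<phi> y"
    then have "fst x div snd x = fst y div snd x" "snd x dvd fst x" "snd x dvd fst y" "snd x = snd y"
      by (auto simp: case_prod_unfold)
    then show "x = y" by (metis dvd_mult_div_cancel prod_eq_iff)
  qed
  have sub: "?\<phi> ` ?S \<subseteq> ?T"
  proof
    fix y assume "y \<in> ?\<phi> ` ?S"
    then obtain m r where y: "y = (m div r, r)" and m: "m \<in> B" and r: "prime r" "r dvd m" by auto
    obtain e where e: "m = r * e" using r by blast
    have r0: "r > 0" using r by (simp add: prime_gt_0_nat)
    have e0: "e > 0" using e m by (cases e) (auto simp: B_def smooths_def)
    have "m \<le> n" using m by (simp add: B_def smooths_def)
    then have "r * e \<le> n" using e by simp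
    then have "r \<le> n div e" using e0 by (simp add: less_eq_div_iff_mult_less_eq)
    moreover have "e \<le> n" using \<open>r * e \<le> n\<close> r0 by (metis le_trans mult_le_mono1 One_nat_def Suc_leI mult_1)
    moreover have "prime_factors e \<subseteq> prime_factors m" using e m by (auto simp: in_prime_factors_iff B_def smooths_def)
    moreover have "squarefree e" using m e by (auto simp: B_def intro: squarefree_mono[of e m])
    ultimately have "e \<in> B" using m e0 by (auto simp: B_def smooths_def)
    moreover have "m div r = e" using e r0 by simp
    ultimately show "y \<in> ?T" using \<open>r \<le> n div e\<close> r by (simp add: y)
  qed
  have "(\<Sum>m\<in>B. ln (real m)) = (\<Sum>m\<in>B. \<Sum>r\<in>prime_factors m. ln (real r))"
    by (intro sum.cong refl ln_squarefree) (simp add: B_def)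
  also have "\<dots> = (\<Sum>(m, r)\<in>?S. ln (real r))" using finB by (subst sum.Sigma) auto
  also have "\<dots> = (\<Sum>x\<in>?\<phi> ` ?S. ln (real (snd x)))"
    by (subst sum.reindex[OF inj]) (auto intro!: sum.cong)
  also have "\<dots> \<le> (\<Sum>x\<in>?T. ln (real (snd x)))"
    using finB sub by (intro sum_mono2) (auto simp: prime_gt_0_nat Suc_le_eq)
  also have "\<dots> = (\<Sum>m\<in>B. \<Sum>r | prime r \<and> r \<le> n div m. ln (real r))"
    using finB by (subst sum.Sigma) (auto intro!: sum.cong)
  also have "\<dots> \<le> (\<Sum>m\<in>B. ln 4 * real n * (1 / real m))"
  proof (rule sum_mono)
    fix m
    have "(\<Sum>r | prime r \<and> r \<le> n div m. ln (real r)) \<le> ln 4 * real (n div m)" by (rule theta_le)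
    also have "\<dots> \<le> ln 4 * (real n / real m)" by (intro mult_left_mono real_div_le) auto
    finally show "(\<Sum>r | prime r \<and> r \<le> n div m. ln (real r)) \<le> ln 4 * real n * (1 / real m)" by simp
  qed
  also have "\<dots> = ln 4 * real n * (\<Sum>m\<in>B. 1 / real m)" by (rule sum_distrib_left[symmetric])
  finally show ?thesis .
qed

text \<open>All prime factors exceed n^(1/u), so there are fewer than u of them, and the integers
  are composed of primes between z and z^(2u). Those above sqrt n have logarithm at least half of ln
  n and are counted by the weighted bound; the others are at most sqrt n in number.\<close>

lemma sum_least_prime_factor_large_le:
  fixes u n :: nat
  assumes n: "n \<ge> 3" and u: "u \<ge> 1" "2 ^ u \<le> n"
  shows "(\<Sum>m | m \<in> {2..n} \<and> n < least_prime_factor m ^ u. \<bar>real_of_int (moebius m) * real (omega m)\<bar>)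
    \<le> (2 + 256 * exp 4) * real u ^ 4 * real n / ln (real n)"
proof -
  have ln1: "ln (real n) \<ge> 1" using n by (intro one_le_ln) simp
  define B where "B = {m. m \<in> {2..n} \<and> n < least_prime_factor m ^ u \<and> squarefree m}"
  have "finite {z. z ^ u \<le> n}"
  proof (rule finite_subset)
    show "{z. z ^ u \<le> n} \<subseteq> {..n}"
    proof
      fix z assume "z \<in> {z. z ^ u \<le> n}"
      moreover have "z \<le> z ^ u" using u by (cases "z = 0") (auto intro: self_le_power)
      ultimately show "z \<in> {..n}" by simp
    qed
  qed simp
  \<comment> \<open>This is the integer part of the u-th root of n; it is at least 2 because 2^u
    \<le> n.\<close>
  moreover define z where "z = Max {z. z ^ u \<le> n}"
  ultimately have z1: "z ^ u \<le> n" and z2: "z \<ge> 2" and z3: "n < (z + 1) ^ u"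
  proof -
    assume fin: "finite {z. z ^ u \<le> n}" and zd: "z = Max {z. z ^ u \<le> n}"
    have "z \<in> {z. z ^ u \<le> n}" unfolding zd using u by (intro Max_in fin) auto
    then show "z ^ u \<le> n" by simp
    show "z \<ge> 2" unfolding zd using u by (intro Max_ge fin) auto
    show "n < (z + 1) ^ u"
    proof (rule ccontr)
      assume "\<not> n < (z + 1) ^ u"
      then have "z + 1 \<le> z" unfolding zd by (intro Max_ge fin) auto
      then show False by simp
    qed
  qed
  \<comment> \<open>The rounding in z is absorbed by z + 1 \<le> z^2. This gives n < z^(2u), and all
    primes that occur lie in an interval to which the bound for the sum of 1/r applies with w =
    2u.\<close>
  have "2 * z \<le> z * z" using z2 by (rule mult_le_mono1)
  then have "z + 1 \<le> z ^ 2" using z2 unfolding power2_eq_square by linarith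
  then have "(z + 1) ^ u \<le> (z ^ 2) ^ u" by (rule power_mono) simp
  then have z4: "n < z ^ (2 * u)" using z3 by (simp add: power_mult)
  define P where "P = {r. prime r \<and> z < r \<and> r \<le> z ^ (2 * u)}"
  have finP: "finite P" by (simp add: P_def)
  define B' where "B' = {m \<in> smooths P n. squarefree m}"
  have lpf: "least_prime_factor m \<le> r" if "m \<in> B" "r \<in> prime_factors m" for m r
    using that least_prime_factor_eq_iff[of m "least_prime_factor m"] by (auto simp: B_def)
  have BB': "B \<subseteq> B'"
  proof
    fix m assume m: "m \<in> B"
    have "r \<in> P" if r: "r \<in> prime_factors m" for r
    proof -
      have "n < least_prime_factor m ^ u" using m by (simp add: B_def)
      also have "\<dots> \<le> r ^ u" using lpf[OF m r] by (rule power_mono) simp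
      finally have "z ^ u < r ^ u" using z1 by linarith
      then have "z < r" by (rule power_less_imp_less_base) simp
      moreover have "r \<le> m" using r m by (intro dvd_imp_le) (auto simp: B_def)
      ultimately show ?thesis using r m z4 by (auto simp: P_def B_def)
    qed
    then show "m \<in> B'" using m by (auto simp: B'_def B_def smooths_def)
  qed
  have om: "real (omega m) \<le> real u" if m: "m \<in> B" for m
  proof -
    define l where "l = least_prime_factor m"
    have "prime l" using m least_prime_factor_eq_iff[of m l] by (auto simp: B_def l_def)
    then have l1: "l > 1" by (rule prime_gt_1_nat)
    have "l ^ omega m = (\<Prod>r\<in>prime_factors m. l)" by (simp add: omega_def)
    also have "\<dots> \<le> \<Prod>(prime_factors m)" using lpf[OF m] by (intro prod_mono) (auto simp: l_def)
    also have "\<dots> \<le> m"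
      using m by (intro dvd_imp_le prod_primes_dvd) (auto simp: B_def)
    also have "m \<le> n" using m by (simp add: B_def)
    also have "n < l ^ u" using m by (simp add: B_def l_def)
    finally have "omega m < u" using l1 by (simp add: power_strict_increasing_iff)
    then show ?thesis by simp
  qed
  have card_B: "real (card B) \<le> sqrt (real n) + 256 * exp 4 * real u ^ 3 * real n / ln (real n)"
  proof -
    let ?B1 = "{m \<in> B. real m \<le> sqrt (real n)}" and ?B2 = "{m \<in> B. sqrt (real n) < real m}"
    have "?B1 \<subseteq> {1..nat \<lfloor>sqrt (real n)\<rfloor>}" by (auto simp: B_def le_nat_floor)
    then have "card ?B1 \<le> card {1..nat \<lfloor>sqrt (real n)\<rfloor>}" by (intro card_mono) auto
    then have "real (card ?B1) \<le> real (nat \<lfloor>sqrt (real n)\<rfloor>)" by (simp only: card_atLeastAtMost of_nat_le_iff diff_Suc_1)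
    also have "\<dots> \<le> sqrt (real n)" by (rule of_nat_floor) simp
    finally have c1: "real (card ?B1) \<le> sqrt (real n)" .
    have "real (card ?B2) * (ln (real n) / 2) = (\<Sum>m\<in>?B2. ln (real n) / 2)" by simp
    also have "\<dots> \<le> (\<Sum>m\<in>?B2. ln (real m))"
    proof (rule sum_mono)
      fix m assume "m \<in> ?B2"
      then have "ln (sqrt (real n)) \<le> ln (real m)" using n by (subst ln_le_cancel_iff) (auto simp: B_def)
      then show "ln (real n) / 2 \<le> ln (real m)" using n by (simp add: ln_sqrt)
    qed
    also have "\<dots> \<le> (\<Sum>m\<in>B'. ln (real m))"
      using BB' by (intro sum_mono2) (auto simp: B'_def smooths_def)
    also have "\<dots> \<le> ln 4 * real n * (\<Sum>m\<in>B'. 1 / real m)"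
      unfolding B'_def using n by (intro sum_ln_squarefree_smooths_le) (auto simp: P_def)
    also have "\<dots> \<le> 2 * real n * (8 * exp 4 * real (2 * u) ^ 3)"
    proof (intro mult_mono)
      show "ln 4 \<le> (2::real)" by (rule ln_4_le_2)
      have "(\<Sum>m\<in>B'. 1 / real m) \<le> exp (\<Sum>r\<in>P. 1 / real r)"
        unfolding B'_def by (rule sum_squarefree_reciprocals_le[OF finP]) (simp add: P_def)
      also have "\<dots> \<le> 8 * exp 4 * real (2 * u) ^ 3"
        unfolding P_def by (rule exp_sum_prime_reciprocals_le[OF z2]) (use u in simp)
      finally show "(\<Sum>m\<in>B'. 1 / real m) \<le> 8 * exp 4 * real (2 * u) ^ 3" .
    qed (auto intro: sum_nonneg)
    finally have c2: "real (card ?B2) \<le> 256 * exp 4 * real u ^ 3 * real n / ln (real n)"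
      using ln1 by (simp add: pos_le_divide_eq power_mult_distrib mult_ac)
    have "B = ?B1 \<union> ?B2" by auto
    then have "card B \<le> card ?B1 + card ?B2" by (metis card_Un_le)
    then have "real (card B) \<le> real (card ?B1) + real (card ?B2)" by linarith
    then show ?thesis using c1 c2 by linarith
  qed
  have "(\<Sum>m | m \<in> {2..n} \<and> n < least_prime_factor m ^ u. \<bar>real_of_int (moebius m) * real (omega m)\<bar>)
      = (\<Sum>m\<in>B. \<bar>real_of_int (moebius m) * real (omega m)\<bar>)"
    by (rule sum.mono_neutral_right) (auto simp: B_def moebius_def)
  also have "\<dots> \<le> (\<Sum>m\<in>B. real u)"
  proof (rule sum_mono)
    fix m assume m: "m \<in> B"
    have "\<bar>real_of_int (moebius m)\<bar> \<le> 1" using abs_moebius_le[of m] by linarith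
    then have "\<bar>real_of_int (moebius m)\<bar> * real (omega m) \<le> 1 * real u"
      using om[OF m] by (intro mult_mono) auto
    then show "\<bar>real_of_int (moebius m) * real (omega m)\<bar> \<le> real u" by (simp add: abs_mult)
  qed
  also have "\<dots> = real u * real (card B)" by simp
  also have "\<dots> \<le> real u * (2 * real n / ln (real n) + 256 * exp 4 * real u ^ 3 * real n / ln (real n))"
    using card_B sqrt_le_over_ln[of n] n by (intro mult_left_mono) auto
  also have "\<dots> \<le> real u * (2 * real u ^ 3 * real n / ln (real n) + 256 * exp 4 * real u ^ 3 * real n / ln (real n))"
  proof (intro mult_left_mono add_right_mono divide_right_mono mult_right_mono)
    have "1 \<le> real u ^ 3" using u by (intro one_le_power) simp
    then show "2 \<le> 2 * real u ^ 3" by simp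
  qed (use ln1 in auto)
  also have "\<dots> = (2 + 256 * exp 4) * real u ^ 4 * real n / ln (real n)"
    by (simp add: power4_eq_xxxx power3_eq_cube algebra_simps add_divide_distrib)
  finally show ?thesis .
qed

lemma sum_moebius_omega_bound:
  obtains K where "K > 0"
    "\<And>n S. n \<ge> 3 \<Longrightarrow> ln (ln (real n)) \<ge> 1 \<Longrightarrow> 436 * ln (ln (real n)) \<le> ln (real n) \<Longrightarrow>
       \<bar>\<Sum>m | m \<in> {2..n} \<and> least_prime_factor m \<in> S. real_of_int (moebius m) * real (omega m)\<bar>
         \<le> K * (real n * ln (ln (real n)) ^ 4 / ln (real n))"
proof -
  obtain C where C: "C > 0" and M: "\<And>N. N \<ge> 2 \<Longrightarrow> \<bar>mertens N\<bar> \<le> C * real N / ln (real N) ^ 4"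
    by (rule mertens_bound) blast
  define K1 where "K1 = 427 * (162 * C + exp 100) + 144 * exp 4"
  have K1: "K1 > 0" using C by (simp add: K1_def add_pos_pos)
  define K2 where "K2 = (2 + 256 * exp 4 :: real)"
  have K2: "K2 > 0" by (simp add: K2_def add_pos_pos)
  let ?f = "\<lambda>m. real_of_int (moebius m) * real (omega m)"
  have main: "\<bar>\<Sum>m | m \<in> {2..n} \<and> least_prime_factor m \<in> S. ?f m\<bar>
      \<le> (K1 * 217 ^ 3 * 15 + K2 * 436 ^ 4) * (real n * ln (ln (real n)) ^ 4 / ln (real n))"
    if n: "n \<ge> 3" and L1: "ln (ln (real n)) \<ge> 1" and Ln: "436 * ln (ln (real n)) \<le> ln (real n)" for n S
  proof -
    define L where "L = ln (ln (real n))"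
    define W where "W = real n / ln (real n)"
    have ln1: "ln (real n) \<ge> 1" using L1 Ln by linarith
    have W: "W \<ge> 0" using ln1 by (simp add: W_def)
    \<comment> \<open>The factor 216 is what Rankin's bound requires; since L \<ge> 1, rounding up
      is covered by 217 L.\<close>
    define v where "v = nat \<lceil>216 * L\<rceil>"
    have v: "real v \<ge> 216 * L" "real v \<le> 217 * L" "v \<ge> 2"
      using L1 unfolding v_def L_def by linarith+
    \<comment> \<open>The same exponent decides between small and large p, so the two estimates
      cover everything. As 2 (217 L + 1) \<le> 436 L, the assumption on 436 yields 2^u \<le>
      n.\<close>
    define u where "u = 2 * (v + 1)"
    have u: "real u \<le> 436 * L" "u \<ge> 1" using v L1 by (auto simp: u_def L_def)
    have "(2::real) ^ u \<le> exp 1 ^ u" using exp_ge_add_one_self[of 1] by (intro power_mono) auto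
    also have "\<dots> = exp (real u)" by (simp add: exp_of_nat_mult[symmetric])
    also have "\<dots> \<le> exp (ln (real n))" using u Ln by (simp add: L_def)
    also have "\<dots> = real n" using n by simp
    finally have un: "2 ^ u \<le> n" by (metis of_nat_le_iff of_nat_numeral of_nat_power)
    define S1 where "S1 = {m. m \<in> {2..n} \<and> least_prime_factor m \<in> S \<and> least_prime_factor m ^ u \<le> n}"
    define S2 where "S2 = {m. m \<in> {2..n} \<and> least_prime_factor m \<in> S \<and> n < least_prime_factor m ^ u}"
    define PS where "PS = {p. prime p \<and> p \<le> n \<and> p \<in> S \<and> p ^ u \<le> n}"
    have fin: "finite S1" "finite S2" "finite PS"
      by (auto simp: S1_def S2_def PS_def intro: finite_subset[of _ "{..n}"])
    have lpf: "prime (least_prime_factor m)" "least_prime_factor m \<le> n" if "m \<in> {2..n}" for m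
    proof -
      have "prime (least_prime_factor m) \<and> least_prime_factor m dvd m"
        using that least_prime_factor_eq_iff[of m "least_prime_factor m"] by auto
      then show "prime (least_prime_factor m)" "least_prime_factor m \<le> n"
        using that dvd_imp_le[of "least_prime_factor m" m] by auto
    qed
    have "{m. m \<in> {2..n} \<and> least_prime_factor m \<in> S} = S1 \<union> S2" by (auto simp: S1_def S2_def)
    then have "(\<Sum>m | m \<in> {2..n} \<and> least_prime_factor m \<in> S. ?f m) = (\<Sum>m\<in>S1. ?f m) + (\<Sum>m\<in>S2. ?f m)"
      by (simp only:) (rule sum.union_disjoint; auto simp: S1_def S2_def)
    moreover have "\<bar>\<Sum>m\<in>S1. ?f m\<bar> \<le> K1 * 217 ^ 3 * 15 * (W * L ^ 4)"
    proof -
      have "(\<Sum>m\<in>S1. ?f m) = (\<Sum>p\<in>PS. \<Sum>m | m \<in> S1 \<and> least_prime_factor m = p. ?f m)"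
        by (rule sum.group[symmetric]) (use fin lpf in \<open>auto simp: S1_def PS_def\<close>)
      also have "\<dots> = (\<Sum>p\<in>PS. \<Sum>m | m \<in> {2..n} \<and> least_prime_factor m = p. ?f m)"
        by (intro sum.cong refl Collect_cong) (auto simp: S1_def PS_def)
      also have "\<bar>\<dots>\<bar> \<le> (\<Sum>p\<in>PS. K1 * real v ^ 3 * real n / ln (real n) * (1 / real p))"
      proof (rule order_trans[OF sum_abs sum_mono])
        fix p assume p: "p \<in> PS"
        show "\<bar>\<Sum>m | m \<in> {2..n} \<and> least_prime_factor m = p. ?f m\<bar> \<le> K1 * real v ^ 3 * real n / ln (real n) * (1 / real p)"
          unfolding K1_def
          by (rule abs_sum_least_prime_factor_eq_le[OF M C]) (use p n v in \<open>auto simp: PS_def u_def L_def\<close>)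
      qed
      also have "\<dots> = K1 * real v ^ 3 * W * (\<Sum>p\<in>PS. 1 / real p)"
        by (simp add: sum_distrib_left W_def)
      also have "\<dots> \<le> K1 * (217 * L) ^ 3 * W * (15 * L)"
      proof (intro mult_mono power_mono)
        have "(\<Sum>p\<in>PS. 1 / real p) \<le> (\<Sum>p | prime p \<and> p \<le> n. 1 / real p)"
          by (intro sum_mono2) (auto simp: PS_def)
        also have "\<dots> \<le> 3 * L + 12" unfolding L_def by (rule sum_prime_reciprocals_le[OF n])
        finally show "(\<Sum>p\<in>PS. 1 / real p) \<le> 15 * L" using L1 by (simp add: L_def)
      qed (use K1 W v L1 in \<open>auto simp: L_def intro: sum_nonneg\<close>)
      also have "\<dots> = K1 * 217 ^ 3 * 15 * (W * L ^ 4)"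
        by (simp add: power_mult_distrib power4_eq_xxxx power3_eq_cube)
      finally show ?thesis .
    qed
    moreover have "\<bar>\<Sum>m\<in>S2. ?f m\<bar> \<le> K2 * 436 ^ 4 * (W * L ^ 4)"
    proof -
      have "\<bar>\<Sum>m\<in>S2. ?f m\<bar> \<le> (\<Sum>m\<in>S2. \<bar>?f m\<bar>)" by (rule sum_abs)
      also have "\<dots> \<le> (\<Sum>m | m \<in> {2..n} \<and> n < least_prime_factor m ^ u. \<bar>?f m\<bar>)"
        by (intro sum_mono2) (auto simp: S2_def)
      also have "\<dots> \<le> K2 * real u ^ 4 * real n / ln (real n)"
        unfolding K2_def by (rule sum_least_prime_factor_large_le[OF n u(2) un])
      also have "\<dots> = K2 * real u ^ 4 * W" by (simp add: W_def)
      also have "\<dots> \<le> K2 * (436 * L) ^ 4 * W"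
        using u K2 W by (intro mult_right_mono mult_left_mono power_mono) auto
      finally show ?thesis by (simp add: power_mult_distrib mult_ac)
    qed
    ultimately have "\<bar>\<Sum>m | m \<in> {2..n} \<and> least_prime_factor m \<in> S. ?f m\<bar>
        \<le> (K1 * 217 ^ 3 * 15 + K2 * 436 ^ 4) * (W * L ^ 4)"
      unfolding distrib_right by linarith
    then show ?thesis by (simp add: W_def L_def)
  qed
  show thesis
    by (rule that[OF _ main]) (use K1 K2 in \<open>auto intro!: add_pos_pos\<close>)
qed

theorem theorem8:
  fixes k l :: nat
  assumes "k \<ge> 1" and "1 \<le> l" and "l \<le> k" and "gcd l k = 1"
  shows "(\<lambda>x::real. \<Sum>n | 2 \<le> n \<and> real n \<le> x \<and> [least_prime_factor n = l] (mod k).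
            real_of_int (moebius n) * real (omega n))
         \<in> O[at_top](\<lambda>x. x * ln (ln x) ^ 4 / ln x)"
proof -
  obtain K where K: "K > 0"
    "\<And>n S. n \<ge> 3 \<Longrightarrow> ln (ln (real n)) \<ge> 1 \<Longrightarrow> 436 * ln (ln (real n)) \<le> ln (real n) \<Longrightarrow>
       \<bar>\<Sum>m | m \<in> {2..n} \<and> least_prime_factor m \<in> S. real_of_int (moebius m) * real (omega m)\<bar>
         \<le> K * (real n * ln (ln (real n)) ^ 4 / ln (real n))"
    by (rule sum_moebius_omega_bound) blast
  have lim: "filterlim (\<lambda>x::real. nat \<lfloor>x\<rfloor>) sequentially at_top"
    by (rule filterlim_compose[OF filterlim_nat_sequentially filterlim_floor_sequentially])
  have "\<forall>\<^sub>F n :: nat in sequentially. ln (ln (real n)) \<ge> 1" by real_asymp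
  then have ev1: "\<forall>\<^sub>F x :: real in at_top. ln (ln (real (nat \<lfloor>x\<rfloor>))) \<ge> 1"
    using lim by (rule eventually_compose_filterlim)
  have "\<forall>\<^sub>F n :: nat in sequentially. 436 * ln (ln (real n)) \<le> ln (real n)" by real_asymp
  then have ev2: "\<forall>\<^sub>F x :: real in at_top. 436 * ln (ln (real (nat \<lfloor>x\<rfloor>))) \<le> ln (real (nat \<lfloor>x\<rfloor>))"
    using lim by (rule eventually_compose_filterlim)
  show ?thesis
  proof (rule bigoI[where c = "2 * K"])
    show "\<forall>\<^sub>F x in at_top. norm (\<Sum>n | 2 \<le> n \<and> real n \<le> x \<and> [least_prime_factor n = l] (mod k).
            real_of_int (moebius n) * real (omega n)) \<le> 2 * K * norm (x * ln (ln x) ^ 4 / ln x)"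
      using ev1 ev2 eventually_ge_at_top[of 4]
    proof eventually_elim
      case (elim x)
      define n where "n = nat \<lfloor>x\<rfloor>"
      have n: "real n \<le> x" "x < real n + 1" "n \<ge> 4" using elim(3) unfolding n_def by linarith+
      have e1: "ln (ln (real n)) \<ge> 1" and e2: "436 * ln (ln (real n)) \<le> ln (real n)"
        using elim by (auto simp: n_def)
      have ln0: "ln (real n) > 0" using n by simp
      \<comment> \<open>Rounding x down to n at most halves the logarithm, which is where the factor
        2 in \<open>2 * K\<close> comes from.\<close>
      have "x \<le> real n * real n" using n mult_right_mono[of 4 "real n" "real n"] by linarith
      then have "ln x \<le> ln (real n * real n)" using elim n by (subst ln_le_cancel_iff) auto
      then have lx: "ln x \<le> 2 * ln (real n)" using n by (simp add: ln_mult)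
      have lx0: "ln x > 0" using elim by simp
      have nx: "ln (real n) \<le> ln x" using n by simp
      then have "ln (ln (real n)) \<le> ln (ln x)" using ln0 lx0 by simp
      then have L: "ln (ln (real n)) ^ 4 \<le> ln (ln x) ^ 4" using e1 by (intro power_mono) auto
      have "\<lfloor>x\<rfloor> \<ge> 0" using elim by simp
      then have "real m \<le> x \<longleftrightarrow> m \<le> n" for m :: nat
        unfolding n_def by (simp add: le_nat_iff le_floor_iff)
      then have "{m. 2 \<le> m \<and> real m \<le> x \<and> [least_prime_factor m = l] (mod k)} =
          {m. m \<in> {2..n} \<and> least_prime_factor m \<in> {p. [p = l] (mod k)}}" by auto
      then have "\<bar>\<Sum>m | 2 \<le> m \<and> real m \<le> x \<and> [least_prime_factor m = l] (mod k). real_of_int (moebius m) * real (omega m)\<bar>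
          \<le> K * (real n * ln (ln (real n)) ^ 4 / ln (real n))"
        using K(2)[of n "{p. [p = l] (mod k)}"] n e1 e2 by simp
      also have "\<dots> \<le> K * (x * ln (ln x) ^ 4 / (ln x / 2))"
        using K(1) n L lx lx0 ln0 elim by (intro mult_left_mono frac_le mult_mono) auto
      also have "\<dots> = 2 * K * \<bar>x * ln (ln x) ^ 4 / ln x\<bar>" using elim lx0 by (simp add: abs_mult)
      finally show ?case by simp
    qed
  qed
qed

end
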